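(* Let $d\ge 2$ be an integer, $q$ a power of a prime $p$ with $q\equiv 1\pmod d$, $t=\frac{q-1}{d}$, $T$ a generator of $\widehat{\mathbb F_q^{\times}}$, and $\lambda\in\mathbb F_q^\times$. Then \begin{align*} \#X_{\lambda}^d(\mathbb F_q)&=\frac{q^{d-1}-1}{q-1}+q^{d-2}\,{}_{d-1}F_{d-2}\left(\left.\begin{array}{cccc}T^t&T^{2t}&\ldots&T^{(d-1)t}\\ {}&\epsilon&\ldots&\epsilon\end{array}\right|\frac{1}{\lambda^d}\right)_q\\ &\quad+\frac1q\sum_{w\in W^{**}}\prod_{i=1}^d g(T^{w_it})+\frac{1}{q-1}\sum_{[w]\in W/\sim,\ [w]\neq[0]}\ \sum_{j=0}^{q-2}\frac{\prod_{i=1}^d g(T^{w_it+j})}{g(T^{dj})}\,T^{dj}(d\lambda). \end{align*}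
   Context: $X_\lambda^d$ is the Dwork hypersurface in $\mathbb P^{d-1}$ defined by $x_1^d+\cdots+x_d^d=d\lambda x_1x_2\cdots x_d$, and $\#X_\lambda^d(\mathbb F_q)$ its number of $\mathbb F_q$-rational points. $W$ is the set of $d$-tuples $w=(w_1,\dots,w_d)$ of integers with $0\le w_i<d$ and $\sum_i w_i\equiv0\pmod d$; $w\sim w'$ if $w-w'$ is congruent modulo $d$ to a multiple of $(1,\dots,1)$; the inner summand depends only on the class $[w]$, and $[0]$ is the class of $(0,\dots,0)$. $W^{**}\subset W$ is the set of tuples with all $w_i\ne0$ and the $w_i$ not all equal. Characters are extended by $\chi(0)=0$; $\epsilon$ is the trivial character. With $\mathrm{tr}:\mathbb F_q\to\mathbb F_p$ the trace, $\zeta$ a fixed primitive $p$-th root of unity and $\theta(x)=\zeta^{\mathrm{tr}(x)}$, the Gauss sum is $g(\chi)=\sum_{x\in\mathbb F_q}\chi(x)\theta(x)$. For characters $A,B$, $\binom{A}{B}:=\frac{B(-1)}{q}\sum_{x\in\mathbb F_q}A(x)\overline B(1-x)$, and Greene's function is ${}_{n+1}F_n\left(\left.\begin{array}{ccc}A_0&\ldots&A_n\\ &B_1\ldots&B_n\end{array}\right|x\right)_q:=\frac{q}{q-1}\sum_\chi\binom{A_0\chi}{\chi}\prod_{i=1}^n\binom{A_i\chi}{B_i\chi}\chi(x)$, summed over all characters $\chi$. *)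

theory Defs
  imports Complex_Main "HOL-Computational_Algebra.Primes" "HOL-Library.Cardinality" "HOL-Number_Theory.Cong"
begin

(* Multiplicative characters of F_q^x, extended by chi(0) = 0, as functions 'a => complex *)
definition is_mchar :: "('a::field \<Rightarrow> complex) \<Rightarrow> bool" where
  "is_mchar \<chi> \<longleftrightarrow> \<chi> 0 = 0 \<and> \<chi> 1 = 1 \<and>
     (\<forall>x y. x \<noteq> 0 \<longrightarrow> y \<noteq> 0 \<longrightarrow> \<chi> (x * y) = \<chi> x * \<chi> y)"

(* the trivial character epsilon (with epsilon(0) = 0) *)
definition triv_char :: "'a::field \<Rightarrow> complex" where
  "triv_char x = (if x = 0 then 0 else 1)"

(* power T^k of a character *)
definition char_pow :: "('a::field \<Rightarrow> complex) \<Rightarrow> nat \<Rightarrow> 'a \<Rightarrow> complex" where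
  "char_pow T k x = (if x = 0 then 0 else T x ^ k)"

(* T generates the character group *)
definition char_generator :: "('a::field \<Rightarrow> complex) \<Rightarrow> bool" where
  "char_generator T \<longleftrightarrow> is_mchar T \<and>
     (\<forall>\<chi>. is_mchar \<chi> \<longrightarrow> (\<exists>k. \<chi> = char_pow T k))"

(* pointwise product of characters *)
definition char_mult :: "('a \<Rightarrow> complex) \<Rightarrow> ('a \<Rightarrow> complex) \<Rightarrow> 'a \<Rightarrow> complex" where
  "char_mult A B x = A x * B x"

(* absolute trace F_q -> F_p, q = p^n *)
definition ftrace :: "nat \<Rightarrow> nat \<Rightarrow> 'a::field \<Rightarrow> 'a" where
  "ftrace p n x = (\<Sum>k<n. x ^ (p ^ k))"

(* theta(x) = zeta^{tr(x)}, tr(x) identified with an element of {0..<p} *)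
definition add_char :: "nat \<Rightarrow> nat \<Rightarrow> complex \<Rightarrow> 'a::field \<Rightarrow> complex" where
  "add_char p n \<zeta> x = \<zeta> ^ (THE m. m < p \<and> of_nat m = ftrace p n x)"

(* Gauss sum g(chi) *)
definition gauss_sum :: "nat \<Rightarrow> nat \<Rightarrow> complex \<Rightarrow> ('a::{field,finite} \<Rightarrow> complex) \<Rightarrow> complex" where
  "gauss_sum p n \<zeta> \<chi> = (\<Sum>x\<in>UNIV. \<chi> x * add_char p n \<zeta> x)"

(* Greene's binomial (A choose B) *)
definition char_binom :: "('a::{field,finite} \<Rightarrow> complex) \<Rightarrow> ('a \<Rightarrow> complex) \<Rightarrow> complex" where
  "char_binom A B = B (-1) / of_nat CARD('a) * (\<Sum>x\<in>UNIV. A x * cnj (B (1 - x)))"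

(* Greene's hypergeometric function _{n+1}F_n(A_0,...,A_n; B_1,...,B_n | x) *)
definition greeneF :: "nat \<Rightarrow> (nat \<Rightarrow> 'a::{field,finite} \<Rightarrow> complex) \<Rightarrow>
    (nat \<Rightarrow> 'a \<Rightarrow> complex) \<Rightarrow> 'a \<Rightarrow> complex" where
  "greeneF n A B x = of_nat CARD('a) / (of_nat CARD('a) - 1) *
     (\<Sum>\<chi>\<in>{\<chi>. is_mchar \<chi>}. char_binom (char_mult (A 0) \<chi>) \<chi> *
        (\<Prod>i\<in>{1..n}. char_binom (char_mult (A i) \<chi>) (char_mult (B i) \<chi>)) * \<chi> x)"

(* Dwork hypersurface: points of P^{d-1}(F_q), as classes of nonzero vectors
   x = (x_0,...,x_{d-1}) (functions nat => 'a vanishing from index d on) up to scalars *)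
definition dwork_points :: "nat \<Rightarrow> 'a::field \<Rightarrow> (nat \<Rightarrow> 'a) set set" where
  "dwork_points d lam =
     (\<lambda>x. {(\<lambda>i. c * x i) | c. c \<noteq> 0}) `
       {x. (\<forall>i\<ge>d. x i = 0) \<and> (\<exists>i<d. x i \<noteq> 0) \<and>
           (\<Sum>i<d. x i ^ d) = of_nat d * lam * (\<Prod>i<d. x i)}"

(* W: tuples (w_0,...,w_{d-1}), 0 <= w_i < d, sum = 0 mod d (w i = 0 for i >= d) *)
definition Wset :: "nat \<Rightarrow> (nat \<Rightarrow> nat) set" where
  "Wset d = {w. (\<forall>i<d. w i < d) \<and> (\<forall>i\<ge>d. w i = 0) \<and> (\<Sum>i<d. w i) mod d = 0}"

(* W^{**}: all w_i nonzero and not all equal *)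
definition Wss :: "nat \<Rightarrow> (nat \<Rightarrow> nat) set" where
  "Wss d = {w \<in> Wset d. (\<forall>i<d. w i \<noteq> 0) \<and> \<not> (\<forall>i<d. \<forall>j<d. w i = w j)}"

(* w ~ w' iff w - w' is congruent mod d to a multiple of (1,...,1) *)
definition Wrel :: "nat \<Rightarrow> ((nat \<Rightarrow> nat) \<times> (nat \<Rightarrow> nat)) set" where
  "Wrel d = {(w, w'). w \<in> Wset d \<and> w' \<in> Wset d \<and>
     (\<exists>k::int. \<forall>i<d. [int (w i) - int (w' i) = k] (mod int d))}"

end

theory Submission
  imports Defs "HOL-Algebra.Algebraic_Closure_Type" "HOL-Number_Theory.Residues"
begin

hide_const (open) Divisibility.prime Coset.order

text \<open>
  Orthogonality of the additive character \<open>\<theta>\<close> expresses \<open>q\<close> times the number of zeros of the form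
  on \<open>F\<^sub>q\<^sup>d\<close> as a sum of products of \<open>\<theta>(z x\<^sub>i\<^sup>d)\<close> and \<open>\<theta>(- z d \<lambda> x\<^sub>1 \<dots> x\<^sub>d)\<close>. Expanding the last factor in
  multiplicative characters separates the variables and gives a sum of products of Gauss sums indexed
  by \<open>w \<in> W\<close> and \<open>j < t\<close>; replacing \<open>w\<close> by \<open>w + (1, \<dots>, 1)\<close> amounts to replacing \<open>j\<close> by \<open>j + t\<close>, so the
  sum regroups into classes with \<open>j < q - 1\<close>. The class of \<open>0\<close> together with the constant tuples in
  \<open>W\<close> is Greene's function: its binomials are Jacobi sums, and the resulting product of the
  \<open>g(T\<^sup>i\<^sup>t \<chi>)\<close> is evaluated by the Hasse--Davenport product formula.

  The product formula is proved with L-series over polynomials \<open>P\<close> with \<open>P(0) = 1\<close>. The weight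
  \<open>\<chi>(\<Prod> b) \<theta>(\<Sum> b)\<close> of the reciprocal roots \<open>b\<close> of \<open>P\<close> has L-series \<open>1 + g(\<chi>) X\<close>. Since the number of
  \<open>d\<close>-th roots of \<open>y\<close> in the extension of degree \<open>k\<close> is \<open>\<Sum>\<^sub>i T\<^sup>i\<^sup>t(N y)\<close>, the logarithmic derivatives show
  that the L-series of the weight \<open>\<chi>(\<Prod> b)\<^sup>d \<theta>(\<Sum> b\<^sup>d)\<close> is the product of the \<open>1 + g(\<chi> T\<^sup>i\<^sup>t) X\<close> over
  \<open>i < d\<close>. The coefficient of \<open>X\<^sup>d\<close> can also be computed directly, because \<open>\<Sum> b\<^sup>d\<close> is affine in the
  leading coefficient of \<open>P\<close>.
\<close>

section \<open>Multiplicative characters of a finite field\<close>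

text \<open>The class of \<open>0\<close> and Greene's function agree character by character, except
  at nontrivial \<psi> with trivial \<open>d\<close>-th power. There the Gauss sum of the
  \<open>d\<close>-th power is \<open>-1\<close>, so its product with the conjugate one is
  \<open>1\<close> and not \<open>q\<close>, and the discrepancy is
  \<open>gauss \<psi> ^ d / q\<close>. These \<psi> are the powers of \<open>T\<close> with exponent
  \<open>c * t\<close>, \<open>0 < c < d\<close>, so the discrepancies are exactly the constant
  tuples. This is why \<open>Wss\<close> remains out of all tuples with nonzero entries. The
  L-series argument avoids irreducible polynomials and a tower of extension fields. Pairs
  \<open>(k, b)\<close> with \<open>b ^ (q ^ k) = b\<close> in one algebraic closure replace prime
  powers, and multiplicities of roots replace unique factorization. The direct computation of the
  coefficient of \<open>X ^ d\<close> leaves one sum unevaluated. That sum does not involve \<chi>,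
  so the trivial character determines it. Divisibility of \<open>q - 1\<close> by \<open>d\<close>
  acts in two ways: the \<open>t\<close>-th power of \<open>T\<close> has order \<open>d\<close>,
  and \<open>d\<close> is invertible in \<open>F_q\<close>, so \<open>X ^ d - y\<close> is separable
  for \<open>y\<close> nonzero and the dependence on the leading coefficient is not
  constant.\<close>

lemma card_field_ge_2: "CARD('a::{field,finite}) \<ge> 2"
proof -
  have "card {0, 1::'a} \<le> CARD('a)"
    by (rule card_mono) auto
  thus ?thesis by simp
qed

lemma ex_primitive_element:
  "\<exists>\<gamma>::'a::{field,finite}. \<gamma> \<noteq> 0 \<and> (\<forall>x. x \<noteq> 0 \<longrightarrow> (\<exists>j::nat. x = \<gamma> ^ j))"
proof -
  let ?R = "ring_of_type_algebra :: 'a ring"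
  interpret R: field ?R by (rule field_from_type_algebra)
  have fin: "finite (carrier ?R)" by (simp add: ring_of_type_algebra_def)
  have pow: "x [^]\<^bsub>?R\<^esub> (j::nat) = x ^ j" for x :: 'a and j
    by (induction j) (simp_all add: ring_of_type_algebra_def)
  have carr: "carrier (Multiplicative_Group.mult_of ?R) = UNIV - {0}"
    by (simp add: ring_of_type_algebra_def)
  have "\<exists>a\<in>UNIV - {0::'a}. UNIV - {0} = {a ^ i | i::nat. i \<in> UNIV}"
    using R.finite_field_mult_group_has_gen[OF fin] unfolding carr pow .
  then obtain a :: 'a where a: "a \<noteq> 0" "UNIV - {0} = {a ^ i | i::nat. i \<in> UNIV}" by auto
  have "\<exists>j::nat. x = a ^ j" if "x \<noteq> 0" for x
  proof -
    have "x \<in> {a ^ i | i::nat. i \<in> UNIV}" using that unfolding a(2)[symmetric] by simp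
    thus ?thesis by simp
  qed
  thus ?thesis using a(1) by blast
qed

lemma field_power_card_minus_one:
  fixes x :: "'a::{field,finite}"
  assumes "x \<noteq> 0"
  shows "x ^ (CARD('a) - 1) = 1"
proof -
  have "(\<Prod>y\<in>UNIV-{0}. x * y) = (\<Prod>y\<in>UNIV-{0::'a}. y)"
    by (rule prod.reindex_bij_witness[of _ "\<lambda>y. y / x" "\<lambda>y. x * y"]) (use assms in auto)
  hence "x ^ (CARD('a) - 1) * \<Prod>(UNIV-{0::'a}) = 1 * \<Prod>(UNIV-{0})"
    by (simp add: prod.distrib)
  thus ?thesis by (subst (asm) mult_right_cancel) auto
qed

lemma field_power_card:
  fixes x :: "'a::{field,finite}"
  shows "x ^ CARD('a) = x"
proof (cases "x = 0")
  case False
  have "Suc (CARD('a) - 1) = CARD('a)" using card_field_ge_2[where 'a='a] by simp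
  hence "x ^ CARD('a) = x * x ^ (CARD('a) - 1)" by (metis power_Suc)
  thus ?thesis using field_power_card_minus_one[OF False] by simp
qed (use card_field_ge_2[where 'a='a] in \<open>simp add: power_0_left\<close>)

lemma mchar_0: "is_mchar \<chi> \<Longrightarrow> \<chi> 0 = 0"
  and mchar_1: "is_mchar \<chi> \<Longrightarrow> \<chi> 1 = 1"
  by (auto simp: is_mchar_def)

lemma mchar_mult: "is_mchar \<chi> \<Longrightarrow> \<chi> (x * y) = \<chi> x * \<chi> y"
  by (cases "x = 0 \<or> y = 0") (auto simp: is_mchar_def)

lemma mchar_power: "is_mchar \<chi> \<Longrightarrow> \<chi> (x ^ k) = \<chi> x ^ k"
  by (induction k) (simp_all add: mchar_mult mchar_1)

lemma mchar_power_card: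
  fixes \<chi> :: "'a::{field,finite} \<Rightarrow> complex"
  assumes "is_mchar \<chi>" "x \<noteq> 0"
  shows "\<chi> x ^ (CARD('a) - 1) = 1"
  using mchar_power[OF assms(1), of x "CARD('a) - 1"] field_power_card_minus_one[OF assms(2)]
  by (simp add: mchar_1[OF assms(1)])

lemma mchar_nonzero:
  fixes \<chi> :: "'a::{field,finite} \<Rightarrow> complex"
  assumes "is_mchar \<chi>" "x \<noteq> 0"
  shows "\<chi> x \<noteq> 0"
proof
  assume "\<chi> x = 0"
  hence "\<chi> (x * inverse x) = 0" unfolding mchar_mult[OF assms(1)] by simp
  moreover have "\<chi> (x * inverse x) = 1" using assms by (simp add: mchar_1[OF assms(1)])
  ultimately show False by simp
qed

lemma mchar_inverse:
  fixes \<chi> :: "'a::{field,finite} \<Rightarrow> complex"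
  assumes "is_mchar \<chi>"
  shows "\<chi> (inverse x) = inverse (\<chi> x)"
proof (cases "x = 0")
  case False
  hence "\<chi> x * \<chi> (inverse x) = 1"
    by (simp add: mchar_1[OF assms] flip: mchar_mult[OF assms])
  thus ?thesis by (metis inverse_unique)
qed (simp add: mchar_0[OF assms])

lemma mchar_norm:
  fixes \<chi> :: "'a::{field,finite} \<Rightarrow> complex"
  assumes "is_mchar \<chi>" "x \<noteq> 0"
  shows "norm (\<chi> x) = 1"
proof -
  have "norm (\<chi> x) ^ (CARD('a) - 1) = 1"
    using mchar_power_card[OF assms] by (metis norm_one norm_power)
  moreover have "CARD('a) - 1 > 0" using card_field_ge_2[where 'a='a] by simp
  ultimately show ?thesis
    using power_eq_imp_eq_base[of "norm (\<chi> x)" "CARD('a) - 1" 1] by simp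
qed

lemma mchar_cnj:
  fixes \<chi> :: "'a::{field,finite} \<Rightarrow> complex"
  assumes "is_mchar \<chi>"
  shows "cnj (\<chi> x) = inverse (\<chi> x)"
proof (cases "x = 0")
  case False
  have "\<chi> x * cnj (\<chi> x) = 1" using mchar_norm[OF assms False]
    by (metis complex_norm_square mult.right_neutral of_real_1 power2_eq_square)
  thus ?thesis by (metis inverse_unique)
qed (simp add: mchar_0[OF assms])

lemma mchar_minus_one_square:
  assumes "is_mchar \<chi>"
  shows "\<chi> (-1) * \<chi> (-1) = 1"
  by (simp add: mchar_1[OF assms] flip: mchar_mult[OF assms])

lemma is_mchar_triv [intro, simp]: "is_mchar triv_char"
  by (auto simp: is_mchar_def triv_char_def)

lemma is_mchar_char_mult [intro]: "is_mchar A \<Longrightarrow> is_mchar B \<Longrightarrow> is_mchar (char_mult A B)"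
  by (auto simp: is_mchar_def char_mult_def)

lemma is_mchar_cnj [intro]: "is_mchar A \<Longrightarrow> is_mchar (\<lambda>x. cnj (A x))"
  by (auto simp: is_mchar_def)

lemma is_mchar_char_pow [intro]: "is_mchar A \<Longrightarrow> is_mchar (char_pow A k)"
  by (auto simp: is_mchar_def char_pow_def power_mult_distrib)

lemma char_pow_0 [simp]: "char_pow T 0 = triv_char"
  by (auto simp: char_pow_def triv_char_def fun_eq_iff)

lemma char_pow_add: "char_pow T (i + j) = char_mult (char_pow T i) (char_pow T j)"
  by (auto simp: char_pow_def char_mult_def power_add fun_eq_iff)

lemma char_pow_pow: "char_pow (char_pow T i) j = char_pow T (i * j)"
  by (auto simp: char_pow_def power_mult fun_eq_iff)

lemma char_pow_periodic:
  fixes T :: "'a::{field,finite} \<Rightarrow> complex"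
  assumes "is_mchar T" "i mod (CARD('a) - 1) = j mod (CARD('a) - 1)"
  shows "char_pow T i = char_pow T j"
proof -
  have *: "T x ^ i = T x ^ (i mod (CARD('a) - 1))" if "x \<noteq> 0" for i x
  proof -
    have "T x ^ i = T x ^ ((CARD('a) - 1) * (i div (CARD('a) - 1)) + i mod (CARD('a) - 1))"
      by simp
    also have "\<dots> = T x ^ (i mod (CARD('a) - 1))"
      by (simp only: power_add power_mult mchar_power_card[OF assms(1) that] power_one mult_1)
    finally show ?thesis .
  qed
  show ?thesis using *[of _ i] *[of _ j] assms(2) by (simp add: char_pow_def fun_eq_iff)
qed

lemma sum_mchar:
  fixes \<chi> :: "'a::{field,finite} \<Rightarrow> complex"
  assumes "is_mchar \<chi>"
  shows "(\<Sum>x\<in>UNIV. \<chi> x) = (if \<chi> = triv_char then of_nat CARD('a) - 1 else 0)"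
proof (cases "\<chi> = triv_char")
  case True
  have "(\<Sum>x\<in>(UNIV::'a set). triv_char x) = (\<Sum>x\<in>UNIV - {0::'a}. 1::complex)"
    by (rule sum.mono_neutral_cong_right) (auto simp: triv_char_def)
  also have "\<dots> = of_nat CARD('a) - 1"
    using card_field_ge_2[where 'a='a] by (simp add: of_nat_diff)
  finally show ?thesis using True by simp
next
  case False
  then obtain a where a: "\<chi> a \<noteq> triv_char a" by (auto simp: fun_eq_iff)
  hence a0: "a \<noteq> 0" and a1: "\<chi> a \<noteq> 1" using mchar_0[OF assms] by (auto simp: triv_char_def split: if_splits)
  have "(\<Sum>x\<in>UNIV. \<chi> x) = (\<Sum>x\<in>UNIV. \<chi> (a * x))"
    by (rule sum.reindex_bij_witness[of _ "\<lambda>y. a * y" "\<lambda>y. y / a"]) (use a0 in auto)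
  also have "\<dots> = \<chi> a * (\<Sum>x\<in>UNIV. \<chi> x)"
    by (simp add: mchar_mult[OF assms] sum_distrib_left)
  finally have "(\<Sum>x\<in>UNIV. \<chi> x) = 0" using a1 by simp
  thus ?thesis using False by simp
qed

lemma sum_powers_root_of_unity:
  fixes z :: complex
  assumes "z ^ n = 1" "z \<noteq> 1"
  shows "(\<Sum>i<n. z ^ i) = 0"
  using assms by (simp add: sum_gp_strict)

text \<open>\<open>char_generator\<close> only says that the powers of \<open>T\<close> exhaust the
  characters. A character separating \<open>1\<close> from all other units is built from a primitive
  element and a primitive root of unity; being a power of \<open>T\<close>, it takes the value
  \<open>1\<close> wherever \<open>T\<close> does.\<close>

lemma char_generator_faithful:
  fixes T :: "'a::{field,finite} \<Rightarrow> complex"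
  assumes T: "char_generator T" and x: "x \<noteq> 0" and Tx: "T x = 1"
  shows "x = 1"
proof -
  obtain \<gamma> :: 'a where \<gamma>: "\<gamma> \<noteq> 0" "\<And>x. x \<noteq> 0 \<Longrightarrow> \<exists>j::nat. x = \<gamma> ^ j"
    using ex_primitive_element by blast
  define N where "N = CARD('a) - 1"
  have N: "N > 0" using card_field_ge_2[where 'a='a] by (simp add: N_def)
  have \<gamma>N: "\<gamma> ^ N = 1" using field_power_card_minus_one[OF \<gamma>(1)] by (simp add: N_def)
  have \<gamma>mod: "\<gamma> ^ j = \<gamma> ^ (j mod N)" for j
    by (metis \<gamma>N div_mult_mod_eq mult.commute mult.left_neutral power_add power_mult power_one)
  have "(\<lambda>j. \<gamma> ^ j) ` {..<N} = UNIV - {0}"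
  proof (intro equalityI subsetI)
    fix y assume "y \<in> UNIV - {0 :: 'a}"
    then obtain j where "y = \<gamma> ^ j" using \<gamma>(2) by blast
    thus "y \<in> (\<lambda>j. \<gamma> ^ j) ` {..<N}" using \<gamma>mod N by (auto intro!: image_eqI[of _ _ "j mod N"])
  qed (use \<gamma>(1) in auto)
  hence inj: "inj_on (\<lambda>j. \<gamma> ^ j) {..<N}"
    by (intro eq_card_imp_inj_on) (auto simp: N_def)
  define w where "w = cis (2 * pi / of_nat N)"
  have wN: "w ^ N = 1" using N by (simp add: w_def DeMoivre)
  have w1: "N dvd j" if "w ^ j = 1" for j
  proof -
    have "cis (2 * pi * (real j / real N)) = 1" using that by (simp add: w_def DeMoivre mult_ac)
    hence "cos (2 * pi * (real j / real N)) = 1" by (simp add: complex_eq_iff)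
    then obtain k :: int where "2 * pi * (real j / real N) = of_int k * 2 * pi"
      unfolding cos_one_2pi_int by blast
    hence "(2 * pi) * (real j / real N) = (2 * pi) * of_int k" by (simp only: mult_ac)
    hence "real j / real N = of_int k" by (subst (asm) mult_left_cancel) auto
    hence "real_of_int (int j) = real_of_int (int N * k)" using N by (simp add: field_simps)
    hence "int j = int N * k" by linarith
    thus ?thesis by (metis dvd_triv_left int_dvd_int_iff)
  qed
  have wmod: "w ^ j = w ^ (j mod N)" for j
    by (metis wN div_mult_mod_eq mult.commute mult.left_neutral power_add power_mult power_one)
  \<comment> \<open>A discrete logarithm: the exponent is determined modulo \<open>N\<close> and
    \<open>w ^ N = 1\<close>, so the choice made by \<open>SOME\<close> does not affect the
    value.\<close>
  define \<chi> where "\<chi> y = (if y = 0 then 0 else w ^ (SOME j. y = \<gamma> ^ j))" for y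
  have \<chi>\<gamma>: "\<chi> (\<gamma> ^ j) = w ^ j" for j
  proof -
    define i where "i = (SOME i. \<gamma> ^ j = \<gamma> ^ i)"
    have "\<gamma> ^ j = \<gamma> ^ i" unfolding i_def by (rule someI[of _ j]) simp
    hence "\<gamma> ^ (j mod N) = \<gamma> ^ (i mod N)" using \<gamma>mod by metis
    hence "j mod N = i mod N" using inj N by (auto simp: inj_on_def)
    hence "w ^ j = w ^ i" using wmod by metis
    thus ?thesis using \<gamma>(1) by (simp add: \<chi>_def i_def)
  qed
  have "is_mchar \<chi>"
    unfolding is_mchar_def
  proof (intro conjI allI impI)
    show "\<chi> 1 = 1" using \<chi>\<gamma>[of 0] by simp
    fix x y :: 'a assume "x \<noteq> 0" "y \<noteq> 0"
    then obtain i j where "x = \<gamma> ^ i" "y = \<gamma> ^ j" using \<gamma>(2) by metis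
    thus "\<chi> (x * y) = \<chi> x * \<chi> y" by (simp add: \<chi>\<gamma> power_add flip: power_add)
  qed (simp add: \<chi>_def)
  then obtain k where k: "\<chi> = char_pow T k" using T by (auto simp: char_generator_def)
  obtain j where j: "x = \<gamma> ^ j" using \<gamma>(2) x by blast
  have "w ^ j = 1" using \<chi>\<gamma>[of j] k Tx x j \<gamma>(1) by (simp add: char_pow_def)
  hence "j mod N = 0" using w1 by auto
  thus ?thesis using \<gamma>mod[of j] j by simp
qed

lemma is_mchar_generator: "char_generator T \<Longrightarrow> is_mchar T"
  by (simp add: char_generator_def)

text \<open>Faithfulness turns triviality at a primitive element \<gamma> into
  \<open>\<gamma> ^ r = 1\<close>; a positive \<open>r\<close> below \<open>q - 1\<close> would
  leave too few powers of \<gamma> to cover the units.\<close>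

lemma char_pow_generator_eq_triv_iff:
  fixes T :: "'a::{field,finite} \<Rightarrow> complex"
  assumes T: "char_generator T"
  shows "char_pow T k = triv_char \<longleftrightarrow> (CARD('a) - 1) dvd k"
proof
  assume k: "char_pow T k = triv_char"
  obtain \<gamma> :: 'a where \<gamma>: "\<gamma> \<noteq> 0" "\<And>x. x \<noteq> 0 \<Longrightarrow> \<exists>j::nat. x = \<gamma> ^ j"
    using ex_primitive_element by blast
  have mT: "is_mchar T" by (rule is_mchar_generator[OF T])
  define N where "N = CARD('a) - 1"
  define r where "r = k mod N"
  have N: "N > 0" using card_field_ge_2[where 'a='a] by (simp add: N_def)
  have r: "r < N" using N by (simp add: r_def)
  have "char_pow T r = triv_char"
    using k char_pow_periodic[OF mT, of r k] by (simp add: r_def N_def)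
  hence "char_pow T r \<gamma> = triv_char \<gamma>" by simp
  hence "T (\<gamma> ^ r) = 1" using \<gamma>(1) by (simp add: mchar_power[OF mT] char_pow_def triv_char_def)
  hence \<gamma>r: "\<gamma> ^ r = 1" using char_generator_faithful[OF T, of "\<gamma> ^ r"] \<gamma>(1) by simp
  show "(CARD('a) - 1) dvd k"
  proof (rule ccontr)
    assume "\<not> ?thesis"
    hence r0: "r > 0" using mod_greater_zero_iff_not_dvd unfolding r_def N_def by blast
    have "UNIV - {0} \<subseteq> (\<lambda>j. \<gamma> ^ j) ` {..<r}"
    proof
      fix y assume "y \<in> UNIV - {0 :: 'a}"
      then obtain j where "y = \<gamma> ^ j" using \<gamma>(2) by blast
      moreover have "\<gamma> ^ j = \<gamma> ^ (j mod r)"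
        by (metis \<gamma>r div_mult_mod_eq mult.commute mult.left_neutral power_add power_mult power_one)
      ultimately show "y \<in> (\<lambda>j. \<gamma> ^ j) ` {..<r}" using r0 by auto
    qed
    hence "card (UNIV - {0::'a}) \<le> card {..<r}" by (rule surj_card_le[rotated]) simp
    thus False using r by (simp add: N_def)
  qed
next
  assume "(CARD('a) - 1) dvd k"
  hence "char_pow T k = char_pow T 0"
    by (intro char_pow_periodic is_mchar_generator[OF T]) auto
  thus "char_pow T k = triv_char" by simp
qed

text \<open>Dual orthogonality: for a unit other than \<open>1\<close> the value \<open>T x\<close>
  is a nontrivial root of unity by faithfulness, so its powers over a full period cancel.\<close>

lemma sum_char_pow_generator:
  fixes T :: "'a::{field,finite} \<Rightarrow> complex"
  assumes T: "char_generator T"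
  shows "(\<Sum>j<CARD('a) - 1. char_pow T j x) = (if x = 1 then of_nat CARD('a) - 1 else 0)"
proof -
  have mT: "is_mchar T" by (rule is_mchar_generator[OF T])
  consider "x = 0" | "x = 1" | "x \<noteq> 0" "x \<noteq> 1" by blast
  thus ?thesis
  proof cases
    case 2
    thus ?thesis using card_field_ge_2[where 'a='a] by (simp add: char_pow_def of_nat_diff mchar_1[OF mT])
  next
    case 3
    have "T x \<noteq> 1" using char_generator_faithful[OF T] 3 by blast
    thus ?thesis using sum_powers_root_of_unity[OF mchar_power_card[OF mT 3(1)]] 3
      by (simp add: char_pow_def)
  qed (simp add: char_pow_def)
qed

lemma mchars_eq_char_pow_image:
  fixes T :: "'a::{field,finite} \<Rightarrow> complex"
  assumes T: "char_generator T"
  shows "{\<chi>. is_mchar \<chi>} = char_pow T ` {..<CARD('a) - 1}"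
    and "inj_on (char_pow T) {..<CARD('a) - 1}"
proof -
  have mT: "is_mchar T" by (rule is_mchar_generator[OF T])
  have N: "CARD('a) - 1 > 0" using card_field_ge_2[where 'a='a] by simp
  show "{\<chi>. is_mchar \<chi>} = char_pow T ` {..<CARD('a) - 1}"
  proof (intro equalityI subsetI)
    fix \<chi> :: "'a \<Rightarrow> complex" assume "\<chi> \<in> {\<chi>. is_mchar \<chi>}"
    then obtain k where "\<chi> = char_pow T k" using T by (auto simp: char_generator_def)
    also have "\<dots> = char_pow T (k mod (CARD('a) - 1))" by (rule char_pow_periodic[OF mT]) simp
    finally show "\<chi> \<in> char_pow T ` {..<CARD('a) - 1}" using N by simp
  qed (use mT in auto)
  have *: "i = j" if "i \<le> j" "j < CARD('a) - 1" "char_pow T i = char_pow T j" for i j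
  proof -
    have "char_pow T (j - i) x = triv_char x" for x
    proof (cases "x = 0")
      case False
      have "char_pow T j x = char_pow T i x" using that by simp
      hence "T x ^ i * T x ^ (j - i) = T x ^ i" 
        using that(1) False by (simp add: char_pow_def flip: power_add)
      thus ?thesis using False mchar_nonzero[OF mT False] by (simp add: char_pow_def triv_char_def)
    qed (simp add: char_pow_def triv_char_def)
    hence "(CARD('a) - 1) dvd (j - i)"
      using char_pow_generator_eq_triv_iff[OF T] by auto
    thus ?thesis using that by (auto dest: dvd_imp_le)
  qed
  show "inj_on (char_pow T) {..<CARD('a) - 1}"
  proof (rule inj_onI)
    fix i j assume "i \<in> {..<CARD('a) - 1}" "j \<in> {..<CARD('a) - 1}" "char_pow T i = char_pow T j"
    thus "i = j" using *[of i j] *[of j i] by (cases "i \<le> j") auto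
  qed
qed

section \<open>Gauss sums\<close>

locale additive_character =
  fixes \<theta> :: "'a::{field,finite} \<Rightarrow> complex"
  assumes theta_add: "\<theta> (x + y) = \<theta> x * \<theta> y"
    and theta_0: "\<theta> 0 = 1"
    and theta_nontrivial: "\<exists>x. \<theta> x \<noteq> 1"
begin

definition gauss :: "('a \<Rightarrow> complex) \<Rightarrow> complex" where
  "gauss \<chi> = (\<Sum>x\<in>UNIV. \<chi> x * \<theta> x)"

lemma theta_sum: "\<theta> (sum f A) = (\<Prod>i\<in>A. \<theta> (f i))"
  by (induction A rule: infinite_finite_induct) (auto simp: theta_0 theta_add)

lemma sum_theta: "(\<Sum>x\<in>UNIV. \<theta> (a * x)) = (if a = 0 then of_nat CARD('a) else 0)"
proof (cases "a = 0")
  case False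
  obtain b where b: "\<theta> b \<noteq> 1" using theta_nontrivial by blast
  have "(\<Sum>x\<in>UNIV. \<theta> (a * x)) = (\<Sum>x\<in>UNIV. \<theta> (b + a * x))"
    by (rule sum.reindex_bij_witness[of _ "\<lambda>x. x + b / a" "\<lambda>x. x - b / a"])
       (use False in \<open>auto simp: field_simps\<close>)
  also have "\<dots> = \<theta> b * (\<Sum>x\<in>UNIV. \<theta> (a * x))"
    by (simp add: theta_add sum_distrib_left)
  finally show ?thesis using b False by simp
qed (simp add: theta_0)

lemma sum_theta_nonzero: "(\<Sum>x\<in>UNIV - {0}. \<theta> (a * x)) = (if a = 0 then of_nat CARD('a) else 0) - 1"
  using sum_theta[of a] by (subst (asm) sum.remove[of _ 0]) (auto simp: theta_0 algebra_simps)

lemma gauss_triv: "gauss triv_char = -1"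
proof -
  have "gauss triv_char = (\<Sum>x\<in>UNIV - {0}. \<theta> x)"
    unfolding gauss_def by (rule sum.mono_neutral_cong_right) (auto simp: triv_char_def)
  also have "\<dots> = -1" using sum_theta_nonzero[of 1] by simp
  finally show ?thesis .
qed

lemma gauss_twist:
  assumes \<chi>: "is_mchar \<chi>" and z: "z \<noteq> 0"
  shows "(\<Sum>x\<in>UNIV. \<chi> x * \<theta> (z * x)) = cnj (\<chi> z) * gauss \<chi>"
proof -
  have "(\<Sum>x\<in>UNIV. \<chi> x * \<theta> (z * x)) = (\<Sum>x\<in>UNIV. \<chi> (inverse z * x) * \<theta> x)"
    by (rule sum.reindex_bij_witness[of _ "\<lambda>x. x / z" "\<lambda>x. z * x"])
       (use z in \<open>auto simp: field_simps\<close>)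
  also have "\<dots> = cnj (\<chi> z) * gauss \<chi>"
    by (simp add: mchar_mult[OF \<chi>] mchar_inverse[OF \<chi>] mchar_cnj[OF \<chi>] gauss_def
        sum_distrib_left mult_ac)
  finally show ?thesis .
qed

lemma gauss_mult_cnj:
  assumes \<chi>: "is_mchar \<chi>" and nontriv: "\<chi> \<noteq> triv_char"
  shows "gauss \<chi> * gauss (\<lambda>x. cnj (\<chi> x)) = \<chi> (-1) * of_nat CARD('a)"
proof -
  have "gauss \<chi> * gauss (\<lambda>x. cnj (\<chi> x)) = (\<Sum>y\<in>UNIV. cnj (\<chi> y) * \<theta> y * gauss \<chi>)"
    by (simp add: gauss_def sum_distrib_left sum_distrib_right mult_ac)
  also have "\<dots> = (\<Sum>y\<in>UNIV - {0}. \<theta> y * (cnj (\<chi> y) * gauss \<chi>))"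
    by (rule sum.mono_neutral_cong_right) (auto simp: mchar_0[OF \<chi>])
  \<comment> \<open>\<open>gauss_twist\<close> absorbs the conjugate value into the additive
    character. After the swap, orthogonality over \<open>y\<close> singles out
    \<open>u = -1\<close>, and the omitted \<open>y = 0\<close> costs a full sum of \<chi>, which is
    zero.\<close>
  also have "\<dots> = (\<Sum>y\<in>UNIV - {0}. \<theta> y * (\<Sum>u\<in>UNIV. \<chi> u * \<theta> (y * u)))"
    by (intro sum.cong refl) (simp add: gauss_twist[OF \<chi>])
  also have "\<dots> = (\<Sum>u\<in>UNIV. \<chi> u * (\<Sum>y\<in>UNIV - {0}. \<theta> ((u + 1) * y)))"
    by (subst sum_distrib_left, subst sum.swap)
       (simp add: sum_distrib_left theta_add algebra_simps)
  also have "\<dots> = (\<Sum>u\<in>UNIV. \<chi> u * (if u = -1 then of_nat CARD('a) else 0) - \<chi> u)"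
    unfolding sum_theta_nonzero by (intro sum.cong refl) (auto simp: algebra_simps eq_neg_iff_add_eq_0)
  also have "\<dots> = \<chi> (-1) * of_nat CARD('a) - (\<Sum>u\<in>UNIV. \<chi> u)"
    by (simp add: sum_subtractf if_distrib[of "\<lambda>c. _ * c"] cong: if_cong)
  also have "\<dots> = \<chi> (-1) * of_nat CARD('a)" using sum_mchar[OF \<chi>] nontriv by simp
  finally show ?thesis .
qed

lemma gauss_nonzero:
  assumes "is_mchar \<chi>"
  shows "gauss \<chi> \<noteq> 0"
proof (cases "\<chi> = triv_char")
  case False
  have "\<chi> (-1) * of_nat CARD('a) \<noteq> 0" using mchar_nonzero[OF assms, of "-1"] by simp
  thus ?thesis using gauss_mult_cnj[OF assms False] by auto
qed (simp add: gauss_triv)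

text \<open>The product of the two Gauss sums is sorted by \<open>s = x + y\<close>. Scaling by
  \<open>s\<close> makes every slice with \<open>s \<noteq> 0\<close> a multiple of the Jacobi sum,
  and the slice \<open>s = 0\<close> is a sum of the nontrivial product character. Condition and
  denominator concern this product only, so the cases of trivial \<open>A\<close> or
  \<open>B\<close> that arise in Greene's binomials are covered.\<close>

lemma jacobi_sum:
  assumes A: "is_mchar A" and B: "is_mchar B" and nontriv: "char_mult A B \<noteq> triv_char"
  shows "(\<Sum>x\<in>UNIV. A x * B (1 - x)) = gauss A * gauss B / gauss (char_mult A B)"
proof -
  have AB: "is_mchar (char_mult A B)" using A B by auto
  define J where "J = (\<Sum>x\<in>UNIV. A x * B (1 - x))"
  have inner: "(\<Sum>x\<in>UNIV. A x * B (s - x)) = char_mult A B s * J" for s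
  proof (cases "s = 0")
    case True
    have "A x * B (- x) = char_mult A B x * B (-1)" for x
      using mchar_mult[OF B, of x "-1"] by (simp add: char_mult_def)
    hence "(\<Sum>x\<in>UNIV. A x * B (- x)) = (\<Sum>x\<in>UNIV. char_mult A B x * B (-1))"
      by (rule sum.cong[OF refl])
    also have "\<dots> = 0"
      using sum_mchar[OF AB] nontriv by (simp flip: sum_distrib_right)
    finally show ?thesis using True by (simp add: mchar_0[OF AB])
  next
    case False
    have "s * (1 - x / s) = s - x" for x using False by (simp add: field_simps)
    hence "(\<Sum>x\<in>UNIV. A x * B (s - x)) = (\<Sum>x\<in>UNIV. A (s * x) * B (s * (1 - x)))"
      by (intro sum.reindex_bij_witness[of _ "\<lambda>x. s * x" "\<lambda>x. x / s"]) (use False in auto)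
    also have "\<dots> = char_mult A B s * J"
      by (simp add: mchar_mult[OF A] mchar_mult[OF B] char_mult_def J_def sum_distrib_left mult_ac)
    finally show ?thesis .
  qed
  have "gauss A * gauss B = (\<Sum>x\<in>UNIV. \<Sum>y\<in>UNIV. A x * B y * \<theta> (x + y))"
    by (simp add: gauss_def sum_product theta_add mult_ac)
  also have "\<dots> = (\<Sum>x\<in>UNIV. \<Sum>s\<in>UNIV. A x * B (s - x) * \<theta> s)"
  proof (rule sum.cong[OF refl])
    fix x :: 'a
    show "(\<Sum>y\<in>UNIV. A x * B y * \<theta> (x + y)) = (\<Sum>s\<in>UNIV. A x * B (s - x) * \<theta> s)"
      by (rule sum.reindex_bij_witness[of _ "\<lambda>s. s - x" "\<lambda>y. x + y"]) auto
  qed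
  also have "\<dots> = (\<Sum>s\<in>UNIV. (\<Sum>x\<in>UNIV. A x * B (s - x)) * \<theta> s)"
    by (subst sum.swap) (simp add: sum_distrib_right)
  also have "\<dots> = J * gauss (char_mult A B)"
    by (simp add: inner gauss_def sum_distrib_left mult_ac)
  finally show ?thesis using gauss_nonzero[OF AB] by (simp add: J_def)
qed

text \<open>Using the quotient by the Gauss sum in place of the conjugate Gauss sum changes only the
  coefficient of the trivial character, and this is what makes the identity hold at \<open>y = 0\<close> too.\<close>

lemma theta_expansion:
  assumes T: "char_generator T"
  shows "\<theta> y = 1 + of_nat CARD('a) / (of_nat CARD('a) - 1) * (\<Sum>m<CARD('a) - 1. char_pow T m (- y) / gauss (char_pow T m))"
proof (cases "y = 0")
  case True
  thus ?thesis by (simp add: char_pow_def theta_0)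
next
  case y: False
  have mT: "is_mchar (char_pow T m)" for m using T by (auto simp: char_generator_def)
  have q2: "CARD('a) \<ge> 2" by (rule card_field_ge_2)
  hence "CARD('a) \<noteq> 1" by simp
  hence "of_nat CARD('a) \<noteq> (of_nat 1 :: complex)" unfolding of_nat_eq_iff .
  hence q1: "of_nat CARD('a) - (1::complex) \<noteq> 0" by simp
  have "(\<Sum>m<CARD('a) - 1. char_pow T m y * gauss (\<lambda>x. cnj (char_pow T m x)))
      = (\<Sum>x\<in>UNIV. (\<Sum>m<CARD('a) - 1. char_pow T m (y * inverse x)) * \<theta> x)"
    unfolding gauss_def sum_distrib_left sum_distrib_right
    by (subst sum.swap) (simp add: mchar_mult[OF mT] mchar_inverse[OF mT] mchar_cnj[OF mT] mult_ac)
  also have "\<dots> = (\<Sum>x\<in>UNIV. if x = y then (of_nat CARD('a) - 1) * \<theta> y else 0)"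
    unfolding sum_char_pow_generator[OF T]
    by (intro sum.cong refl) (use y in \<open>auto simp: field_simps\<close>)
  also have "\<dots> = (of_nat CARD('a) - 1) * \<theta> y" by simp
  finally have *: "(of_nat CARD('a) - 1) * \<theta> y = (\<Sum>m<CARD('a) - 1. char_pow T m y * gauss (\<lambda>x. cnj (char_pow T m x)))"
    by simp
  \<comment> \<open>At \<open>m = 0\<close> the conjugate Gauss sum gives \<open>-1\<close> while
    the quotient gives \<open>-q\<close>; the difference \<open>q - 1\<close>, divided by
    \<open>q - 1\<close>, is the leading \<open>1\<close> of the expansion.\<close>
  have summand: "char_pow T m y * gauss (\<lambda>x. cnj (char_pow T m x)) =
      of_nat CARD('a) * (char_pow T m (- y) / gauss (char_pow T m)) + (if m = 0 then of_nat CARD('a) - 1 else 0)"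
    if "m < CARD('a) - 1" for m
  proof (cases "m = 0")
    case True
    have "(\<lambda>x. cnj (triv_char x)) = (triv_char :: 'a \<Rightarrow> complex)" by (auto simp: triv_char_def)
    thus ?thesis using True y by (simp add: gauss_triv triv_char_def)
  next
    case False
    hence nt: "char_pow T m \<noteq> triv_char"
      using that char_pow_generator_eq_triv_iff[OF T, of m] by (auto dest: dvd_imp_le)
    have "gauss (char_pow T m) * gauss (\<lambda>x. cnj (char_pow T m x)) = char_pow T m (-1) * of_nat CARD('a)"
      by (rule gauss_mult_cnj[OF mT nt])
    hence "gauss (\<lambda>x. cnj (char_pow T m x)) = char_pow T m (-1) * of_nat CARD('a) / gauss (char_pow T m)"
      using gauss_nonzero[OF mT, of m] by (simp add: field_simps)
    moreover have "char_pow T m (- y) = char_pow T m (-1) * char_pow T m y"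
      using mchar_mult[OF mT, of m "-1" y] by simp
    ultimately show ?thesis using False by simp
  qed
  have "(of_nat CARD('a) - 1) * \<theta> y =
      of_nat CARD('a) * (\<Sum>m<CARD('a) - 1. char_pow T m (- y) / gauss (char_pow T m)) + (of_nat CARD('a) - 1)"
    unfolding * using q2 by (simp add: summand sum.distrib sum_distrib_left)
  thus ?thesis using q1 by (simp add: field_simps)
qed

end

section \<open>Frobenius and characteristic polynomials in the algebraic closure\<close>

lemma map_poly_hom_add:
  assumes "f 0 = 0" "\<And>x y. f (x + y) = f x + f y"
  shows "map_poly f (p + q) = map_poly f p + map_poly f q"
  by (rule poly_eqI) (simp add: coeff_map_poly assms)

lemma map_poly_hom_mult:
  fixes f :: "'a::comm_semiring_0 \<Rightarrow> 'b::comm_semiring_0"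
  assumes "f 0 = 0" "\<And>x y. f (x + y) = f x + f y" "\<And>x y. f (x * y) = f x * f y"
  shows "map_poly f (p * q) = map_poly f p * map_poly f q"
proof (rule poly_eqI)
  fix n
  have "f (sum g A) = (\<Sum>i\<in>A. f (g i))" for g and A :: "nat set"
    by (induction A rule: infinite_finite_induct) (auto simp: assms)
  thus "coeff (map_poly f (p * q)) n = coeff (map_poly f p * map_poly f q) n"
    by (simp add: coeff_map_poly coeff_mult assms)
qed

lemma map_poly_hom_prod:
  fixes f :: "'a::comm_semiring_1 \<Rightarrow> 'b::comm_semiring_1"
  assumes "f 0 = 0" "f 1 = 1" "\<And>x y. f (x + y) = f x + f y" "\<And>x y. f (x * y) = f x * f y"
  shows "map_poly f (\<Prod>i\<in>A. P i) = (\<Prod>i\<in>A. map_poly f (P i))"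
  by (induction A rule: infinite_finite_induct)
     (auto simp: map_poly_hom_mult[of f, OF assms(1,3,4)] map_poly_1' assms(2))

lemma map_poly_hom_power:
  fixes f :: "'a::comm_semiring_1 \<Rightarrow> 'b::comm_semiring_1"
  assumes "f 0 = 0" "f 1 = 1" "\<And>x y. f (x + y) = f x + f y" "\<And>x y. f (x * y) = f x * f y"
  shows "map_poly f (P ^ n) = map_poly f P ^ n"
  by (induction n) (auto simp: map_poly_hom_mult[of f, OF assms(1,3,4)] map_poly_1' assms(2))

abbreviation poly_to_ac :: "'a::field poly \<Rightarrow> 'a alg_closure poly" where
  "poly_to_ac \<equiv> map_poly to_ac"

lemma poly_to_ac_mult: "poly_to_ac (p * q) = poly_to_ac p * poly_to_ac q"
  by (rule map_poly_hom_mult) auto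

lemma poly_to_ac_add: "poly_to_ac (p + q) = poly_to_ac p + poly_to_ac q"
  by (rule map_poly_hom_add) auto

lemma degree_poly_to_ac [simp]: "degree (poly_to_ac p) = degree p"
  by (rule degree_map_poly) auto

lemma poly_to_ac_eq_0_iff [simp]: "poly_to_ac p = 0 \<longleftrightarrow> p = 0"
  by (metis map_poly_0 coeff_map_poly leading_coeff_0_iff degree_poly_to_ac to_ac_0 to_ac_eq_0_iff)

lemma poly_poly_to_ac_0: "poly (poly_to_ac p) 0 = to_ac (poly p 0)"
  by (simp add: poly_0_coeff_0 coeff_map_poly)

text \<open>Division with remainder over the small field remains a division with remainder after
  base change, since degrees are preserved; so divisibility above kills the remainder below.\<close>

lemma poly_to_ac_dvd_iff:
  fixes p q :: "'a::field poly"
  shows "poly_to_ac p dvd poly_to_ac q \<longleftrightarrow> p dvd q"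
proof
  assume *: "poly_to_ac p dvd poly_to_ac q"
  show "p dvd q"
  proof (cases "p = 0")
    case True
    thus ?thesis using * by simp
  next
    case False
    have "q = q div p * p + q mod p" by simp
    hence "poly_to_ac q = poly_to_ac (q div p) * poly_to_ac p + poly_to_ac (q mod p)"
      by (metis poly_to_ac_add poly_to_ac_mult)
    hence "poly_to_ac p dvd poly_to_ac (q mod p)" using *
      by (metis dvd_add_right_iff dvd_triv_right)
    hence "degree p \<le> degree (q mod p)" if "q mod p \<noteq> 0"
      using dvd_imp_degree_le[of "poly_to_ac p" "poly_to_ac (q mod p)"] that by simp
    hence "q mod p = 0" using degree_mod_less[OF False, of q] by force
    thus ?thesis by auto
  qed
qed (auto simp: dvd_def poly_to_ac_mult)

text \<open>The product over the other points does not vanish at \<open>x\<close>, so the whole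
  multiplicity of \<open>P\<close> at \<open>x\<close> survives in the cofactor.\<close>

lemma prod_linear_power_dvd:
  fixes P :: "'a::field poly"
  assumes "finite S" "P \<noteq> 0" "\<And>x. x \<in> S \<Longrightarrow> r \<le> order x P"
  shows "(\<Prod>x\<in>S. [:-x, 1:] ^ r) dvd P"
  using assms
proof (induction S rule: finite_induct)
  case (insert x S)
  define R where "R = (\<Prod>x\<in>S. [:-x, 1:] ^ r)"
  obtain Q where Q: "P = R * Q" using insert by (auto simp: R_def)
  have "poly R x \<noteq> 0" using insert.hyps by (auto simp: R_def poly_prod)
  hence "order x R = 0" by (rule order_0I)
  hence "order x P = order x Q" using insert.prems(1) by (simp add: Q order_mult)
  hence "[:-x, 1:] ^ r dvd Q" using insert.prems(2)[of x] by (simp add: order_divides)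
  thus ?case using insert.hyps Q by (simp add: R_def[symmetric] mult.commute mult_dvd_mono)
qed simp

lemma order_prod_mset_linear:
  fixes A :: "'a::field multiset"
  shows "order x (\<Prod>y\<in>#A. [:-y, 1:]) = count A x"
proof (induction A)
  case (add y A)
  have "(\<Prod>y\<in>#A. [:-y, 1:]) \<noteq> 0" by (auto simp: prod_mset_zero_iff)
  hence nz: "[:-y, 1:] * (\<Prod>y\<in>#A. [:-y, 1:]) \<noteq> 0"
    unfolding mult_eq_0_iff by simp
  have "order x ([:-y, 1:] * (\<Prod>y\<in>#A. [:-y, 1:])) = order x [:-y, 1:] + count A x"
    unfolding order_mult[OF nz] add ..
  moreover have "order x [:-y, 1:] = (if x = y then 1 else 0)"
    using order_power_n_n[of y 1] by (auto intro: order_0I)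
  ultimately show ?case by simp
qed simp

lemma sum_order_eq_degree:
  fixes P :: "'a::alg_closed_field poly"
  assumes "P \<noteq> 0"
  shows "(\<Sum>x | poly P x = 0. order x P) = degree P"
proof -
  obtain A where A: "size A = degree P" "P = smult (lead_coeff P) (\<Prod>x\<in>#A. [:-x, 1:])"
    using alg_closed_imp_factorization[OF assms] by blast
  have ord: "order x P = count A x" for x
    using assms by (subst A(2)) (simp add: order_smult order_prod_mset_linear)
  have "{x. poly P x = 0} = set_mset A"
    using assms by (auto simp: order_root ord)
  thus ?thesis using A(1) by (simp add: ord size_multiset_overloaded_eq)
qed

section \<open>Frobenius orbits and reversed characteristic polynomials\<close>

locale finite_field_card =
  fixes p n :: nat and ty :: "'a::{field,finite} itself"
  assumes prime_p: "prime p" and card_eq: "CARD('a) = p ^ n"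
begin

lemma CHAR_eq: "CHAR('a) = p"
proof -
  have "CHAR('a) dvd p ^ n" using CHAR_dvd_CARD[where 'a='a] by (simp add: card_eq)
  moreover have "CHAR('a) > 0" by (rule finite_imp_CHAR_pos) simp
  hence "prime CHAR('a)" by (rule prime_CHAR_semidom)
  ultimately have "CHAR('a) dvd p" by (metis prime_dvd_power)
  thus ?thesis using prime_p \<open>prime CHAR('a)\<close> by (simp add: primes_dvd_imp_eq)
qed

lemma frobenius_add: "(x + y) ^ (CARD('a) ^ k) = x ^ (CARD('a) ^ k) + y ^ (CARD('a) ^ k)"
  for x y :: "'a alg_closure"
  by (rule freshmans_dream'[of _ "n * k"]) (simp_all add: CHAR_eq prime_p card_eq power_mult)

lemma card_power_pos: "CARD('a) ^ k > 0"
  using card_field_ge_2[where 'a='a] by simp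

lemma frobenius_0: "(0 :: 'a alg_closure) ^ (CARD('a) ^ k) = 0"
  by (metis card_power_pos power_0_left less_not_refl)

lemma frobenius_inj:
  fixes x y :: "'a alg_closure"
  assumes "x ^ (CARD('a) ^ k) = y ^ (CARD('a) ^ k)"
  shows "x = y"
proof -
  have "x ^ (CARD('a) ^ k) = (x - y) ^ (CARD('a) ^ k) + y ^ (CARD('a) ^ k)"
    using frobenius_add[of "x - y" y k] by simp
  hence "(x - y) ^ (CARD('a) ^ k) = 0" using assms by simp
  thus ?thesis by simp
qed

lemma finite_fixed_points:
  assumes "k > 0"
  shows "finite {x :: 'a alg_closure. x ^ (CARD('a) ^ k) = x}"
    and "card {x :: 'a alg_closure. x ^ (CARD('a) ^ k) = x} \<le> CARD('a) ^ k"
proof -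
  define P where "P = monom (1 :: 'a alg_closure) (CARD('a) ^ k) - monom 1 1"
  have "CARD('a) ^ 1 \<le> CARD('a) ^ k"
    using assms card_field_ge_2[where 'a='a] by (intro power_increasing) auto
  hence gt: "CARD('a) ^ k > 1" using card_field_ge_2[where 'a='a] by simp
  hence "coeff P (CARD('a) ^ k) = 1" by (simp add: P_def)
  hence P0: "P \<noteq> 0" by auto
  have "degree P \<le> CARD('a) ^ k"
    unfolding P_def using gt by (intro degree_diff_le) (auto simp: degree_monom_eq)
  moreover have eq: "{x. poly P x = 0} = {x :: 'a alg_closure. x ^ (CARD('a) ^ k) = x}"
    by (auto simp: P_def poly_monom)
  ultimately show "finite {x :: 'a alg_closure. x ^ (CARD('a) ^ k) = x}"
    "card {x :: 'a alg_closure. x ^ (CARD('a) ^ k) = x} \<le> CARD('a) ^ k"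
    using poly_roots_finite[OF P0] card_poly_roots_bound[OF P0] by auto
qed

lemma frobenius_fixed_iff: "x ^ CARD('a) = x \<longleftrightarrow> x \<in> range (to_ac :: 'a \<Rightarrow> 'a alg_closure)"
proof -
  have sub: "range (to_ac :: 'a \<Rightarrow> _) \<subseteq> {x. x ^ (CARD('a) ^ 1) = x}"
    by (auto simp: field_power_card simp flip: to_ac_power)
  have "card (range (to_ac :: 'a \<Rightarrow> 'a alg_closure)) = CARD('a)"
    by (intro card_image inj_to_ac)
  hence "range (to_ac :: 'a \<Rightarrow> 'a alg_closure) = {x. x ^ (CARD('a) ^ 1) = x}"
    using finite_fixed_points[of 1] sub by (intro card_seteq) auto
  thus ?thesis by auto
qed

definition fixed_units :: "nat \<Rightarrow> 'a alg_closure set" where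
  "fixed_units k = {b. b \<noteq> 0 \<and> b ^ (CARD('a) ^ k) = b}"

lemma finite_fixed_units: "k > 0 \<Longrightarrow> finite (fixed_units k)"
  using finite_fixed_points(1)[of k] by (rule finite_subset[rotated]) (auto simp: fixed_units_def)

text \<open>The reversed characteristic polynomial of \<open>b\<close> over \<open>F_q\<close>. For
  nonzero \<open>b\<close> of degree \<open>m\<close> over \<open>F_q\<close> with \<open>m\<close>
  dividing \<open>k\<close>, its reciprocal roots are the conjugates of \<open>b\<close>, each taken
  \<open>k / m\<close> times.\<close>

definition conj_poly :: "nat \<Rightarrow> 'a alg_closure \<Rightarrow> 'a alg_closure poly" where
  "conj_poly k b = (\<Prod>j<k. [:1, - (b ^ (CARD('a) ^ j)):])"

text \<open>\<open>of_ac\<close> inverts \<open>to_ac\<close> on the range of the latter, so this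
  descent is meaningful once the coefficients of \<open>conj_poly k b\<close> are fixed by
  Frobenius, which follows from \<open>b ^ (q ^ k) = b\<close>.\<close>

definition norm_poly :: "nat \<Rightarrow> 'a alg_closure \<Rightarrow> 'a poly" where
  "norm_poly k b = map_poly of_ac (conj_poly k b)"

text \<open>Raising to the power \<open>q\<close> moves each linear factor to the next one, and
  periodicity of \<open>b\<close> closes the cycle.\<close>

lemma frobenius_conj_poly:
  assumes "b ^ (CARD('a) ^ k) = b"
  shows "map_poly (\<lambda>x. x ^ CARD('a)) (conj_poly k b) = conj_poly k b"
proof -
  have add: "(x + y) ^ CARD('a) = x ^ CARD('a) + y ^ CARD('a)" for x y :: "'a alg_closure"
    using frobenius_add[of x y 1] by simp
  have q0: "(0::'a alg_closure) ^ CARD('a) = 0" using frobenius_0[of 1] by simp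
  have neg: "(- x) ^ CARD('a) = - (x ^ CARD('a))" for x :: "'a alg_closure"
    using add[of x "- x"] q0 by (simp add: eq_neg_iff_add_eq_0 add.commute)
  have "map_poly (\<lambda>x. x ^ CARD('a)) (conj_poly k b)
      = (\<Prod>j<k. map_poly (\<lambda>x. x ^ CARD('a)) [:1, - (b ^ (CARD('a) ^ j)):])"
    unfolding conj_poly_def by (rule map_poly_hom_prod) (auto simp: add power_mult_distrib q0)
  also have "\<dots> = (\<Prod>j<k. [:1, - (b ^ (CARD('a) ^ Suc j)):])"
    by (intro prod.cong refl) (simp add: map_poly_pCons q0 neg mult.commute flip: power_mult)
  also have "\<dots> = conj_poly k b"
  proof (cases k)
    case (Suc m)
    have "(\<Prod>j<k. [:1, - (b ^ (CARD('a) ^ Suc j)):])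
        = [:1, - (b ^ (CARD('a) ^ 0)):] * (\<Prod>j<m. [:1, - (b ^ (CARD('a) ^ Suc j)):])"
      using assms by (simp add: Suc mult.commute)
    also have "\<dots> = conj_poly k b"
      unfolding conj_poly_def Suc prod.lessThan_Suc_shift by simp
    finally show ?thesis .
  qed (simp add: conj_poly_def)
  finally show ?thesis .
qed

lemma poly_to_ac_norm_poly:
  assumes "b ^ (CARD('a) ^ k) = b"
  shows "poly_to_ac (norm_poly k b) = conj_poly k b"
proof (rule poly_eqI)
  fix i
  have "coeff (conj_poly k b) i ^ CARD('a) = coeff (conj_poly k b) i"
    using arg_cong[OF frobenius_conj_poly[OF assms], of "\<lambda>P. coeff P i"] frobenius_0[of 1]
    by (simp add: coeff_map_poly)
  thus "coeff (poly_to_ac (norm_poly k b)) i = coeff (conj_poly k b) i"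
    by (simp add: norm_poly_def coeff_map_poly frobenius_fixed_iff to_ac_of_ac)
qed

lemma conj_poly_0: "poly (conj_poly k b) 0 = 1"
  by (simp add: conj_poly_def poly_prod)

lemma degree_conj_poly: "b \<noteq> 0 \<Longrightarrow> degree (conj_poly k b) = k"
  unfolding conj_poly_def by (subst degree_prod_eq_sum_degree) auto

lemma poly_to_ac_frobenius:
  "map_poly (\<lambda>x. x ^ CARD('a)) (poly_to_ac P) = poly_to_ac (P :: 'a poly)"
  using frobenius_0[of 1]
  by (intro poly_eqI) (simp add: coeff_map_poly field_power_card flip: to_ac_power)

text \<open>The coefficientwise Frobenius fixes a polynomial over \<open>F_q\<close> and sends the
  factor \<open>X - x\<close> to \<open>X - x ^ q\<close>. This one direction is enough to pass from
  \<open>inverse b\<close> to all its conjugates.\<close>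

lemma order_frobenius_ge:
  fixes P :: "'a poly"
  assumes "P \<noteq> 0"
  shows "order x (poly_to_ac P) \<le> order (x ^ CARD('a)) (poly_to_ac P)"
proof -
  let ?F = "map_poly (\<lambda>x :: 'a alg_closure. x ^ CARD('a))"
  have add: "(x + y) ^ CARD('a) = x ^ CARD('a) + y ^ CARD('a)" for x y :: "'a alg_closure"
    using frobenius_add[of x y 1] by simp
  have q0: "(0::'a alg_closure) ^ CARD('a) = 0" using frobenius_0[of 1] by simp
  have neg: "(- x) ^ CARD('a) = - (x ^ CARD('a))" for x :: "'a alg_closure"
    using add[of x "- x"] q0 by (simp add: eq_neg_iff_add_eq_0 add.commute)
  define r where "r = order x (poly_to_ac P)"
  obtain Q where "poly_to_ac P = [:-x, 1:] ^ r * Q" using order_1[of x "poly_to_ac P"] r_def by blast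
  hence "?F (poly_to_ac P) = ?F ([:-x, 1:] ^ r * Q)" by simp
  also have "\<dots> = ?F ([:-x, 1:] ^ r) * ?F Q"
    by (rule map_poly_hom_mult) (simp_all add: add q0 power_mult_distrib)
  also have "?F ([:-x, 1:] ^ r) = ?F [:-x, 1:] ^ r"
    by (rule map_poly_hom_power) (simp_all add: add q0 power_mult_distrib)
  also have "?F [:-x, 1:] = [:- (x ^ CARD('a)), 1:]"
    by (simp add: map_poly_pCons q0 neg)
  finally have "[:- (x ^ CARD('a)), 1:] ^ r dvd poly_to_ac P"
    by (simp add: poly_to_ac_frobenius)
  thus ?thesis using assms by (simp add: order_divides r_def)
qed

lemma order_frobenius_iter_ge:
  fixes P :: "'a poly"
  assumes "P \<noteq> 0"
  shows "order x (poly_to_ac P) \<le> order (x ^ (CARD('a) ^ j)) (poly_to_ac P)"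
proof (induction j)
  case (Suc j)
  also have "order (x ^ (CARD('a) ^ j)) (poly_to_ac P)
      \<le> order ((x ^ (CARD('a) ^ j)) ^ CARD('a)) (poly_to_ac P)"
    by (rule order_frobenius_ge[OF assms])
  also have "(x ^ (CARD('a) ^ j)) ^ CARD('a) = x ^ (CARD('a) ^ Suc j)"
    by (simp add: mult.commute flip: power_mult)
  finally show ?case .
qed simp

lemma frobenius_period:
  fixes b :: "'a alg_closure"
  assumes "b ^ (CARD('a) ^ m) = b"
  shows "b ^ (CARD('a) ^ (m * r + i)) = b ^ (CARD('a) ^ i)"
proof (induction r)
  case (Suc r)
  have "b ^ (CARD('a) ^ (m * Suc r + i)) = (b ^ (CARD('a) ^ m)) ^ (CARD('a) ^ (m * r + i))"
    by (simp add: power_add algebra_simps flip: power_mult)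
  thus ?case using Suc assms by simp
qed simp

lemma conj_poly_period:
  assumes "b ^ (CARD('a) ^ m) = b"
  shows "conj_poly (m * r) b = conj_poly m b ^ r"
proof (induction r)
  case (Suc r)
  have split: "(\<Prod>j<a + c. g j) = (\<Prod>j<a. g j) * (\<Prod>j<c. g (a + j))"
    for a c and g :: "nat \<Rightarrow> 'a alg_closure poly"
    by (induction c) (simp_all add: mult_ac)
  have "conj_poly (m * Suc r) b = conj_poly (m * r + m) b" by (simp add: algebra_simps)
  also have "\<dots> = conj_poly (m * r) b * conj_poly m b"
    unfolding conj_poly_def split by (simp add: frobenius_period[OF assms])
  finally show ?case using Suc by simp
qed (simp add: conj_poly_def)

end

section \<open>Logarithmic derivatives of L-series\<close>

context finite_field_card
begin

text \<open>Here \<open>m\<close> is the degree of \<open>b\<close> over \<open>F_q\<close>, so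
  \<open>conj_poly m b\<close> has \<open>m\<close> distinct simple roots and
  \<open>conj_poly (m * r) b\<close> is its \<open>r\<close>-th power. Since multiplicities in
  \<open>P\<close> do not drop along the Frobenius orbit, divisibility is decided at
  \<open>inverse b\<close> alone.\<close>

lemma dvd_conj_poly_iff_le_order:
  fixes P :: "'a poly"
  assumes P: "P \<noteq> 0" and b: "b \<noteq> 0" and m: "m > 0" "b ^ (CARD('a) ^ m) = b"
    and least: "\<And>k. 0 < k \<Longrightarrow> k < m \<Longrightarrow> b ^ (CARD('a) ^ k) \<noteq> b"
  shows "conj_poly (m * r) b dvd poly_to_ac P \<longleftrightarrow> r \<le> order (inverse b) (poly_to_ac P)"
proof -
  define c where "c j = b ^ (CARD('a) ^ j)" for j
  have c0: "c j \<noteq> 0" for j using b by (simp add: c_def)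
  have lin: "[:1, - c j:] = smult (- c j) [:- inverse (c j), 1:]" for j
    using c0[of j] by simp
  \<comment> \<open>An equality \<open>c i = c j\<close> is a Frobenius image of
    \<open>b = b ^ (q ^ (j - i))\<close>; injectivity of Frobenius would then give a period shorter
    than \<open>m\<close>.\<close>
  have inj: "inj_on c {..<m}"
  proof -
    have "c i \<noteq> c j" if "i < j" "j < m" for i j
    proof
      assume "c i = c j"
      also have "c j = (b ^ (CARD('a) ^ (j - i))) ^ (CARD('a) ^ i)"
        using that by (simp add: c_def flip: power_mult power_add)
      finally have "b ^ (CARD('a) ^ (j - i)) = b" unfolding c_def by (metis frobenius_inj)
      thus False using least[of "j - i"] that by simp
    qed
    thus ?thesis by (metis (no_types, lifting) inj_onI lessThan_iff linorder_neqE_nat)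
  qed
  have "conj_poly m b = (\<Prod>j<m. smult (- c j) [:- inverse (c j), 1:])"
    unfolding conj_poly_def c_def[symmetric] lin ..
  also have "\<dots> = smult (\<Prod>j<m. - c j) (\<Prod>j<m. [:- inverse (c j), 1:])"
    by (rule prod_smult)
  also have "(\<Prod>j<m. [:- inverse (c j), 1:]) = (\<Prod>x\<in>(\<lambda>j. inverse (c j)) ` {..<m}. [:-x, 1:])"
    using inj by (subst prod.reindex) (auto simp: inj_on_def)
  finally have cm: "conj_poly m b = smult (\<Prod>j<m. - c j) (\<Prod>x\<in>(\<lambda>j. inverse (c j)) ` {..<m}. [:-x, 1:])" .
  have nz: "(\<Prod>j<m. (- c j) ^ r) \<noteq> 0" using c0 by simp
  have *: "conj_poly (m * r) b dvd Q \<longleftrightarrow>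
      (\<Prod>x\<in>(\<lambda>j. inverse (c j)) ` {..<m}. [:-x, 1:] ^ r) dvd Q" for Q
    unfolding conj_poly_period[OF m(2)] cm smult_power prod_power_distrib
    by (simp only: smult_dvd_iff nz if_False)
  show ?thesis
  proof
    assume "conj_poly (m * r) b dvd poly_to_ac P"
    hence "(\<Prod>x\<in>(\<lambda>j. inverse (c j)) ` {..<m}. [:-x, 1:] ^ r) dvd poly_to_ac P" unfolding * .
    moreover have "[:- inverse b, 1:] ^ r dvd (\<Prod>x\<in>(\<lambda>j. inverse (c j)) ` {..<m}. [:-x, 1:] ^ r)"
      using m(1) by (intro dvd_prodI) (auto simp: c_def intro!: image_eqI[of _ _ 0])
    ultimately have "[:- inverse b, 1:] ^ r dvd poly_to_ac P" by (rule dvd_trans[rotated])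
    thus "r \<le> order (inverse b) (poly_to_ac P)" using P by (simp add: order_divides)
  next
    assume r: "r \<le> order (inverse b) (poly_to_ac P)"
    have "r \<le> order (inverse (c j)) (poly_to_ac P)" for j
      using r order_frobenius_iter_ge[OF P, of "inverse b" j] by (simp add: c_def power_inverse)
    thus "conj_poly (m * r) b dvd poly_to_ac P"
      unfolding * using P by (intro prod_linear_power_dvd) auto
  qed
qed

text \<open>The orbit of \<open>inverse b\<close> stays inside the finite root set of
  \<open>P\<close>, so it repeats, and injectivity of Frobenius pulls the repetition back to the
  start.\<close>

lemma root_frobenius_periodic:
  fixes P :: "'a poly"
  assumes P: "P \<noteq> 0" and root: "order (inverse b) (poly_to_ac P) > 0"
  shows "\<exists>m>0. b ^ (CARD('a) ^ m) = b"
proof -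
  define f where "f j = inverse b ^ (CARD('a) ^ j)" for j
  have "range f \<subseteq> {x. poly (poly_to_ac P) x = 0}"
  proof
    fix x assume "x \<in> range f"
    then obtain j where "x = f j" by blast
    hence "order x (poly_to_ac P) > 0"
      using order_frobenius_iter_ge[OF P, of "inverse b" j] root by (simp add: f_def)
    thus "x \<in> {x. poly (poly_to_ac P) x = 0}" using P by (simp add: order_root)
  qed
  hence "finite (range f)" by (rule finite_subset) (use P in \<open>auto intro: poly_roots_finite\<close>)
  hence "\<not> inj f" by (metis finite_imageD infinite_UNIV_nat)
  then obtain i j where "f i = f j" "i < j" by (metis injI linorder_neqE_nat)
  hence "b ^ (CARD('a) ^ i) = (b ^ (CARD('a) ^ (j - i))) ^ (CARD('a) ^ i)"
    by (simp add: f_def power_inverse flip: power_mult power_add)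
  hence "b ^ (CARD('a) ^ (j - i)) = b" by (metis frobenius_inj)
  thus ?thesis using \<open>i < j\<close> by (intro exI[of _ "j - i"]) simp
qed

text \<open>The admissible \<open>k\<close> are the multiples \<open>m * r\<close> of the least
  period of \<open>b\<close> with \<open>r\<close> between \<open>1\<close> and the multiplicity of
  \<open>inverse b\<close>. Without a period there is no such \<open>k\<close>, and
  \<open>inverse b\<close> is not a root.\<close>

lemma card_conj_poly_dvd:
  fixes P :: "'a poly"
  assumes P: "P \<noteq> 0" and b: "b \<noteq> 0"
  shows "finite {k. k > 0 \<and> b ^ (CARD('a) ^ k) = b \<and> conj_poly k b dvd poly_to_ac P}"
    and "card {k. k > 0 \<and> b ^ (CARD('a) ^ k) = b \<and> conj_poly k b dvd poly_to_ac P}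
           = order (inverse b) (poly_to_ac P)"
proof -
  let ?S = "{k. k > 0 \<and> b ^ (CARD('a) ^ k) = b \<and> conj_poly k b dvd poly_to_ac P}"
  define e where "e = order (inverse b) (poly_to_ac P)"
  have "finite ?S \<and> card ?S = e"
  proof (cases "\<exists>m>0. b ^ (CARD('a) ^ m) = b")
    case False
    have "e = 0"
    proof (rule ccontr)
      assume "e \<noteq> 0"
      thus False using root_frobenius_periodic[OF P, of b] False by (simp add: e_def)
    qed
    moreover have S: "?S = {}" using False by blast
    ultimately show ?thesis unfolding S by simp
  next
    case True
    define m where "m = (LEAST m. m > 0 \<and> b ^ (CARD('a) ^ m) = b)"
    have m: "m > 0" "b ^ (CARD('a) ^ m) = b"
      using LeastI_ex[of "\<lambda>m. m > 0 \<and> b ^ (CARD('a) ^ m) = b"] True by (auto simp: m_def)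
    have least: "b ^ (CARD('a) ^ k) \<noteq> b" if "0 < k" "k < m" for k
      using not_less_Least[of k "\<lambda>m. m > 0 \<and> b ^ (CARD('a) ^ m) = b"] that by (auto simp: m_def)
    have dvd: "m dvd k" if "b ^ (CARD('a) ^ k) = b" for k
    proof -
      have "b ^ (CARD('a) ^ (k mod m)) = b"
        using frobenius_period[OF m(2), of "k div m" "k mod m"] that by simp
      hence "k mod m = 0" using least[of "k mod m"] m(1) by auto
      thus ?thesis by auto
    qed
    have fixed: "b ^ (CARD('a) ^ (m * r)) = b" for r
      using frobenius_period[OF m(2), of r 0] by simp
    have le: "conj_poly (m * r) b dvd poly_to_ac P \<longleftrightarrow> r \<le> e" for r
      unfolding e_def by (rule dvd_conj_poly_iff_le_order[OF P b m]) (rule least)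
    have "?S = (\<lambda>r. m * r) ` {r. m * r > 0 \<and> conj_poly (m * r) b dvd poly_to_ac P}"
      using fixed by (auto simp del: nat_0_less_mult_iff dest!: dvd elim!: dvdE[of m])
    also have "{r. m * r > 0 \<and> conj_poly (m * r) b dvd poly_to_ac P} = {1..e}"
      unfolding le using m(1) by auto
    finally have S: "?S = (\<lambda>r. m * r) ` {1..e}" .
    show ?thesis unfolding S using m(1) by (auto simp: card_image inj_on_def)
  qed
  thus "finite ?S" "card ?S = order (inverse b) (poly_to_ac P)" by (auto simp: e_def)
qed

text \<open>Reversal identifies these with the monic polynomials of degree \<open>m\<close> that do
  not vanish at \<open>0\<close>. The normalization at \<open>0\<close> is closed under products and
  leaves the leading coefficient free.\<close>

definition unit_polys :: "nat \<Rightarrow> 'a poly set" where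
  "unit_polys m = {P. poly P 0 = 1 \<and> degree P = m}"

lemma finite_unit_polys: "finite (unit_polys m)"
proof -
  have "unit_polys m \<subseteq> Poly ` {xs. set xs \<subseteq> UNIV \<and> length xs = Suc m}"
  proof
    fix P assume "P \<in> unit_polys m"
    hence "P \<noteq> 0" "degree P = m" by (auto simp: unit_polys_def)
    hence "length (coeffs P) = Suc m" by (simp add: length_coeffs_degree)
    thus "P \<in> Poly ` {xs. set xs \<subseteq> UNIV \<and> length xs = Suc m}"
      by (intro image_eqI[of _ _ "coeffs P"]) auto
  qed
  thus ?thesis by (rule finite_subset) (intro finite_imageI finite_lists_length_eq, simp)
qed

lemma norm_poly_unit_polys:
  assumes "b \<in> fixed_units k"
  shows "norm_poly k b \<in> unit_polys k"
proof -
  have b: "b \<noteq> 0" "b ^ (CARD('a) ^ k) = b" using assms by (auto simp: fixed_units_def)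
  have "degree (norm_poly k b) = k"
    using degree_conj_poly[OF b(1), of k] by (simp flip: poly_to_ac_norm_poly[OF b(2)])
  moreover have "to_ac (poly (norm_poly k b) 0) = to_ac 1"
    using conj_poly_0[of k b] by (simp add: poly_poly_to_ac_0 flip: poly_to_ac_norm_poly[OF b(2)])
  hence "poly (norm_poly k b) 0 = 1" unfolding to_ac_eq_iff .
  ultimately show ?thesis by (simp add: unit_polys_def)
qed

text \<open>Sorting the pairs \<open>(k, b)\<close> by the root \<open>inverse b\<close> gives each
  root of \<open>P\<close> as many pairs as its multiplicity, and the multiplicities add up to the
  degree. The bound \<open>k \<le> m\<close> is automatic because \<open>conj_poly k b\<close> has
  degree \<open>k\<close>.\<close>

lemma card_norm_poly_divisors:
  assumes P: "P \<in> unit_polys m"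
  shows "card (SIGMA k:{1..m}. {b \<in> fixed_units k. norm_poly k b dvd P}) = m"
proof -
  have P0: "P \<noteq> 0" using P by (auto simp: unit_polys_def)
  define R where "R = {x. poly (poly_to_ac P) x = 0}"
  have finR: "finite R" unfolding R_def by (rule poly_roots_finite) (use P0 in simp)
  have nz: "0 \<notin> R" using P by (auto simp: R_def unit_polys_def poly_poly_to_ac_0)
  define S where "S b = {k. k > 0 \<and> b ^ (CARD('a) ^ k) = b \<and> conj_poly k b dvd poly_to_ac P}" for b
  have dvd: "norm_poly k b dvd P \<longleftrightarrow> conj_poly k b dvd poly_to_ac P"
    if "b ^ (CARD('a) ^ k) = b" for k b
    unfolding poly_to_ac_norm_poly[OF that, symmetric] poly_to_ac_dvd_iff ..
  have le: "k \<le> m" if "conj_poly k b dvd poly_to_ac P" "b \<noteq> 0" for k b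
    using dvd_imp_degree_le[OF that(1)] P0 P degree_conj_poly[OF that(2)] by (simp add: unit_polys_def)
  have le': "k \<le> m" if "conj_poly k (inverse x) dvd poly_to_ac P" "x \<in> R" for k x
    using le[OF that(1)] that(2) nz by auto
  have root: "inverse b \<in> R" if "conj_poly k b dvd poly_to_ac P" "b \<noteq> 0" "k > 0" for k b
  proof -
    have "poly [:1, - (b ^ CARD('a) ^ 0):] (inverse b) = 0" using that by simp
    hence "poly (conj_poly k b) (inverse b) = 0"
      unfolding conj_poly_def poly_prod using that(3) by (auto intro!: prod_zero bexI[of _ 0])
    thus ?thesis using that(1) by (auto simp: R_def elim!: dvdE)
  qed
  have "bij_betw (\<lambda>(k, b). (inverse b, k)) (SIGMA k:{1..m}. {b \<in> fixed_units k. norm_poly k b dvd P})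
      (SIGMA x:R. S (inverse x))"
    by (rule bij_betw_byWitness[where f' = "\<lambda>(x, k). (k, inverse x)"])
       (use nz root le le' dvd in \<open>auto simp: S_def fixed_units_def\<close>)
  hence "card (SIGMA k:{1..m}. {b \<in> fixed_units k. norm_poly k b dvd P}) = card (SIGMA x:R. S (inverse x))"
    by (rule bij_betw_same_card)
  also have "\<dots> = (\<Sum>x\<in>R. card (S (inverse x)))"
  proof (intro card_SigmaI finR ballI)
    fix x assume "x \<in> R"
    hence "inverse x \<noteq> 0" using nz by auto
    thus "finite (S (inverse x))" unfolding S_def by (rule card_conj_poly_dvd(1)[OF P0])
  qed
  also have "\<dots> = (\<Sum>x\<in>R. order x (poly_to_ac P))"
  proof (rule sum.cong[OF refl])
    fix x assume "x \<in> R"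
    hence "inverse x \<noteq> 0" using nz by auto
    thus "card (S (inverse x)) = order x (poly_to_ac P)"
      using card_conj_poly_dvd(2)[OF P0, of "inverse x"] by (simp add: S_def)
  qed
  also have "\<dots> = m"
    unfolding R_def using sum_order_eq_degree[of "poly_to_ac P"] P0 P by (simp add: unit_polys_def)
  finally show ?thesis .
qed

text \<open>The coefficient form of \<open>X A' = A \<Lambda>\<close>, where \<open>A\<close> is the L-series of \<open>\<Phi>\<close>: a polynomial of
  degree \<open>m\<close> is counted once for each of its \<open>m\<close> divisors \<open>norm_poly k b\<close>.\<close>

lemma log_derivative_L_series:
  fixes \<Phi> :: "'a poly \<Rightarrow> complex"
  assumes mult: "\<And>P Q. poly P 0 = 1 \<Longrightarrow> poly Q 0 = 1 \<Longrightarrow> \<Phi> (P * Q) = \<Phi> P * \<Phi> Q"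
  shows "of_nat m * (\<Sum>P\<in>unit_polys m. \<Phi> P)
       = (\<Sum>k=1..m. (\<Sum>b\<in>fixed_units k. \<Phi> (norm_poly k b)) * (\<Sum>Q\<in>unit_polys (m - k). \<Phi> Q))"
proof -
  have inner: "(\<Sum>P | P \<in> unit_polys m \<and> norm_poly k b dvd P. \<Phi> P)
      = \<Phi> (norm_poly k b) * (\<Sum>Q\<in>unit_polys (m - k). \<Phi> Q)"
    if k: "k \<in> {1..m}" and b: "b \<in> fixed_units k" for k b
  proof -
    let ?c = "norm_poly k b"
    have c: "?c \<in> unit_polys k" by (rule norm_poly_unit_polys[OF b])
    hence c0: "?c \<noteq> 0" by (auto simp: unit_polys_def)
    have "{P \<in> unit_polys m. ?c dvd P} = (\<lambda>Q. ?c * Q) ` unit_polys (m - k)"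
    proof (intro equalityI subsetI)
      fix P assume P: "P \<in> {P \<in> unit_polys m. ?c dvd P}"
      then obtain Q where Q: "P = ?c * Q" by blast
      hence "Q \<noteq> 0" using P by (auto simp: unit_polys_def)
      hence "Q \<in> unit_polys (m - k)" using P c c0 by (auto simp: Q unit_polys_def degree_mult_eq)
      thus "P \<in> (\<lambda>Q. ?c * Q) ` unit_polys (m - k)" using Q by blast
    next
      fix P assume "P \<in> (\<lambda>Q. ?c * Q) ` unit_polys (m - k)"
      then obtain Q where Q: "P = ?c * Q" "Q \<in> unit_polys (m - k)" by blast
      hence "Q \<noteq> 0" by (auto simp: unit_polys_def)
      thus "P \<in> {P \<in> unit_polys m. ?c dvd P}"
        using Q c c0 k by (auto simp: unit_polys_def degree_mult_eq)
    qed
    moreover have "inj_on (\<lambda>Q. ?c * Q) (unit_polys (m - k))" using c0 by (auto simp: inj_on_def)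
    ultimately have "(\<Sum>P\<in>{P \<in> unit_polys m. ?c dvd P}. \<Phi> P) = (\<Sum>Q\<in>unit_polys (m - k). \<Phi> (?c * Q))"
      by (simp add: sum.reindex)
    also have "\<dots> = (\<Sum>Q\<in>unit_polys (m - k). \<Phi> ?c * \<Phi> Q)"
      using c by (intro sum.cong refl mult) (auto simp: unit_polys_def)
    finally show ?thesis by (simp add: sum_distrib_left)
  qed
  have "of_nat m * (\<Sum>P\<in>unit_polys m. \<Phi> P)
      = (\<Sum>P\<in>unit_polys m. of_nat (card (SIGMA k:{1..m}. {b \<in> fixed_units k. norm_poly k b dvd P})) * \<Phi> P)"
    unfolding sum_distrib_left by (intro sum.cong[OF refl]) (simp only: card_norm_poly_divisors)
  also have "\<dots> = (\<Sum>P\<in>unit_polys m. \<Sum>k=1..m. \<Sum>b\<in>{b \<in> fixed_units k. norm_poly k b dvd P}. \<Phi> P)"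
    by (intro sum.cong refl, subst card_SigmaI)
       (auto simp: finite_fixed_units sum_distrib_right)
  also have "\<dots> = (\<Sum>P\<in>unit_polys m. \<Sum>k=1..m. \<Sum>b\<in>fixed_units k. if norm_poly k b dvd P then \<Phi> P else 0)"
    by (intro sum.cong[OF refl] sum.inter_filter finite_fixed_units) auto
  also have "\<dots> = (\<Sum>k=1..m. \<Sum>b\<in>fixed_units k. \<Sum>P\<in>unit_polys m. if norm_poly k b dvd P then \<Phi> P else 0)"
    by (subst sum.swap, intro sum.cong refl, subst sum.swap, rule refl)
  also have "\<dots> = (\<Sum>k=1..m. \<Sum>b\<in>fixed_units k. \<Sum>P | P \<in> unit_polys m \<and> norm_poly k b dvd P. \<Phi> P)"
    by (intro sum.cong[OF refl] sum.inter_filter[symmetric] finite_unit_polys)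
  also have "\<dots> = (\<Sum>k=1..m. \<Sum>b\<in>fixed_units k. \<Phi> (norm_poly k b) * (\<Sum>Q\<in>unit_polys (m - k). \<Phi> Q))"
    by (intro sum.cong refl inner)
  finally show ?thesis by (simp add: sum_distrib_right)
qed

end

section \<open>Power sums of reciprocal roots\<close>

text \<open>For \<open>P = \<Prod>\<^sub>i (1 - c\<^sub>i X)\<close> and \<open>d > 0\<close> this is \<open>\<Sum>\<^sub>i c\<^sub>i\<^sup>d\<close>, read off
  from the logarithmic derivative so that it makes sense over the field of coefficients.\<close>

definition power_sum :: "nat \<Rightarrow> 'a::field poly \<Rightarrow> 'a" where
  "power_sum d P = - fps_nth (fps_deriv (fps_of_poly P) * inverse (fps_of_poly P)) (d - 1)"

lemma power_sum_mult:
  assumes "poly P 0 = 1" "poly Q 0 = 1"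
  shows "power_sum d (P * Q) = power_sum d P + power_sum d Q"
proof -
  define F G where "F = fps_of_poly P" "G = fps_of_poly Q"
  have 0: "fps_nth F 0 \<noteq> 0" "fps_nth G 0 \<noteq> 0" using assms by (auto simp: F_G_def poly_0_coeff_0)
  have inv: "F * inverse F = 1" "G * inverse G = 1" using 0 by (simp_all add: inverse_mult_eq_1')
  have "fps_deriv (F * G) * inverse (F * G)
      = (F * inverse F) * (fps_deriv G * inverse G) + (G * inverse G) * (fps_deriv F * inverse F)"
    by (simp add: fps_inverse_mult algebra_simps)
  also have "\<dots> = fps_deriv F * inverse F + fps_deriv G * inverse G" by (simp add: inv)
  finally show ?thesis by (simp add: power_sum_def F_G_def fps_of_poly_mult)
qed

lemma power_sum_1: "power_sum d 1 = 0"
  by (simp add: power_sum_def)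

lemma power_sum_prod:
  assumes "\<And>i. i \<in> A \<Longrightarrow> poly (P i) 0 = 1"
  shows "power_sum d (\<Prod>i\<in>A. P i) = (\<Sum>i\<in>A. power_sum d (P i))"
  using assms
proof (induction A rule: infinite_finite_induct)
  case (insert x A)
  have "poly (\<Prod>i\<in>A. P i) 0 = 1" using insert by (simp add: poly_prod)
  thus ?case using insert by (simp add: power_sum_mult)
qed (auto simp: power_sum_1)

lemma power_sum_linear:
  assumes "d > 0"
  shows "power_sum d [:1, - c:] = c ^ d"
proof -
  define F where "F = fps_of_poly [:1, - c:]"
  have F: "F = 1 - fps_const c * fps_X"
    by (rule fps_ext) (auto simp: F_def coeff_pCons split: nat.splits)
  have "F * Abs_fps (\<lambda>i. c ^ i) = 1"
  proof (rule fps_ext)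
    fix i show "fps_nth (F * Abs_fps (\<lambda>i. c ^ i)) i = fps_nth 1 i"
      by (cases i) (simp_all add: F ring_distribs mult.assoc)
  qed
  hence "inverse F = Abs_fps (\<lambda>i. c ^ i)"
    using fps_inverse_unique by metis
  moreover have "fps_deriv F = fps_const (- c)" by (simp add: F)
  ultimately have "fps_nth (fps_deriv F * inverse F) (d - 1) = - c * c ^ (d - 1)" by simp
  also have "\<dots> = - (c ^ d)" using assms by (cases d) auto
  finally show ?thesis by (simp add: power_sum_def F_def)
qed

lemma power_sum_to_ac:
  assumes "poly P 0 = 1"
  shows "power_sum d (poly_to_ac P) = to_ac (power_sum d P)"
proof -
  define h where "h F = Abs_fps (\<lambda>i. to_ac (fps_nth F i))" for F :: "'a fps"
  define F where "F = fps_of_poly P"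
  have 0: "fps_nth F 0 = 1" using assms by (auto simp: F_def poly_0_coeff_0)
  have h_mult: "h (A * B) = h A * h B" for A B
    by (rule fps_ext) (simp add: h_def fps_mult_nth to_ac_sum)
  have h_deriv: "h (fps_deriv A) = fps_deriv (h A)" for A
    by (rule fps_ext) (simp add: h_def)
  have hF: "h F = fps_of_poly (poly_to_ac P)"
    by (rule fps_ext) (simp add: h_def F_def coeff_map_poly)
  have "h F * h (inverse F) = h 1"
    using 0 by (simp add: inverse_mult_eq_1' flip: h_mult)
  also have "h 1 = 1" by (rule fps_ext) (auto simp: h_def)
  finally have "h (inverse F) = inverse (h F)"
    using fps_inverse_unique by metis
  hence "fps_deriv (h F) * inverse (h F) = h (fps_deriv F * inverse F)"
    by (simp add: h_mult h_deriv)
  thus ?thesis by (simp add: power_sum_def hF[symmetric] F_def[symmetric] h_def)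
qed

text \<open>This is the top-degree case of Newton's identities: modulo \<open>X ^ d\<close>, adding
  \<open>f X ^ d\<close> changes the logarithmic derivative only by \<open>d f X ^ (d - 1)\<close>,
  because the inverse series starts with \<open>1\<close>.\<close>

lemma power_sum_add_monom:
  assumes "poly P 0 = 1" "d > 0"
  shows "power_sum d (P + monom f d) = power_sum d P - of_nat d * f"
proof -
  define F where "F = fps_of_poly P"
  define G where "G = F + fps_const f * fps_X ^ d"
  have G: "fps_of_poly (P + monom f d) = G"
    by (simp add: G_def F_def fps_of_poly_add fps_of_poly_monom)
  have F0: "fps_nth F 0 = 1" using assms by (auto simp: F_def poly_0_coeff_0)
  hence G0: "fps_nth G 0 = 1" using assms(2) by (simp add: G_def)
  have invF: "F * inverse F = 1" and invG: "G * inverse G = 1"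
    using F0 G0 by (simp_all add: inverse_mult_eq_1')
  \<comment> \<open>The resolvent identity isolates the effect of the perturbation:
    \<open>F - G\<close> is a multiple of \<open>X ^ d\<close>, so this correction is invisible in
    the coefficient of index \<open>d - 1\<close>.\<close>
  have iG: "inverse G = inverse F + (F - G) * inverse F * inverse G"
  proof -
    have "(F - G) * inverse F * inverse G = (F * inverse F) * inverse G - (G * inverse G) * inverse F"
      by (simp add: algebra_simps)
    thus ?thesis by (simp add: invF invG)
  qed
  have "fps_deriv G * inverse G = fps_deriv F * inverse G + (fps_deriv G - fps_deriv F) * inverse G"
    by (simp add: algebra_simps)
  also have "fps_deriv F * inverse G = fps_deriv F * (inverse F + (F - G) * inverse F * inverse G)"
    using arg_cong[OF iG, of "\<lambda>H. fps_deriv F * H"] .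
  also have "fps_deriv F * (inverse F + (F - G) * inverse F * inverse G)
      + (fps_deriv G - fps_deriv F) * inverse G = fps_deriv F * inverse F - fps_X ^ d * (fps_const f * fps_deriv F * inverse F * inverse G)
      + fps_X ^ (d - 1) * (fps_const (of_nat d * f) * inverse G)"
  proof -
    have FG: "F - G = - (fps_const f * fps_X ^ d)" by (simp add: G_def)
    have dFG: "fps_deriv G - fps_deriv F = fps_const (of_nat d * f) * fps_X ^ (d - 1)"
      by (simp add: G_def fps_deriv_power fps_of_nat mult_ac flip: fps_const_mult)
    show ?thesis unfolding FG dFG by (simp add: algebra_simps)
  qed
  finally have "fps_nth (fps_deriv G * inverse G) (d - 1)
      = fps_nth (fps_deriv F * inverse F) (d - 1) + of_nat d * f"
    using assms(2) G0 by (simp add: fps_X_power_mult_nth)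
  thus ?thesis by (simp add: power_sum_def G F_def)
qed

text \<open>Since \<open>L\<close> has no constant term, the equation expresses \<open>m\<close>
  times the \<open>m\<close>-th coefficient through earlier ones, and characteristic zero allows
  division by \<open>m\<close>.\<close>

lemma fps_log_derivative_unique:
  fixes A B L :: "'a::field_char_0 fps"
  assumes "fps_X * fps_deriv A = A * L" "fps_X * fps_deriv B = B * L"
    and "fps_nth A 0 = fps_nth B 0" "fps_nth L 0 = 0"
  shows "A = B"
proof (rule fps_ext)
  fix m show "fps_nth A m = fps_nth B m"
  proof (induction m rule: less_induct)
    case (less m)
    show ?case
    proof (cases m)
      case (Suc k)
      have rec: "of_nat m * fps_nth C m = (\<Sum>i\<le>k. fps_nth C i * fps_nth L (m - i))"
        if "fps_X * fps_deriv C = C * L" for C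
      proof -
        have "of_nat m * fps_nth C m = fps_nth (fps_X * fps_deriv C) m" by (simp add: Suc)
        also have "\<dots> = (\<Sum>i\<le>Suc k. fps_nth C i * fps_nth L (m - i))"
          by (simp add: that fps_mult_nth Suc atMost_atLeast0)
        also have "\<dots> = (\<Sum>i\<le>k. fps_nth C i * fps_nth L (m - i))"
          using assms(4) by (simp add: Suc)
        finally show ?thesis .
      qed
      have "of_nat m * fps_nth A m = (\<Sum>i\<le>k. fps_nth A i * fps_nth L (m - i))"
        by (rule rec[OF assms(1)])
      also have "\<dots> = (\<Sum>i\<le>k. fps_nth B i * fps_nth L (m - i))"
        by (intro sum.cong refl) (simp add: less Suc)
      also have "\<dots> = of_nat m * fps_nth B m"
        by (rule rec[OF assms(2), symmetric])
      finally show ?thesis by (simp add: Suc del: of_nat_Suc)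
    qed (use assms(3) in simp)
  qed
qed

lemma fps_log_derivative_prod:
  fixes A :: "'i \<Rightarrow> 'a::field_char_0 fps"
  assumes "\<And>i. i \<in> I \<Longrightarrow> fps_X * fps_deriv (A i) = A i * L i"
  shows "fps_X * fps_deriv (\<Prod>i\<in>I. A i) = (\<Prod>i\<in>I. A i) * (\<Sum>i\<in>I. L i)"
  using assms
proof (induction I rule: infinite_finite_induct)
  case (insert x I)
  let ?P = "\<Prod>i\<in>I. A i"
  have "fps_X * fps_deriv (A x * ?P) = A x * (fps_X * fps_deriv ?P) + (fps_X * fps_deriv (A x)) * ?P"
    by (simp add: algebra_simps)
  also have "\<dots> = A x * (?P * (\<Sum>i\<in>I. L i)) + (A x * L x) * ?P"
    using insert by simp
  also have "\<dots> = (A x * ?P) * (L x + (\<Sum>i\<in>I. L i))" by (simp add: algebra_simps)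
  finally show ?case using insert.hyps by simp
qed auto

text \<open>The derivative \<open>d X ^ (d - 1)\<close> vanishes only at \<open>0\<close>, which is
  not a root of \<open>X ^ d - y\<close>; hence all roots are simple and their number is the
  degree.\<close>

lemma card_roots_of_power_eq:
  fixes y :: "'a::alg_closed_field"
  assumes y: "y \<noteq> 0" and d: "of_nat d \<noteq> (0 :: 'a)"
  shows "card {x. x ^ d = y} = d"
proof -
  have d0: "d > 0" using d by (intro gr0I) auto
  define P where "P = monom (1 :: 'a) d - [:y:]"
  have "coeff P d = 1" using d0 by (simp add: P_def coeff_pCons split: nat.splits)
  hence P0: "P \<noteq> 0" by auto
  have "degree P \<le> d" unfolding P_def by (intro degree_diff_le) (auto simp: degree_monom_eq)
  hence deg: "degree P = d" using \<open>coeff P d = 1\<close> le_degree[of P d] by simp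
  have roots: "poly P x = 0 \<longleftrightarrow> x ^ d = y" for x by (simp add: P_def poly_monom)
  have "order x P = 1" if "poly P x = 0" for x
  proof (rule ccontr)
    assume "order x P \<noteq> 1"
    moreover have "order x P \<noteq> 0" using that P0 by (simp add: order_root)
    ultimately have "[:-x, 1:] ^ 2 dvd P" by (simp add: order_divides)
    then obtain Q where Q: "P = [:-x, 1:] ^ 2 * Q" by blast
    define R where "R = [:-x, 1:] * Q"
    have "P = [:-x, 1:] * R" unfolding Q R_def power2_eq_square mult.assoc ..
    moreover have "poly R x = 0" by (simp add: R_def)
    ultimately have "poly (pderiv P) x = 0" by (simp only: pderiv_mult) simp
    moreover have "poly (pderiv P) x = of_nat d * x ^ (d - 1)"
      by (simp add: P_def pderiv_diff pderiv_monom poly_monom pderiv_pCons)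
    ultimately have "x = 0" using d by simp
    thus False using that roots[of x] y d0 by (simp add: power_0_left)
  qed
  hence "(\<Sum>x | poly P x = 0. order x P) = card {x. poly P x = 0}" by simp
  thus ?thesis using sum_order_eq_degree[OF P0] deg by (simp add: roots)
qed

section \<open>The Hasse--Davenport product formula\<close>

locale gauss_field = additive_character \<theta> + finite_field_card p n "TYPE('a)"
  for \<theta> :: "'a::{field,finite} \<Rightarrow> complex" and p n :: nat
begin

text \<open>The norm from the field with \<open>q ^ k\<close> elements down to \<open>F_q\<close>,
  as a total function on the closure; it has this meaning on \<open>fixed_units k\<close>, where the
  product lies in the range of \<open>to_ac\<close>.\<close>

definition field_norm :: "nat \<Rightarrow> 'a alg_closure \<Rightarrow> 'a" where
  "field_norm k b = of_ac (\<Prod>j<k. b ^ (CARD('a) ^ j))"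

definition field_trace :: "nat \<Rightarrow> 'a alg_closure \<Rightarrow> 'a" where
  "field_trace k b = of_ac (\<Sum>j<k. b ^ (CARD('a) ^ j))"

lemma lead_coeff_norm_poly:
  assumes "b \<in> fixed_units k"
  shows "(-1) ^ k * lead_coeff (norm_poly k b) = field_norm k b"
    and "to_ac (field_norm k b) = (\<Prod>j<k. b ^ (CARD('a) ^ j))"
proof -
  have b: "b \<noteq> 0" "b ^ (CARD('a) ^ k) = b" using assms by (auto simp: fixed_units_def)
  have "to_ac (lead_coeff (norm_poly k b)) = lead_coeff (conj_poly k b)"
    by (simp add: coeff_map_poly flip: poly_to_ac_norm_poly[OF b(2)])
  also have "\<dots> = (\<Prod>j<k. - (b ^ (CARD('a) ^ j)))"
    unfolding conj_poly_def lead_coeff_prod using b(1) by simp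
  also have "\<dots> = (-1) ^ k * (\<Prod>j<k. b ^ (CARD('a) ^ j))"
    by (induction k) simp_all
  finally have *: "to_ac ((-1) ^ k * lead_coeff (norm_poly k b)) = (\<Prod>j<k. b ^ (CARD('a) ^ j))"
    by (simp flip: mult.assoc power_mult_distrib)
  thus eq: "(-1) ^ k * lead_coeff (norm_poly k b) = field_norm k b"
    unfolding field_norm_def by (metis of_ac_to_ac)
  show "to_ac (field_norm k b) = (\<Prod>j<k. b ^ (CARD('a) ^ j))"
    using * unfolding eq .
qed

lemma coeff_1_prod_linear: "coeff (\<Prod>j<k. [:1, - c j:]) 1 = - (\<Sum>j<k. c j)"
  for c :: "nat \<Rightarrow> 'b::comm_ring_1"
proof (induction k)
  case (Suc k)
  have "coeff (\<Prod>j<k. [:1, - c j:]) 0 = 1"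
    by (simp flip: poly_0_coeff_0 add: poly_prod)
  thus ?case using Suc by (simp add: mult_pCons_right coeff_pCons)
qed simp

lemma coeff_1_norm_poly:
  assumes "b \<in> fixed_units k"
  shows "- coeff (norm_poly k b) 1 = field_trace k b"
    and "to_ac (field_trace k b) = (\<Sum>j<k. b ^ (CARD('a) ^ j))"
proof -
  have b: "b \<noteq> 0" "b ^ (CARD('a) ^ k) = b" using assms by (auto simp: fixed_units_def)
  have "to_ac (- coeff (norm_poly k b) 1) = - coeff (conj_poly k b) 1"
    by (simp add: coeff_map_poly flip: poly_to_ac_norm_poly[OF b(2)])
  also have "\<dots> = (\<Sum>j<k. b ^ (CARD('a) ^ j))"
    unfolding conj_poly_def coeff_1_prod_linear by simp
  finally have *: "to_ac (- coeff (norm_poly k b) 1) = (\<Sum>j<k. b ^ (CARD('a) ^ j))" .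
  thus eq: "- coeff (norm_poly k b) 1 = field_trace k b"
    unfolding field_trace_def by (metis of_ac_to_ac)
  show "to_ac (field_trace k b) = (\<Sum>j<k. b ^ (CARD('a) ^ j))"
    using * unfolding eq .
qed

lemma power_fixed_units: "b \<in> fixed_units k \<Longrightarrow> b ^ d \<in> fixed_units k"
  using power_mult[of b d "CARD('a) ^ k"] power_mult[of b "CARD('a) ^ k" d]
  by (auto simp: fixed_units_def mult.commute)

lemma power_sum_norm_poly:
  assumes "b \<in> fixed_units k" "d > 0"
  shows "power_sum d (norm_poly k b) = field_trace k (b ^ d)"
proof -
  have b: "b \<noteq> 0" "b ^ (CARD('a) ^ k) = b" using assms by (auto simp: fixed_units_def)
  have "to_ac (power_sum d (norm_poly k b)) = power_sum d (conj_poly k b)"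
    using norm_poly_unit_polys[OF assms(1)]
    by (simp add: unit_polys_def flip: power_sum_to_ac poly_to_ac_norm_poly[OF b(2)])
  also have "\<dots> = (\<Sum>j<k. (b ^ (CARD('a) ^ j)) ^ d)"
    unfolding conj_poly_def using assms(2) by (subst power_sum_prod) (auto simp: power_sum_linear)
  also have "\<dots> = (\<Sum>j<k. (b ^ d) ^ (CARD('a) ^ j))"
    by (simp add: mult.commute flip: power_mult)
  also have "\<dots> = to_ac (field_trace k (b ^ d))"
    using coeff_1_norm_poly(2)[OF power_fixed_units[OF assms(1)]] by simp
  finally show ?thesis by simp
qed

lemma field_norm_power:
  assumes "b \<in> fixed_units k"
  shows "field_norm k (b ^ d) = field_norm k b ^ d"
proof -
  have "to_ac (field_norm k (b ^ d)) = (\<Prod>j<k. (b ^ (CARD('a) ^ j)) ^ d)"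
    unfolding lead_coeff_norm_poly(2)[OF power_fixed_units[OF assms]]
    by (simp add: mult.commute flip: power_mult)
  also have "\<dots> = to_ac (field_norm k b ^ d)"
    by (simp add: lead_coeff_norm_poly(2)[OF assms] prod_power_distrib)
  finally show ?thesis unfolding to_ac_eq_iff .
qed

lemma field_norm_nonzero: "b \<in> fixed_units k \<Longrightarrow> field_norm k b \<noteq> 0"
  using lead_coeff_norm_poly(2)[of b k] by (auto simp: fixed_units_def)

text \<open>For \<open>P\<close> a product of factors \<open>1 - b X\<close> with nonzero
  \<open>b\<close>, the signed leading coefficient is the product of the \<open>b\<close>, and minus
  the linear coefficient is their sum.\<close>

definition gauss_weight :: "('a \<Rightarrow> complex) \<Rightarrow> 'a poly \<Rightarrow> complex" where
  "gauss_weight \<chi> P = \<chi> ((-1) ^ degree P * lead_coeff P) * \<theta> (- coeff P 1)"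

text \<open>The analogue of \<open>gauss_weight\<close> with every reciprocal root replaced by its
  \<open>d\<close>-th power, still written through the coefficients of \<open>P\<close>
  itself.\<close>

definition power_weight :: "nat \<Rightarrow> ('a \<Rightarrow> complex) \<Rightarrow> 'a poly \<Rightarrow> complex" where
  "power_weight d \<chi> P = \<chi> ((-1) ^ degree P * lead_coeff P) ^ d * \<theta> (power_sum d P)"

lemma signed_lead_coeff_mult:
  assumes "poly P 0 = 1" "poly Q 0 = (1::'a)"
  shows "(-1) ^ degree (P * Q) * lead_coeff (P * Q)
       = ((-1) ^ degree P * lead_coeff P) * ((-1) ^ degree Q * lead_coeff Q)"
proof -
  have "P \<noteq> 0" "Q \<noteq> 0" using assms by auto
  hence deg: "degree (P * Q) = degree P + degree Q" by (rule degree_mult_eq)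
  show ?thesis unfolding lead_coeff_mult unfolding deg by (simp only: power_add mult_ac)
qed

lemma gauss_weight_mult:
  assumes "is_mchar \<chi>" "poly P 0 = 1" "poly Q 0 = 1"
  shows "gauss_weight \<chi> (P * Q) = gauss_weight \<chi> P * gauss_weight \<chi> Q"
proof -
  have "coeff (P * Q) 1 = coeff P 1 + coeff Q 1"
    using assms(2,3) by (simp add: coeff_mult poly_0_coeff_0)
  hence "\<theta> (- coeff (P * Q) 1) = \<theta> (- coeff P 1) * \<theta> (- coeff Q 1)"
    by (simp add: theta_add[symmetric])
  thus ?thesis unfolding gauss_weight_def signed_lead_coeff_mult[OF assms(2,3)]
    by (simp only: mchar_mult[OF assms(1)] mult_ac)
qed

lemma power_weight_mult:
  assumes "is_mchar \<chi>" "poly P 0 = 1" "poly Q 0 = 1"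
  shows "power_weight d \<chi> (P * Q) = power_weight d \<chi> P * power_weight d \<chi> Q"
  unfolding power_weight_def signed_lead_coeff_mult[OF assms(2,3)] power_sum_mult[OF assms(2,3)]
  by (simp only: mchar_mult[OF assms(1)] theta_add power_mult_distrib mult_ac)

lemma gauss_weight_norm_poly:
  assumes "b \<in> fixed_units k"
  shows "gauss_weight \<chi> (norm_poly k b) = \<chi> (field_norm k b) * \<theta> (field_trace k b)"
  using norm_poly_unit_polys[OF assms] lead_coeff_norm_poly(1)[OF assms] coeff_1_norm_poly(1)[OF assms]
  by (simp add: gauss_weight_def unit_polys_def)

lemma power_weight_norm_poly:
  assumes "is_mchar \<chi>" "b \<in> fixed_units k" "d > 0"
  shows "power_weight d \<chi> (norm_poly k b) = \<chi> (field_norm k (b ^ d)) * \<theta> (field_trace k (b ^ d))"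
  using norm_poly_unit_polys[OF assms(2)] lead_coeff_norm_poly(1)[OF assms(2)]
    power_sum_norm_poly[OF assms(2,3)]
  by (simp add: power_weight_def unit_polys_def field_norm_power[OF assms(2)] mchar_power[OF assms(1)])

section \<open>The L-series of the two weights\<close>

definition L_series :: "('a poly \<Rightarrow> complex) \<Rightarrow> complex fps" where
  "L_series \<Phi> = Abs_fps (\<lambda>m. \<Sum>P\<in>unit_polys m. \<Phi> P)"

definition L_log_deriv :: "('a poly \<Rightarrow> complex) \<Rightarrow> complex fps" where
  "L_log_deriv \<Phi> = Abs_fps (\<lambda>k. if k = 0 then 0 else \<Sum>b\<in>fixed_units k. \<Phi> (norm_poly k b))"

lemma L_series_log_deriv:
  assumes "\<And>P Q. poly P 0 = 1 \<Longrightarrow> poly Q 0 = 1 \<Longrightarrow> \<Phi> (P * Q) = \<Phi> P * \<Phi> Q"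
  shows "fps_X * fps_deriv (L_series \<Phi>) = L_series \<Phi> * L_log_deriv \<Phi>"
proof (rule fps_ext)
  fix m
  have "fps_nth (fps_X * fps_deriv (L_series \<Phi>)) m = of_nat m * fps_nth (L_series \<Phi>) m"
    by (cases m) auto
  also have "\<dots> = (\<Sum>k=1..m. fps_nth (L_log_deriv \<Phi>) k * fps_nth (L_series \<Phi>) (m - k))"
    using log_derivative_L_series[of \<Phi> m] assms by (simp add: L_series_def L_log_deriv_def)
  also have "\<dots> = (\<Sum>k=0..m. fps_nth (L_log_deriv \<Phi>) k * fps_nth (L_series \<Phi>) (m - k))"
    by (simp add: sum.atLeast_Suc_atMost[of 0 m] L_log_deriv_def)
  also have "\<dots> = fps_nth (L_log_deriv \<Phi> * L_series \<Phi>) m" by (simp add: fps_mult_nth)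
  finally show "fps_nth (fps_X * fps_deriv (L_series \<Phi>)) m = fps_nth (L_series \<Phi> * L_log_deriv \<Phi>) m"
    by (simp add: mult.commute)
qed

lemma unit_polys_0: "unit_polys 0 = {1}"
proof -
  have "P = 1" if "poly P 0 = 1" "degree P = 0" for P :: "'a poly"
    using that by (auto elim!: degree_eq_zeroE simp: one_pCons)
  thus ?thesis by (auto simp: unit_polys_def)
qed

text \<open>In degree \<open>1\<close> the polynomials \<open>1 - x X\<close> reproduce the Gauss
  sum. From degree \<open>2\<close> on, the linear coefficient is independent of degree and leading
  coefficient, so translating it by a value on which \<theta> is nontrivial multiplies the sum by a
  factor other than \<open>1\<close> and forces it to vanish.\<close>

lemma L_series_gauss_weight:
  assumes \<chi>: "is_mchar \<chi>"
  shows "L_series (gauss_weight \<chi>) = 1 + fps_const (gauss \<chi>) * fps_X"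
proof (rule fps_ext)
  fix m :: nat
  consider "m = 0" | "m = 1" | "m \<ge> 2" by linarith
  thus "fps_nth (L_series (gauss_weight \<chi>)) m = fps_nth (1 + fps_const (gauss \<chi>) * fps_X) m"
  proof cases
    case 1
    thus ?thesis by (simp add: L_series_def unit_polys_0 gauss_weight_def mchar_1[OF \<chi>] theta_0)
  next
    case 2
    have "unit_polys 1 = (\<lambda>x. [:1, - x:]) ` (UNIV - {0})"
    proof (intro equalityI subsetI)
      fix P assume P: "P \<in> unit_polys 1"
      hence "degree P = 1" by (simp add: unit_polys_def)
      then obtain b a where ab: "P = [:a, b:]" "b \<noteq> 0" by (rule degree1_coeffs)
      moreover have "a = 1" using P ab by (simp add: unit_polys_def)
      ultimately show "P \<in> (\<lambda>x. [:1, - x:]) ` (UNIV - {0})"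
        by (intro image_eqI[of _ _ "- b"]) auto
    qed (auto simp: unit_polys_def)
    moreover have "inj_on (\<lambda>x::'a. [:1, - x:]) (UNIV - {0})" by (auto simp: inj_on_def)
    ultimately have "(\<Sum>P\<in>unit_polys 1. gauss_weight \<chi> P) = (\<Sum>x\<in>UNIV - {0}. \<chi> x * \<theta> x)"
      by (simp add: sum.reindex gauss_weight_def)
    also have "\<dots> = gauss \<chi>"
      unfolding gauss_def by (rule sum.mono_neutral_left) (auto simp: mchar_0[OF \<chi>])
    finally show ?thesis using 2 by (simp add: L_series_def)
  next
    case 3
    obtain a where a: "\<theta> a \<noteq> 1" using theta_nontrivial by blast
    have deg: "degree (P + monom c 1) = m" and lc: "coeff (P + monom c 1) m = coeff P m"
      if "degree P = m" for P and c :: 'a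
      using that 3 degree_monom_le[of c 1] degree_add_eq_left[of "monom c 1" P] by auto
    have bij: "P + monom c 1 \<in> unit_polys m" if "P \<in> unit_polys m" for P c
      using that deg by (simp add: unit_polys_def poly_monom)
    have cancel: "monom a 1 + monom (- a) 1 = 0" "monom (- a) 1 + monom a 1 = 0"
      by (simp_all add: add_monom)
    have "(\<Sum>P\<in>unit_polys m. gauss_weight \<chi> P) = (\<Sum>P\<in>unit_polys m. gauss_weight \<chi> (P + monom (- a) 1))"
      by (rule sum.reindex_bij_witness[of _ "\<lambda>P. P + monom (- a) 1" "\<lambda>P. P + monom a 1"])
         (use bij cancel in \<open>auto simp: add.assoc\<close>)
    also have "\<dots> = (\<Sum>P\<in>unit_polys m. \<theta> a * gauss_weight \<chi> P)"
    proof (rule sum.cong[OF refl])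
      fix P assume "P \<in> unit_polys m"
      hence "degree P = m" by (simp add: unit_polys_def)
      thus "gauss_weight \<chi> (P + monom (- a) 1) = \<theta> a * gauss_weight \<chi> P"
        using deg[of P "-a"] lc[of P "-a"] theta_add[of a "- coeff P 1"]
        by (simp add: gauss_weight_def mult_ac)
    qed
    finally have "(\<Sum>P\<in>unit_polys m. gauss_weight \<chi> P) = 0"
      using a by (simp flip: sum_distrib_left)
    thus ?thesis using 3 by (simp add: L_series_def)
  qed
qed

text \<open>Otherwise both \<open>q\<close> and \<open>q - 1\<close> would be zero in the
  field.\<close>

lemma of_nat_dvd_card_minus_one:
  assumes "d dvd CARD('a) - 1"
  shows "of_nat d \<noteq> (0 :: 'a)"
proof
  assume "of_nat d = (0 :: 'a)"
  obtain t where t: "CARD('a) - 1 = d * t" using assms by blast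
  hence "of_nat (CARD('a) - 1) = (0 :: 'a)" using \<open>of_nat d = 0\<close> by simp
  moreover have "of_nat CARD('a) = (0 :: 'a)"
    using CHAR_dvd_CARD[where 'a='a] by (simp add: of_nat_eq_0_iff_char_dvd)
  moreover have "CARD('a) = Suc (CARD('a) - 1)" using card_field_ge_2[where 'a='a] by simp
  hence "of_nat CARD('a) = of_nat (CARD('a) - 1) + (1 :: 'a)" by (metis of_nat_Suc add.commute)
  ultimately show False by simp
qed

text \<open>With \<open>E = (q ^ k - 1) / (q - 1)\<close> the norm of \<open>y\<close> is
  \<open>y ^ E\<close>, and the right side is a geometric sum in the root of unity \<open>z\<close>:
  it is \<open>d\<close> for \<open>z = 1\<close> and \<open>0\<close> otherwise. By faithfulness
  \<open>z = 1\<close> means \<open>y ^ (E * t) = 1\<close>, the criterion for \<open>y\<close> to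
  be a \<open>d\<close>-th power in the extension.\<close>

lemma card_power_fibre:
  assumes T: "char_generator T" and dt: "d * t = CARD('a) - 1" and y: "y \<in> fixed_units k"
  shows "of_nat (card {b \<in> fixed_units k. b ^ d = y}) = (\<Sum>i<d. char_pow T (i * t) (field_norm k y))"
proof -
  have mT: "is_mchar T" by (rule is_mchar_generator[OF T])
  have q2: "CARD('a) \<ge> 2" by (rule card_field_ge_2)
  define E where "E = (\<Sum>j<k. CARD('a) ^ j)"
  have geom: "(\<Sum>j<k. Suc u ^ j) * u + 1 = Suc u ^ k" for u :: nat
    by (induction k) (simp_all add: algebra_simps)
  have E: "E * (CARD('a) - 1) + 1 = CARD('a) ^ k"
    using geom[of "CARD('a) - 1"] q2 by (simp add: E_def)
  define N where "N = field_norm k y"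
  have N0: "N \<noteq> 0" using field_norm_nonzero[OF y] by (simp add: N_def)
  have NE: "to_ac N = y ^ E"
    unfolding N_def lead_coeff_norm_poly(2)[OF y] E_def by (simp add: power_sum)
  define z where "z = T N ^ t"
  have zd: "z ^ d = 1"
    using mchar_power_card[OF mT N0] by (simp add: z_def mult.commute dt flip: power_mult)
  have sum: "(\<Sum>i<d. char_pow T (i * t) N) = (\<Sum>i<d. z ^ i)"
    using N0 by (simp add: char_pow_def z_def mult.commute flip: power_mult)
  show ?thesis
  proof (cases "z = 1")
    case True
    have "T (N ^ t) = 1" using True by (simp add: z_def mchar_power[OF mT])
    hence "N ^ t = 1" using char_generator_faithful[OF T, of "N ^ t"] N0 by simp
    hence yE: "y ^ (E * t) = 1" by (metis NE power_mult to_ac_1 to_ac_power)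
    \<comment> \<open>Every root of \<open>X ^ d - y\<close> in the closure already lies in the
      extension, because \<open>b ^ (q ^ k - 1) = y ^ (E * t)\<close>; so all \<open>d\<close> of
      them are counted.\<close>
    have "b \<in> fixed_units k" if b: "b ^ d = y" for b
    proof -
      have "b ^ (E * (CARD('a) - 1)) = (b ^ d) ^ (E * t)"
        by (simp only: dt[symmetric] power_mult[symmetric] mult_ac)
      also have "\<dots> = 1" using b yE by simp
      finally have "b ^ (E * (CARD('a) - 1) + 1) = b" by simp
      moreover have "b \<noteq> 0"
      proof
        assume "b = 0"
        moreover have "d > 0" using dt q2 by (intro gr0I) auto
        ultimately show False using b y by (simp add: power_0_left fixed_units_def)
      qed
      ultimately show ?thesis unfolding E by (simp add: fixed_units_def)
    qed
    hence "{b \<in> fixed_units k. b ^ d = y} = {b. b ^ d = y}" by blast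
    moreover have "of_nat d \<noteq> (0 :: 'a alg_closure)"
      using of_nat_dvd_card_minus_one[of d] dt by (metis dvd_triv_left to_ac_eq_0_iff to_ac_of_nat)
    hence "card {b. b ^ d = y} = d"
      using y by (intro card_roots_of_power_eq) (auto simp: fixed_units_def)
    ultimately show ?thesis using True sum by (simp add: N_def)
  next
    case False
    have "b ^ d \<noteq> y" if b: "b \<in> fixed_units k" for b
    proof
      assume "b ^ d = y"
      hence "N = field_norm k b ^ d" using field_norm_power[OF b, of d] by (simp add: N_def)
      hence "z = T (field_norm k b) ^ (CARD('a) - 1)"
        by (simp only: z_def mchar_power[OF mT] dt[symmetric] power_mult[symmetric])
      also have "\<dots> = 1" by (rule mchar_power_card[OF mT field_norm_nonzero[OF b]])
      finally show False using False by simp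
    qed
    hence empty: "{b \<in> fixed_units k. b ^ d = y} = {}" by blast
    show ?thesis unfolding empty using sum_powers_root_of_unity[OF zd False] sum by (simp add: N_def)
  qed
qed

text \<open>On \<open>norm_poly k b\<close> the weight depends only on the norm and trace of
  \<open>b ^ d\<close>, so sorting the \<open>b\<close> by \<open>y = b ^ d\<close> brings in
  exactly the fibre sizes of \<open>card_power_fibre\<close>.\<close>

lemma L_log_deriv_power_weight:
  assumes T: "char_generator T" and dt: "d * t = CARD('a) - 1" and \<chi>: "is_mchar \<chi>"
  shows "L_log_deriv (power_weight d \<chi>)
       = (\<Sum>i<d. L_log_deriv (gauss_weight (char_mult \<chi> (char_pow T (i * t)))))"
proof (rule fps_ext)
  fix k
  have d0: "d > 0" using dt card_field_ge_2[where 'a='a] by (intro gr0I) auto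
  show "fps_nth (L_log_deriv (power_weight d \<chi>)) k
      = fps_nth (\<Sum>i<d. L_log_deriv (gauss_weight (char_mult \<chi> (char_pow T (i * t))))) k"
  proof (cases "k = 0")
    case False
    let ?K = "fixed_units k"
    define h where "h y = \<chi> (field_norm k y) * \<theta> (field_trace k y)" for y
    have fin: "finite ?K" using False by (simp add: finite_fixed_units)
    have "(\<Sum>b\<in>?K. power_weight d \<chi> (norm_poly k b)) = (\<Sum>b\<in>?K. h (b ^ d))"
      using d0 by (intro sum.cong refl) (simp add: power_weight_norm_poly[OF \<chi>] h_def)
    also have "\<dots> = (\<Sum>y\<in>?K. \<Sum>b\<in>{b \<in> ?K. b ^ d = y}. h (b ^ d))"
      by (rule sum.group[symmetric]) (auto simp: fin power_fixed_units)
    also have "\<dots> = (\<Sum>y\<in>?K. of_nat (card {b \<in> ?K. b ^ d = y}) * h y)"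
      by (intro sum.cong refl) simp
    also have "\<dots> = (\<Sum>y\<in>?K. \<Sum>i<d. gauss_weight (char_mult \<chi> (char_pow T (i * t))) (norm_poly k y))"
      by (intro sum.cong refl)
         (simp add: card_power_fibre[OF T dt] gauss_weight_norm_poly h_def char_mult_def
           sum_distrib_left sum_distrib_right mult_ac)
    also have "\<dots> = (\<Sum>i<d. \<Sum>y\<in>?K. gauss_weight (char_mult \<chi> (char_pow T (i * t))) (norm_poly k y))"
      by (rule sum.swap)
    finally show ?thesis using False by (simp add: L_log_deriv_def fps_sum_nth)
  qed (simp add: L_log_deriv_def fps_sum_nth)
qed

lemma L_series_power_weight:
  assumes T: "char_generator T" and dt: "d * t = CARD('a) - 1" and \<chi>: "is_mchar \<chi>"
  shows "L_series (power_weight d \<chi>)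
       = (\<Prod>i<d. 1 + fps_const (gauss (char_mult \<chi> (char_pow T (i * t)))) * fps_X)"
proof -
  have mi: "is_mchar (char_mult \<chi> (char_pow T (i * t)))" for i
    using \<chi> T by (auto simp: char_generator_def)
  have "L_series (power_weight d \<chi>) = (\<Prod>i<d. L_series (gauss_weight (char_mult \<chi> (char_pow T (i * t)))))"
  proof (rule fps_log_derivative_unique)
    show "fps_X * fps_deriv (L_series (power_weight d \<chi>))
        = L_series (power_weight d \<chi>) * L_log_deriv (power_weight d \<chi>)"
      by (intro L_series_log_deriv power_weight_mult[OF \<chi>])
    show "fps_X * fps_deriv (\<Prod>i<d. L_series (gauss_weight (char_mult \<chi> (char_pow T (i * t)))))
        = (\<Prod>i<d. L_series (gauss_weight (char_mult \<chi> (char_pow T (i * t))))) * L_log_deriv (power_weight d \<chi>)"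
      unfolding L_log_deriv_power_weight[OF T dt \<chi>]
      by (intro fps_log_derivative_prod L_series_log_deriv gauss_weight_mult[OF mi])
    have nth_0: "fps_nth (\<Prod>i<m. F i) 0 = (\<Prod>i<m. fps_nth (F i) 0)" for F :: "nat \<Rightarrow> complex fps" and m
      by (induction m) simp_all
    have "fps_nth (L_series (power_weight d \<chi>)) 0 = 1"
      by (simp add: L_series_def unit_polys_0 power_weight_def power_sum_1 theta_0 mchar_1[OF \<chi>])
    thus "fps_nth (L_series (power_weight d \<chi>)) 0
        = fps_nth (\<Prod>i<d. L_series (gauss_weight (char_mult \<chi> (char_pow T (i * t))))) 0"
      by (simp add: L_series_gauss_weight[OF mi] nth_0)
    show "fps_nth (L_log_deriv (power_weight d \<chi>)) 0 = 0" by (simp add: L_log_deriv_def)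
  qed
  thus ?thesis by (simp only: L_series_gauss_weight[OF mi])
qed

section \<open>The coefficient of \<open>X ^ d\<close> and the product formula\<close>

lemma fps_nth_prod_linear:
  fixes c :: "nat \<Rightarrow> 'b::comm_ring_1"
  shows "fps_nth (\<Prod>i<d. 1 + fps_const (c i) * fps_X) d = (\<Prod>i<d. c i)"
proof -
  have step: "fps_nth (A * (1 + fps_const x * fps_X)) (Suc m) = fps_nth A (Suc m) + fps_nth A m * x"
    for A :: "'b fps" and x m
    by (simp add: ring_distribs flip: mult.assoc)
  \<comment> \<open>The vanishing above index \<open>d\<close> is carried along because the
    induction step needs the coefficient of index \<open>d + 1\<close> of the shorter product to be
    zero.\<close>
  have "fps_nth (\<Prod>i<d. 1 + fps_const (c i) * fps_X) d = (\<Prod>i<d. c i) \<and>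
      (\<forall>m>d. fps_nth (\<Prod>i<d. 1 + fps_const (c i) * fps_X) m = 0)"
  proof (induction d)
    case (Suc d)
    show ?case
    proof (intro conjI allI impI)
      show "fps_nth (\<Prod>i<Suc d. 1 + fps_const (c i) * fps_X) (Suc d) = (\<Prod>i<Suc d. c i)"
        unfolding prod.lessThan_Suc step using Suc by simp
      fix m assume "m > Suc d"
      then obtain k where "m = Suc k" "k > d" by (cases m) auto
      thus "fps_nth (\<Prod>i<Suc d. 1 + fps_const (c i) * fps_X) m = 0"
        unfolding prod.lessThan_Suc \<open>m = Suc k\<close> step using Suc by simp
    qed
  qed simp
  thus ?thesis by blast
qed

definition short_unit_polys :: "nat \<Rightarrow> 'a poly set" where
  "short_unit_polys d = {P. poly P 0 = 1 \<and> degree P < d}"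

lemma unit_polys_eq_image:
  assumes "d > 0"
  shows "unit_polys d = (\<lambda>(P, f). P + monom f d) ` (short_unit_polys d \<times> (UNIV - {0}))"
    and "inj_on (\<lambda>(P, f). P + monom f d) (short_unit_polys d \<times> (UNIV - {0}))"
proof -
  show "unit_polys d = (\<lambda>(P, f). P + monom f d) ` (short_unit_polys d \<times> (UNIV - {0}))"
  proof (intro equalityI subsetI)
    fix P assume P: "P \<in> unit_polys d"
    define A where "A = P - monom (coeff P d) d"
    have "degree A \<le> d" unfolding A_def using P degree_monom_le[of "coeff P d" d]
      by (intro degree_diff_le) (auto simp: unit_polys_def)
    moreover have "coeff A d = 0" by (simp add: A_def)
    ultimately have "degree A < d"
      using assms by (metis degree_0 leading_coeff_0_iff le_neq_implies_less)
    moreover have "poly A 0 = 1" using P assms by (simp add: A_def unit_polys_def poly_monom power_0_left)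
    moreover have "coeff P d \<noteq> 0"
      using P assms leading_coeff_0_iff[of P] by (auto simp: unit_polys_def)
    ultimately show "P \<in> (\<lambda>(P, f). P + monom f d) ` (short_unit_polys d \<times> (UNIV - {0}))"
      by (intro image_eqI[of _ _ "(A, coeff P d)"]) (auto simp: A_def short_unit_polys_def)
  next
    fix P assume "P \<in> (\<lambda>(P, f). P + monom f d) ` (short_unit_polys d \<times> (UNIV - {0}))"
    then obtain A f where "P = A + monom f d" "poly A 0 = 1" "degree A < d" "f \<noteq> 0"
      by (auto simp: short_unit_polys_def)
    thus "P \<in> unit_polys d"
      using assms degree_add_eq_right[of A "monom f d"]
      by (auto simp: unit_polys_def poly_monom power_0_left degree_monom_eq)
  qed
  show "inj_on (\<lambda>(P, f). P + monom f d) (short_unit_polys d \<times> (UNIV - {0}))"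
  proof (rule inj_onI)
    fix x y
    assume "x \<in> short_unit_polys d \<times> (UNIV - {0})" "y \<in> short_unit_polys d \<times> (UNIV - {0})"
      and "(\<lambda>(P, f). P + monom f d) x = (\<lambda>(P, f). P + monom f d) y"
    then obtain A f B g where *: "x = (A, f)" "y = (B, g)" "A \<in> short_unit_polys d"
      "B \<in> short_unit_polys d" "A + monom f d = B + monom g d" by auto
    hence "coeff (A + monom f d) d = coeff (B + monom g d) d" by simp
    hence "f = g" using *(3,4) by (auto simp: short_unit_polys_def coeff_eq_0)
    thus "x = y" using * by simp
  qed
qed

text \<open>Splitting off the leading coefficient \<open>f\<close> separates the variables:
  \<open>f\<close> enters the power sum only through \<open>- d * f\<close>, so its sum is a twisted
  Gauss sum of the \<open>d\<close>-th power of \<chi>. The remaining factor no longer depends on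
  \<chi>.\<close>

lemma sum_power_weight:
  assumes dt: "d * t = CARD('a) - 1" and \<chi>: "is_mchar \<chi>"
  shows "(\<Sum>P\<in>unit_polys d. power_weight d \<chi> P)
       = (\<Sum>A\<in>short_unit_polys d. \<theta> (power_sum d A)) * (cnj (\<chi> (of_nat d)) ^ d * gauss (char_pow \<chi> d))"
proof -
  have d0: "d > 0" using dt card_field_ge_2[where 'a='a] by (intro gr0I) auto
  have nd: "of_nat d \<noteq> (0::'a)" using of_nat_dvd_card_minus_one[of d] dt by (metis dvd_triv_left)
  have m\<chi>: "is_mchar (char_pow \<chi> d)" using \<chi> by auto
  define H where "H f = \<chi> ((-1) ^ d * f) ^ d * \<theta> (- of_nat d * f)" for f
  have "(\<Sum>P\<in>unit_polys d. power_weight d \<chi> P)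
      = (\<Sum>(A, f)\<in>short_unit_polys d \<times> (UNIV - {0}). power_weight d \<chi> (A + monom f d))"
    unfolding unit_polys_eq_image(1)[OF d0]
    by (subst sum.reindex[OF unit_polys_eq_image(2)[OF d0]]) (simp add: case_prod_unfold)
  also have "\<dots> = (\<Sum>(A, f)\<in>short_unit_polys d \<times> (UNIV - {0}). \<theta> (power_sum d A) * H f)"
  proof (rule sum.cong[OF refl])
    fix x assume "x \<in> short_unit_polys d \<times> (UNIV - {0 :: 'a})"
    then obtain A f where x: "x = (A, f)" and A: "A \<in> short_unit_polys d" and f: "f \<noteq> 0" by auto
    have deg: "degree (A + monom f d) = d"
      using A f degree_add_eq_right[of A "monom f d"]
      by (simp add: short_unit_polys_def degree_monom_eq)
    have lc: "coeff (A + monom f d) d = f"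
      using A by (simp add: short_unit_polys_def coeff_eq_0)
    have "power_sum d (A + monom f d) = power_sum d A + - of_nat d * f"
      using A d0 by (simp add: short_unit_polys_def power_sum_add_monom)
    hence "power_weight d \<chi> (A + monom f d) = \<theta> (power_sum d A) * H f"
      unfolding power_weight_def deg lc H_def by (simp only: theta_add mult_ac)
    thus "(case x of (A, f) \<Rightarrow> power_weight d \<chi> (A + monom f d)) = (case x of (A, f) \<Rightarrow> \<theta> (power_sum d A) * H f)"
      by (simp add: x)
  qed
  also have "\<dots> = (\<Sum>A\<in>short_unit_polys d. \<theta> (power_sum d A)) * (\<Sum>f\<in>UNIV - {0}. H f)"
    by (simp add: sum_product sum.cartesian_product)
  also have "(\<Sum>f\<in>UNIV - {0}. H f) = (\<Sum>f\<in>UNIV. \<chi> ((-1) ^ d) ^ d * (char_pow \<chi> d f * \<theta> (- of_nat d * f)))"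
    by (rule sum.mono_neutral_cong_left)
       (auto simp: H_def mchar_mult[OF \<chi>] char_pow_def power_mult_distrib)
  also have "\<dots> = \<chi> ((-1) ^ d) ^ d * (cnj (char_pow \<chi> d (- of_nat d)) * gauss (char_pow \<chi> d))"
    using nd gauss_twist[OF m\<chi>, of "- of_nat d"] by (simp flip: sum_distrib_left)
  also have "\<dots> = cnj (\<chi> (of_nat d)) ^ d * gauss (char_pow \<chi> d)"
  proof -
    have neg: "\<chi> (- of_nat d) = \<chi> (-1) * \<chi> (of_nat d)" using mchar_mult[OF \<chi>, of "-1" "of_nat d"] by simp
    have s: "\<chi> (-1) * \<chi> (-1) = 1" by (rule mchar_minus_one_square[OF \<chi>])
    hence inv: "inverse (\<chi> (-1)) = \<chi> (-1)" by (rule inverse_unique)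
    \<comment> \<open>The sign of the leading coefficient contributes exponent \<open>d * d\<close>
      at \<open>-1\<close> and the twist by \<open>- d\<close> contributes \<open>d\<close>;
      evenness of the total removes both.\<close>
    have "even (d * d + d)" by simp
    then obtain e where e: "d * d + d = 2 * e" by blast
    have "\<chi> ((-1) ^ d) ^ d * \<chi> (-1) ^ d = \<chi> (-1) ^ (d * d + d)"
      by (simp add: mchar_power[OF \<chi>] power_add power_mult)
    also have "\<dots> = 1" unfolding e power_mult power2_eq_square s by simp
    finally have sign: "\<chi> ((-1) ^ d) ^ d * \<chi> (-1) ^ d = 1" .
    have "cnj (char_pow \<chi> d (- of_nat d)) = \<chi> (-1) ^ d * cnj (\<chi> (of_nat d)) ^ d"
      using nd by (simp add: char_pow_def neg power_mult_distrib mchar_cnj[OF \<chi>, of "-1"] inv)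
    thus ?thesis using sign by (metis mult.assoc mult.left_neutral)
  qed
  finally show ?thesis .
qed

text \<open>The constant \<open>C\<close> is common to all characters. For the trivial one the
  factor \<open>-1\<close> from \<open>gauss triv_char\<close> occurs on both sides and cancels,
  which identifies \<open>C\<close> with the product over \<open>1 \<le> i < d\<close>.\<close>

theorem hasse_davenport_product:
  assumes T: "char_generator T" and dt: "d * t = CARD('a) - 1" and \<chi>: "is_mchar \<chi>"
  shows "(\<Prod>i<d. gauss (char_mult \<chi> (char_pow T (i * t))))
       = cnj (\<chi> (of_nat d)) ^ d * gauss (char_pow \<chi> d) * (\<Prod>i\<in>{1..<d}. gauss (char_pow T (i * t)))"
proof -
  have d0: "d > 0" using dt card_field_ge_2[where 'a='a] by (intro gr0I) auto
  have nd: "of_nat d \<noteq> (0::'a)" using of_nat_dvd_card_minus_one[of d] dt by (metis dvd_triv_left)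
  define C where "C = (\<Sum>A\<in>short_unit_polys d. \<theta> (power_sum d A))"
  have main: "(\<Prod>i<d. gauss (char_mult \<psi> (char_pow T (i * t))))
      = C * (cnj (\<psi> (of_nat d)) ^ d * gauss (char_pow \<psi> d))" if \<psi>: "is_mchar \<psi>" for \<psi>
    using arg_cong[OF L_series_power_weight[OF T dt \<psi>], of "\<lambda>F. fps_nth F d"]
    by (simp add: fps_nth_prod_linear L_series_def sum_power_weight[OF dt \<psi>] C_def)
  have triv: "char_mult triv_char (char_pow T k) = char_pow T k" for k
    by (auto simp: char_mult_def triv_char_def char_pow_def)
  have triv_pow: "char_pow triv_char d = (triv_char :: 'a \<Rightarrow> complex)"
    by (auto simp: char_pow_def triv_char_def)
  have "(\<Prod>i<d. gauss (char_pow T (i * t))) = - C"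
    using main[of triv_char] nd by (simp add: triv triv_pow gauss_triv) (simp add: triv_char_def)
  moreover have "{..<d} = insert 0 {1..<d}" using d0 by auto
  ultimately have "C = (\<Prod>i\<in>{1..<d}. gauss (char_pow T (i * t)))" by (simp add: gauss_triv)
  thus ?thesis using main[OF \<chi>] by simp
qed

end

section \<open>Counting points on the affine cone\<close>

text \<open>Extensional functions with a chosen default \<open>z\<close> in place of
  \<open>undefined\<close>, matching the zero padding of \<open>dwork_points\<close> and
  \<open>Wset\<close>.\<close>

definition tuples :: "'b set \<Rightarrow> 'b \<Rightarrow> nat \<Rightarrow> (nat \<Rightarrow> 'b) set" where
  "tuples B z d = {x. (\<forall>i<d. x i \<in> B) \<and> (\<forall>i\<ge>d. x i = z)}"

lemma bij_betw_tuples_PiE: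
  "bij_betw (\<lambda>p i. if i < d then p i else z) ({..<d} \<rightarrow>\<^sub>E B) (tuples B z d)"
proof (rule bij_betw_byWitness[where f' = "\<lambda>x. restrict x {..<d}"])
  show "\<forall>p\<in>{..<d} \<rightarrow>\<^sub>E B. restrict (\<lambda>i. if i < d then p i else z) {..<d} = p"
    by (auto simp: fun_eq_iff PiE_def extensional_def)
qed (auto simp: tuples_def fun_eq_iff PiE_def)

lemma finite_tuples: "finite B \<Longrightarrow> finite (tuples B z d)"
  using bij_betw_finite[OF bij_betw_tuples_PiE[of d z B]] by (simp add: finite_PiE)

lemma card_tuples: "finite B \<Longrightarrow> card (tuples B z d) = card B ^ d"
  using bij_betw_same_card[OF bij_betw_tuples_PiE[of d z B]] by (simp add: card_PiE)

lemma sum_tuples_prod: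
  fixes f :: "'b \<Rightarrow> 'c::comm_semiring_1"
  assumes "finite B"
  shows "(\<Sum>x\<in>tuples B z d. \<Prod>i<d. f (x i)) = (\<Sum>y\<in>B. f y) ^ d"
proof -
  have "(\<Sum>x\<in>tuples B z d. \<Prod>i<d. f (x i)) = (\<Sum>p\<in>{..<d} \<rightarrow>\<^sub>E B. \<Prod>i<d. f (p i))"
    unfolding sum.reindex_bij_betw[OF bij_betw_tuples_PiE, symmetric] by simp
  also have "\<dots> = (\<Prod>i<d. \<Sum>y\<in>B. f y)"
    using assms by (subst prod_sum_PiE) auto
  finally show ?thesis by simp
qed

text \<open>Nonzero scalars act freely on nonzero vectors, so each class of proportional vectors in
  \<open>S\<close> has \<open>q - 1\<close> members.\<close>

lemma card_cone:
  fixes S :: "(nat \<Rightarrow> 'a::{field,finite}) set"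
  assumes fin: "finite S" and nz: "\<And>x. x \<in> S \<Longrightarrow> \<exists>i. x i \<noteq> 0"
    and scale: "\<And>x c. x \<in> S \<Longrightarrow> c \<noteq> 0 \<Longrightarrow> (\<lambda>i. c * x i) \<in> S"
  shows "card S = (CARD('a) - 1) * card ((\<lambda>x. {(\<lambda>i. c * x i) | c. c \<noteq> 0}) ` S)"
proof -
  define L where "L x = {(\<lambda>i. c * x i) | c :: 'a. c \<noteq> 0}" for x :: "nat \<Rightarrow> 'a"
  have self: "x \<in> L x" for x unfolding L_def by (rule CollectI, rule exI[of _ 1]) auto
  have L_eq: "L y = L x" if yx: "y \<in> L x" for x y
  proof -
    obtain c where c: "c \<noteq> 0" "y = (\<lambda>i. c * x i)" using yx by (auto simp: L_def)
    have "(\<lambda>i. e * y i) \<in> L x" if "e \<noteq> 0" for e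
      unfolding L_def using that c by (intro CollectI exI[of _ "e * c"]) (auto simp: mult.assoc)
    moreover have "(\<lambda>i. e * x i) \<in> L y" if "e \<noteq> 0" for e
      unfolding L_def using that c by (intro CollectI exI[of _ "e / c"]) (auto simp: mult.assoc)
    ultimately show ?thesis by (auto simp: L_def)
  qed
  have fibre: "card {x \<in> S. L x = C} = CARD('a) - 1" if CS: "C \<in> L ` S" for C
  proof -
    obtain y where y: "y \<in> S" "C = L y" using CS by blast
    obtain i where i: "y i \<noteq> 0" using nz[OF y(1)] by blast
    have "{x \<in> S. L x = C} = L y"
    proof (intro equalityI subsetI)
      fix x assume "x \<in> {x \<in> S. L x = C}"
      thus "x \<in> L y" using self[of x] y(2) by simp
    next
      fix x assume x: "x \<in> L y"
      hence "x \<in> S" using scale[OF y(1)] by (auto simp: L_def)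
      thus "x \<in> {x \<in> S. L x = C}" using L_eq[OF x] y(2) by simp
    qed
    also have "L y = (\<lambda>c i. c * y i) ` (UNIV - {0})" by (auto simp: L_def)
    also have "card \<dots> = card (UNIV - {0 :: 'a})"
    proof (rule card_image, rule inj_onI)
      fix c e :: 'a assume "(\<lambda>i. c * y i) = (\<lambda>i. e * y i)"
      hence "c * y i = e * y i" by metis
      thus "c = e" using i by simp
    qed
    finally show ?thesis by simp
  qed
  have "card S = (\<Sum>C\<in>L ` S. card {x \<in> S. L x = C})"
    using sum.image_gen[OF fin, of "\<lambda>_. 1::nat" L] by simp
  also have "\<dots> = (CARD('a) - 1) * card (L ` S)" by (simp add: fibre)
  finally show ?thesis by (simp add: L_def[abs_def])
qed

definition dwork_form :: "nat \<Rightarrow> 'a::field \<Rightarrow> (nat \<Rightarrow> 'a) \<Rightarrow> 'a" where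
  "dwork_form d lam x = (\<Sum>i<d. x i ^ d) - of_nat d * lam * (\<Prod>i<d. x i)"

definition dwork_cone :: "nat \<Rightarrow> 'a::field \<Rightarrow> (nat \<Rightarrow> 'a) set" where
  "dwork_cone d lam = {x \<in> tuples UNIV 0 d. dwork_form d lam x = 0}"

lemma card_dwork_cone:
  fixes lam :: "'a::{field,finite}"
  assumes "d > 0"
  shows "card (dwork_cone d lam) = (CARD('a) - 1) * card (dwork_points d lam) + 1"
proof -
  \<comment> \<open>The vertex of the cone is removed here and accounts for the final
    \<open>+ 1\<close>.\<close>
  define S where "S = dwork_cone d lam - {\<lambda>i. 0}"
  have fin: "finite (dwork_cone d lam)"
    unfolding dwork_cone_def by (intro finite_Collect_conjI disjI1) (simp add: finite_tuples)
  have S: "S = {x. (\<forall>i\<ge>d. x i = 0) \<and> (\<exists>i<d. x i \<noteq> 0) \<and>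
      (\<Sum>i<d. x i ^ d) = of_nat d * lam * (\<Prod>i<d. x i)}"
    by (auto simp: S_def dwork_cone_def tuples_def dwork_form_def fun_eq_iff) (metis not_le)+
  have "card S = (CARD('a) - 1) * card ((\<lambda>x. {(\<lambda>i. c * x i) | c. c \<noteq> 0}) ` S)"
  proof (rule card_cone)
    fix x :: "nat \<Rightarrow> 'a" and c :: 'a assume "x \<in> S" "c \<noteq> 0"
    moreover have "dwork_form d lam (\<lambda>i. c * x i) = c ^ d * dwork_form d lam x"
      by (simp add: dwork_form_def power_mult_distrib prod.distrib algebra_simps sum_distrib_left)
    ultimately show "(\<lambda>i. c * x i) \<in> S"
      by (auto simp: S_def dwork_cone_def tuples_def fun_eq_iff)
  qed (use fin in \<open>auto simp: S_def fun_eq_iff\<close>)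
  hence "card S = (CARD('a) - 1) * card (dwork_points d lam)"
    unfolding S dwork_points_def .
  moreover have zero: "(\<lambda>i. 0) \<in> dwork_cone d lam"
    using assms by (simp add: dwork_cone_def tuples_def dwork_form_def power_0_left)
  have "card (dwork_cone d lam) = card S + 1"
    by (rule trans[OF card.remove[OF fin zero]]) (simp add: S_def)
  ultimately show ?thesis by simp
qed

lemma Wset_eq_tuples: "d > 0 \<Longrightarrow> Wset d = {w \<in> tuples {..<d} 0 d. d dvd (\<Sum>i<d. w i)}"
  by (auto simp: Wset_def tuples_def mod_eq_0_iff_dvd)

lemma finite_Wset: "d > 0 \<Longrightarrow> finite (Wset d)"
  unfolding Wset_eq_tuples by (intro finite_Collect_conjI disjI1) (simp add: finite_tuples)

lemma Wset_nonzero_eq_tuples: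
  "d > 0 \<Longrightarrow> {w \<in> Wset d. \<forall>i<d. w i \<noteq> 0} = {w \<in> tuples {1..<d} 0 d. d dvd (\<Sum>i<d. w i)}"
  by (auto simp: Wset_def tuples_def mod_eq_0_iff_dvd)

section \<open>Character sums of the power map and the Gauss sum form of the count\<close>

context gauss_field
begin

text \<open>The case \<open>k = 1\<close> of \<open>card_power_fibre\<close>, transported along
  \<open>to_ac\<close>. The sum over \<open>y\<close> may include \<open>0\<close> because
  characters vanish there.\<close>

lemma sum_power_eq_char_sum:
  fixes T h :: "'a \<Rightarrow> complex"
  assumes T: "char_generator T" and dt: "d * t = CARD('a) - 1"
  shows "(\<Sum>x\<in>UNIV - {0}. h (x ^ d)) = (\<Sum>i<d. \<Sum>y\<in>UNIV. char_pow T (i * t) y * h y)"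
proof -
  have fibre: "of_nat (card {x \<in> UNIV - {0}. x ^ d = y}) = (\<Sum>i<d. char_pow T (i * t) y)"
    if y: "y \<in> UNIV - {0}" for y :: 'a
  proof -
    have U: "fixed_units (Suc 0) = to_ac ` (UNIV - {0 :: 'a})"
      using frobenius_fixed_iff by (auto simp: fixed_units_def)
    have yU: "to_ac y \<in> fixed_units (Suc 0)" using y by (auto simp: U)
    have "{b \<in> fixed_units (Suc 0). b ^ d = to_ac y} = to_ac ` {x \<in> UNIV - {0}. x ^ d = y}"
      by (auto simp: U simp flip: to_ac_power)
    hence "card {b \<in> fixed_units (Suc 0). b ^ d = to_ac y} = card {x \<in> UNIV - {0}. x ^ d = y}"
      by (simp add: card_image inj_on_def)
    moreover have "field_norm (Suc 0) (to_ac y) = y" by (simp add: field_norm_def)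
    ultimately show ?thesis using card_power_fibre[OF T dt yU] by simp
  qed
  have d0: "d > 0" using dt card_field_ge_2[where 'a='a] by (intro gr0I) auto
  have "(\<Sum>x\<in>UNIV - {0}. h (x ^ d)) = (\<Sum>y\<in>UNIV - {0}. \<Sum>x\<in>{x \<in> UNIV - {0}. x ^ d = y}. h (x ^ d))"
    by (rule sum.group[symmetric]) auto
  also have "\<dots> = (\<Sum>y\<in>UNIV - {0}. of_nat (card {x \<in> UNIV - {0}. x ^ d = y}) * h y)"
    by (intro sum.cong refl) simp
  also have "\<dots> = (\<Sum>y\<in>UNIV - {0}. \<Sum>i<d. char_pow T (i * t) y * h y)"
    by (intro sum.cong refl) (simp only: fibre sum_distrib_right)
  also have "\<dots> = (\<Sum>y\<in>UNIV. \<Sum>i<d. char_pow T (i * t) y * h y)"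
    by (rule sum.mono_neutral_left) (auto simp: char_pow_def)
  also have "\<dots> = (\<Sum>i<d. \<Sum>y\<in>UNIV. char_pow T (i * t) y * h y)" by (rule sum.swap)
  finally show ?thesis .
qed

lemma sum_char_theta_power:
  assumes T: "char_generator T" and dt: "d * t = CARD('a) - 1" and z: "z \<noteq> 0"
  shows "(\<Sum>x\<in>UNIV. char_pow T (d * j) x * \<theta> (z * x ^ d))
       = (\<Sum>i<d. cnj (char_pow T (i * t + j) z) * gauss (char_pow T (i * t + j)))"
proof -
  have mT: "is_mchar T" by (rule is_mchar_generator[OF T])
  have m: "is_mchar (char_pow T k)" for k using mT by auto
  have "(\<Sum>x\<in>UNIV. char_pow T (d * j) x * \<theta> (z * x ^ d))
      = (\<Sum>x\<in>UNIV - {0}. char_pow T j (x ^ d) * \<theta> (z * x ^ d))"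
    by (rule sum.mono_neutral_cong_right)
       (auto simp: char_pow_def mchar_power[OF mT] power_mult)
  also have "\<dots> = (\<Sum>i<d. \<Sum>y\<in>UNIV. char_pow T (i * t) y * (char_pow T j y * \<theta> (z * y)))"
    by (rule sum_power_eq_char_sum[OF T dt, of "\<lambda>y. char_pow T j y * \<theta> (z * y)"])
  also have "\<dots> = (\<Sum>i<d. \<Sum>y\<in>UNIV. char_pow T (i * t + j) y * \<theta> (z * y))"
    by (simp add: char_pow_add char_mult_def mult.assoc)
  finally show ?thesis by (simp only: gauss_twist[OF m z])
qed

text \<open>The value \<open>1\<close> at \<open>x = 0\<close> cancels the summand
  \<open>i = 0\<close>, whose Gauss sum is \<open>-1\<close>. This is the source of the condition
  that all entries of the tuple be nonzero.\<close>

lemma sum_theta_power: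
  assumes T: "char_generator T" and dt: "d * t = CARD('a) - 1" and z: "z \<noteq> 0"
  shows "(\<Sum>x\<in>UNIV. \<theta> (z * x ^ d))
       = (\<Sum>i\<in>{1..<d}. cnj (char_pow T (i * t) z) * gauss (char_pow T (i * t)))"
proof -
  have d0: "d > 0" using dt card_field_ge_2[where 'a='a] by (intro gr0I) auto
  have "(\<Sum>x\<in>UNIV. \<theta> (z * x ^ d)) = 1 + (\<Sum>x\<in>UNIV - {0}. \<theta> (z * x ^ d))"
    using d0 by (subst sum.remove[of _ 0]) (auto simp: power_0_left theta_0)
  also have "(\<Sum>x\<in>UNIV - {0}. \<theta> (z * x ^ d)) = (\<Sum>x\<in>UNIV. char_pow T (d * 0) x * \<theta> (z * x ^ d))"
    by (rule sum.mono_neutral_cong_left) (auto simp: triv_char_def)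
  also have "\<dots> = (\<Sum>i<d. cnj (char_pow T (i * t) z) * gauss (char_pow T (i * t)))"
    unfolding sum_char_theta_power[OF T dt z] by simp
  also have "{..<d} = insert 0 {1..<d}" using d0 by auto
  finally show ?thesis using z by (simp add: gauss_triv) (simp add: triv_char_def)
qed

text \<open>Substituting \<open>v * x\<close> for \<open>x\<close> with \<open>v ^ d = 1\<close>
  keeps the additive factor and multiplies the sum by \<open>char_pow T m v\<close>. This is not
  \<open>1\<close> for \<open>v = y ^ t\<close>, where \<open>y\<close> is a unit on which the
  nontrivial \<open>char_pow T (t * m)\<close> differs from \<open>1\<close>.\<close>

lemma sum_char_theta_power_eq_0:
  assumes T: "char_generator T" and dt: "d * t = CARD('a) - 1" and m: "\<not> d dvd m"
  shows "(\<Sum>x\<in>UNIV. char_pow T m x * \<theta> (z * x ^ d)) = 0"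
proof -
  have mT: "is_mchar T" by (rule is_mchar_generator[OF T])
  have mm: "is_mchar (char_pow T m)" using mT by auto
  have t0: "t > 0" using dt card_field_ge_2[where 'a='a] by (intro gr0I) auto
  have "\<not> (CARD('a) - 1) dvd (t * m)" 
    unfolding dt[symmetric] mult.commute[of d t] using m t0 by simp
  hence "char_pow T (t * m) \<noteq> triv_char" using char_pow_generator_eq_triv_iff[OF T] by blast
  then obtain y where y: "y \<noteq> 0" "T y ^ (t * m) \<noteq> 1"
    by (auto simp: fun_eq_iff char_pow_def triv_char_def split: if_splits)
  define v where "v = y ^ t"
  have v0: "v \<noteq> 0" using y by (simp add: v_def)
  have vd: "v ^ d = 1"
    unfolding v_def power_mult[symmetric] mult.commute[of t d] dt
    by (rule field_power_card_minus_one[OF y(1)])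
  have Tv: "char_pow T m v \<noteq> 1" using y v0
    by (simp add: char_pow_def v_def mchar_power[OF mT] power_mult)
  define S where "S = (\<Sum>x\<in>UNIV. char_pow T m x * \<theta> (z * x ^ d))"
  have "S = (\<Sum>x\<in>UNIV. char_pow T m (v * x) * \<theta> (z * (v * x) ^ d))"
    unfolding S_def
    by (rule sum.reindex_bij_witness[of _ "\<lambda>x. v * x" "\<lambda>x. x / v"]) (use v0 in auto)
  also have "\<dots> = char_pow T m v * S"
    by (simp add: S_def mchar_mult[OF mm] power_mult_distrib vd sum_distrib_left mult.assoc)
  finally show ?thesis using Tv by (simp add: S_def)
qed

text \<open>Expanding the power gives a sum over tuples. The outer character cancels the
  \<open>j\<close>-part of the \<open>d\<close> conjugate characters, leaving the conjugate of
  \<open>char_pow T (t * s)\<close> with \<open>s\<close> the sum of the entries; summing over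
  \<open>z\<close> keeps only \<open>d dvd s\<close>, which is the congruence defining
  \<open>Wset\<close>.\<close>

lemma sum_twisted_power:
  assumes T: "char_generator T" and dt: "d * t = CARD('a) - 1" and B: "finite B"
  shows "(\<Sum>z\<in>UNIV - {0}. char_pow T (d * j) z *
            (\<Sum>i\<in>B. cnj (char_pow T (i * t + j) z) * gauss (char_pow T (i * t + j))) ^ d)
       = (of_nat CARD('a) - 1) *
         (\<Sum>w | w \<in> tuples B 0 d \<and> d dvd (\<Sum>i<d. w i). \<Prod>i<d. gauss (char_pow T (w i * t + j)))"
proof -
  have mT: "is_mchar T" by (rule is_mchar_generator[OF T])
  have m: "is_mchar (char_pow T k)" for k using mT by auto
  have t0: "t > 0" using dt card_field_ge_2[where 'a='a] by (intro gr0I) auto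
  have prod: "char_pow T (d * j) z * (\<Prod>i<d. cnj (char_pow T (w i * t + j) z)) = cnj (char_pow T (t * (\<Sum>i<d. w i)) z)"
    if z: "z \<noteq> 0" for z and w :: "nat \<Rightarrow> nat"
  proof -
    have Tz: "T z * cnj (T z) = 1" using mchar_cnj[OF mT, of z] mchar_nonzero[OF mT z] by simp
    have "(\<Prod>i<d. cnj (char_pow T (w i * t + j) z)) = (\<Prod>i<d. cnj (T z) ^ (w i * t + j))"
      using z by (simp add: char_pow_def)
    also have "\<dots> = cnj (T z) ^ (\<Sum>i<d. w i * t + j)" by (simp add: power_sum)
    also have "(\<Sum>i<d. w i * t + j) = t * (\<Sum>i<d. w i) + d * j"
      by (simp add: sum.distrib sum_distrib_left mult.commute)
    finally have "char_pow T (d * j) z * (\<Prod>i<d. cnj (char_pow T (w i * t + j) z))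
        = (T z * cnj (T z)) ^ (d * j) * cnj (T z) ^ (t * (\<Sum>i<d. w i))"
      using z by (simp add: char_pow_def power_add power_mult_distrib)
    thus ?thesis using z by (simp add: Tz char_pow_def)
  qed
  have orth: "(\<Sum>z\<in>UNIV - {0}. cnj (char_pow T (t * s) z)) = (if d dvd s then of_nat CARD('a) - 1 else 0)" for s
  proof -
    have "(\<Sum>z\<in>UNIV - {0}. cnj (char_pow T (t * s) z)) = cnj (\<Sum>z\<in>UNIV. char_pow T (t * s) z)"
      unfolding cnj_sum by (rule sum.mono_neutral_left) (auto simp: char_pow_def)
    also have "\<dots> = (if char_pow T (t * s) = triv_char then of_nat CARD('a) - 1 else 0)"
      by (simp add: sum_mchar[OF m])
    also have "char_pow T (t * s) = triv_char \<longleftrightarrow> d dvd s"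
      unfolding char_pow_generator_eq_triv_iff[OF T] dt[symmetric] mult.commute[of d t] using t0 by simp
    finally show ?thesis .
  qed
  have "(\<Sum>z\<in>UNIV - {0}. char_pow T (d * j) z *
            (\<Sum>i\<in>B. cnj (char_pow T (i * t + j) z) * gauss (char_pow T (i * t + j))) ^ d)
     = (\<Sum>z\<in>UNIV - {0}. \<Sum>w\<in>tuples B 0 d. (char_pow T (d * j) z * (\<Prod>i<d. cnj (char_pow T (w i * t + j) z)))
          * (\<Prod>i<d. gauss (char_pow T (w i * t + j))))"
    unfolding sum_tuples_prod[OF B, where z = 0, symmetric] by (simp add: sum_distrib_left prod.distrib mult.assoc)
  also have "\<dots> = (\<Sum>z\<in>UNIV - {0}. \<Sum>w\<in>tuples B 0 d. cnj (char_pow T (t * (\<Sum>i<d. w i)) z)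
          * (\<Prod>i<d. gauss (char_pow T (w i * t + j))))"
    by (intro sum.cong refl) (simp add: prod)
  also have "\<dots> = (\<Sum>w\<in>tuples B 0 d. (\<Sum>z\<in>UNIV - {0}. cnj (char_pow T (t * (\<Sum>i<d. w i)) z))
          * (\<Prod>i<d. gauss (char_pow T (w i * t + j))))"
    by (subst sum.swap) (simp add: sum_distrib_right)
  also have "\<dots> = (\<Sum>w\<in>tuples B 0 d. if d dvd (\<Sum>i<d. w i)
       then (of_nat CARD('a) - 1) * (\<Prod>i<d. gauss (char_pow T (w i * t + j))) else 0)"
    unfolding orth by (intro sum.cong refl) simp
  also have "\<dots> = (\<Sum>w | w \<in> tuples B 0 d \<and> d dvd (\<Sum>i<d. w i).
       (of_nat CARD('a) - 1) * (\<Prod>i<d. gauss (char_pow T (w i * t + j))))"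
    by (rule sum.inter_filter[symmetric]) (rule finite_tuples[OF B])
  finally show ?thesis by (simp add: sum_distrib_left)
qed

end

lemma mchar_prod:
  assumes "is_mchar \<chi>"
  shows "\<chi> (\<Prod>i\<in>A. f i) = (\<Prod>i\<in>A. \<chi> (f i))"
  by (induction A rule: infinite_finite_induct) (simp_all add: mchar_1[OF assms] mchar_mult[OF assms])

lemma sum_multiples:
  fixes F :: "nat \<Rightarrow> 'b::comm_monoid_add"
  assumes "d > 0" "\<And>m. \<not> d dvd m \<Longrightarrow> F m = 0"
  shows "(\<Sum>m<d * t. F m) = (\<Sum>j<t. F (d * j))"
proof -
  have "(\<Sum>m<d * t. F m) = (\<Sum>m\<in>(\<lambda>j. d * j) ` {..<t}. F m)"
  proof (rule sum.mono_neutral_right)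
    show "\<forall>m\<in>{..<d * t} - (\<lambda>j. d * j) ` {..<t}. F m = 0"
    proof
      fix m assume m: "m \<in> {..<d * t} - (\<lambda>j. d * j) ` {..<t}"
      show "F m = 0"
      proof (rule assms(2), rule notI)
        assume "d dvd m"
        then obtain j where "m = d * j" by blast
        thus False using m assms(1) by auto
      qed
    qed
  qed (use assms(1) in auto)
  also have "\<dots> = (\<Sum>j<t. F (d * j))"
    using assms(1) by (subst sum.reindex) (auto simp: inj_on_def)
  finally show ?thesis .
qed

context gauss_field
begin

lemma card_minus_one_nonzero: "of_nat CARD('a) - 1 \<noteq> (0 :: complex)"
proof -
  have "CARD('a) \<noteq> 1" using card_field_ge_2[where 'a='a] by simp
  hence "of_nat CARD('a) \<noteq> (of_nat 1 :: complex)" unfolding of_nat_eq_iff .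
  thus ?thesis by simp
qed

lemma card_dwork_cone_eq_character_sum:
  "of_nat CARD('a) * of_nat (card (dwork_cone d lam))
     = of_nat CARD('a) ^ d + (\<Sum>z\<in>UNIV - {0}. \<Sum>x\<in>tuples UNIV 0 d. \<theta> (dwork_form d lam x * z))"
proof -
  let ?V = "tuples UNIV 0 d :: (nat \<Rightarrow> 'a) set"
  have finV: "finite ?V" by (simp add: finite_tuples)
  have "(\<Sum>z\<in>UNIV. \<Sum>x\<in>?V. \<theta> (dwork_form d lam x * z)) = (\<Sum>x\<in>?V. if dwork_form d lam x = 0 then of_nat CARD('a) else 0)"
    by (subst sum.swap) (simp add: sum_theta)
  also have "\<dots> = (\<Sum>x | x \<in> ?V \<and> dwork_form d lam x = 0. of_nat CARD('a))"
    by (rule sum.inter_filter[symmetric, OF finV])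
  also have "\<dots> = of_nat CARD('a) * of_nat (card (dwork_cone d lam))"
    by (simp add: dwork_cone_def)
  finally have "of_nat CARD('a) * of_nat (card (dwork_cone d lam))
      = (\<Sum>z\<in>UNIV. \<Sum>x\<in>?V. \<theta> (dwork_form d lam x * z))" by simp
  also have "\<dots> = (\<Sum>x\<in>?V. \<theta> (dwork_form d lam x * 0)) + (\<Sum>z\<in>UNIV - {0}. \<Sum>x\<in>?V. \<theta> (dwork_form d lam x * z))"
    by (rule sum.remove) auto
  also have "(\<Sum>x\<in>?V. \<theta> (dwork_form d lam x * 0)) = of_nat CARD('a) ^ d"
    by (simp add: theta_0 card_tuples)
  finally show ?thesis .
qed

lemma sum_theta_dwork_form:
  assumes T: "char_generator T"
  shows "(\<Sum>x\<in>tuples UNIV 0 d. \<theta> (dwork_form d lam x * z))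
       = (\<Sum>x\<in>UNIV. \<theta> (z * x ^ d)) ^ d
         + of_nat CARD('a) / (of_nat CARD('a) - 1) *
           (\<Sum>m<CARD('a) - 1. char_pow T m (of_nat d * lam) / gauss (char_pow T m) *
              (char_pow T m z * (\<Sum>x\<in>UNIV. char_pow T m x * \<theta> (z * x ^ d)) ^ d))"
proof -
  let ?V = "tuples UNIV 0 d :: (nat \<Rightarrow> 'a) set"
  let ?c = "of_nat CARD('a) / (of_nat CARD('a) - 1) :: complex"
  let ?g = "\<lambda>m. gauss (char_pow T m)"
  have m: "is_mchar (char_pow T k)" for k using T by (auto simp: char_generator_def)
  have "\<theta> (dwork_form d lam x * z) = (\<Prod>i<d. \<theta> (z * x i ^ d)) +
      ?c * (\<Sum>k<CARD('a) - 1. char_pow T k (of_nat d * lam) / ?g k *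
         (char_pow T k z * (\<Prod>i<d. char_pow T k (x i) * \<theta> (z * x i ^ d))))" for x
  proof -
    define u where "u = z * (of_nat d * lam) * (\<Prod>i<d. x i)"
    have "dwork_form d lam x * z = (\<Sum>i<d. z * x i ^ d) + - u"
      by (simp add: dwork_form_def u_def algebra_simps sum_distrib_left)
    hence "\<theta> (dwork_form d lam x * z) = (\<Prod>i<d. \<theta> (z * x i ^ d)) * \<theta> (- u)"
      by (simp only: theta_add theta_sum)
    \<comment> \<open>The monomial enters the form with a minus sign and
      \<open>theta_expansion\<close> evaluates characters at the negated argument, so no sign is
      left.\<close>
    also have "\<theta> (- u) = 1 + ?c * (\<Sum>k<CARD('a) - 1. char_pow T k u / ?g k)"
      using theta_expansion[OF T, of "- u"] by simp
    also have "(\<Sum>k<CARD('a) - 1. char_pow T k u / ?g k) = (\<Sum>k<CARD('a) - 1.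
        char_pow T k (of_nat d * lam) / ?g k * (char_pow T k z * (\<Prod>i<d. char_pow T k (x i))))"
      by (intro sum.cong refl) (simp add: u_def mchar_mult[OF m] mchar_prod[OF m])
    finally show ?thesis by (simp add: prod.distrib sum_distrib_left algebra_simps)
  qed
  hence "(\<Sum>x\<in>?V. \<theta> (dwork_form d lam x * z)) = (\<Sum>x\<in>?V. \<Prod>i<d. \<theta> (z * x i ^ d)) +
      ?c * (\<Sum>x\<in>?V. \<Sum>k<CARD('a) - 1. char_pow T k (of_nat d * lam) / ?g k *
         (char_pow T k z * (\<Prod>i<d. char_pow T k (x i) * \<theta> (z * x i ^ d))))"
    by (simp add: sum.distrib sum_distrib_left)
  also have "(\<Sum>x\<in>?V. \<Sum>k<CARD('a) - 1. char_pow T k (of_nat d * lam) / ?g k *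
         (char_pow T k z * (\<Prod>i<d. char_pow T k (x i) * \<theta> (z * x i ^ d))))
      = (\<Sum>k<CARD('a) - 1. char_pow T k (of_nat d * lam) / ?g k *
         (char_pow T k z * (\<Sum>x\<in>?V. \<Prod>i<d. char_pow T k (x i) * \<theta> (z * x i ^ d))))"
    by (subst sum.swap) (simp add: sum_distrib_left)
  finally show ?thesis
    by (simp only: sum_tuples_prod[of UNIV "\<lambda>y. \<theta> (z * y ^ d)"]
        sum_tuples_prod[of UNIV "\<lambda>y. char_pow T k y * \<theta> (z * y ^ d)" for k] finite)
qed

lemma card_dwork_cone_gauss:
  fixes lam :: 'a
  assumes T: "char_generator T" and dt: "d * t = CARD('a) - 1"
  shows "of_nat CARD('a) * of_nat (card (dwork_cone d lam)) = of_nat CARD('a) ^ d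
     + (of_nat CARD('a) - 1) * (\<Sum>w | w \<in> Wset d \<and> (\<forall>i<d. w i \<noteq> 0). \<Prod>i<d. gauss (char_pow T (w i * t)))
     + of_nat CARD('a) * (\<Sum>j<t. \<Sum>w\<in>Wset d. (\<Prod>i<d. gauss (char_pow T (w i * t + j)))
          / gauss (char_pow T (d * j)) * char_pow T (d * j) (of_nat d * lam))"
proof -
  have d0: "d > 0" using dt card_field_ge_2[where 'a='a] by (intro gr0I) auto
  let ?U = "UNIV - {0 :: 'a}"
  let ?c = "of_nat CARD('a) / (of_nat CARD('a) - 1) :: complex"
  define a where "a m = char_pow T m (of_nat d * lam) / gauss (char_pow T m)" for m
  define B where "B m z = (\<Sum>x\<in>UNIV. char_pow T m x * \<theta> (z * x ^ d))" for m z
  have "(\<Sum>z\<in>?U. \<Sum>x\<in>tuples UNIV 0 d. \<theta> (dwork_form d lam x * z))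
      = (\<Sum>z\<in>?U. (\<Sum>x\<in>UNIV. \<theta> (z * x ^ d)) ^ d)
        + ?c * (\<Sum>z\<in>?U. \<Sum>m<CARD('a) - 1. a m * (char_pow T m z * B m z ^ d))"
    unfolding sum_theta_dwork_form[OF T] a_def B_def by (simp add: sum.distrib sum_distrib_left)
  also have "(\<Sum>z\<in>?U. (\<Sum>x\<in>UNIV. \<theta> (z * x ^ d)) ^ d)
      = (\<Sum>z\<in>?U. char_pow T (d * 0) z *
          (\<Sum>i\<in>{1..<d}. cnj (char_pow T (i * t + 0) z) * gauss (char_pow T (i * t + 0))) ^ d)"
    by (intro sum.cong refl) (simp add: sum_theta_power[OF T dt] triv_char_def)
  also have "\<dots> = (of_nat CARD('a) - 1) *
      (\<Sum>w | w \<in> Wset d \<and> (\<forall>i<d. w i \<noteq> 0). \<Prod>i<d. gauss (char_pow T (w i * t)))"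
    using sum_twisted_power[OF T dt, of "{1..<d}" 0] Wset_nonzero_eq_tuples[OF d0] by simp
  also have "(\<Sum>z\<in>?U. \<Sum>m<CARD('a) - 1. a m * (char_pow T m z * B m z ^ d))
      = (\<Sum>m<CARD('a) - 1. a m * (\<Sum>z\<in>?U. char_pow T m z * B m z ^ d))"
    by (subst sum.swap) (simp add: sum_distrib_left)
  \<comment> \<open>Only exponents divisible by \<open>d\<close> survive, and
    \<open>m < d * t\<close> leaves \<open>t\<close> of them.\<close>
  also have "\<dots> = (\<Sum>j<t. a (d * j) * (\<Sum>z\<in>?U. char_pow T (d * j) z * B (d * j) z ^ d))"
    unfolding dt[symmetric]
  proof (rule sum_multiples[OF d0])
    fix m assume "\<not> d dvd m"
    hence "B m z = 0" for z unfolding B_def by (rule sum_char_theta_power_eq_0[OF T dt])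
    thus "a m * (\<Sum>z\<in>?U. char_pow T m z * B m z ^ d) = 0" using d0 by (simp add: power_0_left)
  qed
  also have "\<dots> = (\<Sum>j<t. a (d * j) * ((of_nat CARD('a) - 1) *
      (\<Sum>w\<in>Wset d. \<Prod>i<d. gauss (char_pow T (w i * t + j)))))"
  proof (rule sum.cong[OF refl])
    fix j
    have "(\<Sum>z\<in>?U. char_pow T (d * j) z * B (d * j) z ^ d) = (\<Sum>z\<in>?U. char_pow T (d * j) z *
        (\<Sum>i<d. cnj (char_pow T (i * t + j) z) * gauss (char_pow T (i * t + j))) ^ d)"
      unfolding B_def by (intro sum.cong refl) (simp add: sum_char_theta_power[OF T dt])
    also have "\<dots> = (of_nat CARD('a) - 1) * (\<Sum>w\<in>Wset d. \<Prod>i<d. gauss (char_pow T (w i * t + j)))"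
      using sum_twisted_power[OF T dt, of "{..<d}" j] Wset_eq_tuples[OF d0] by simp
    finally show "a (d * j) * (\<Sum>z\<in>?U. char_pow T (d * j) z * B (d * j) z ^ d)
        = a (d * j) * ((of_nat CARD('a) - 1) * (\<Sum>w\<in>Wset d. \<Prod>i<d. gauss (char_pow T (w i * t + j))))"
      by simp
  qed
  \<comment> \<open>The factor \<open>q - 1\<close> from the sum over \<open>z\<close> cancels the
    denominator of the expansion.\<close>
  also have "?c * \<dots> = of_nat CARD('a) * (\<Sum>j<t. \<Sum>w\<in>Wset d. (\<Prod>i<d. gauss (char_pow T (w i * t + j)))
          / gauss (char_pow T (d * j)) * char_pow T (d * j) (of_nat d * lam))"
    using card_minus_one_nonzero by (simp add: a_def sum_distrib_left mult_ac)
  finally show ?thesis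
    unfolding card_dwork_cone_eq_character_sum by (simp add: algebra_simps)
qed

end

section \<open>Greene's hypergeometric function in terms of Gauss sums\<close>

context gauss_field
begin

text \<open>Greene's binomial conjugates its lower entry, so at the conjugate of \<psi> it is a
  Jacobi sum of \<open>A\<close> times that conjugate with \<psi> itself. The product of these two
  characters is \<open>A\<close>.\<close>

lemma char_binom_gauss:
  assumes A: "is_mchar A" and \<psi>: "is_mchar \<psi>" and nt: "A \<noteq> triv_char"
  shows "char_binom (char_mult A (\<lambda>x. cnj (\<psi> x))) (\<lambda>x. cnj (\<psi> x))
       = \<psi> (-1) * gauss \<psi> / of_nat CARD('a) * (gauss (char_mult (\<lambda>x. cnj (\<psi> x)) A) / gauss A)"
proof -
  have c: "is_mchar (\<lambda>x. cnj (\<psi> x))" using \<psi> by (rule is_mchar_cnj)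
  have AB: "char_mult (char_mult A (\<lambda>x. cnj (\<psi> x))) \<psi> = A"
  proof
    fix x show "char_mult (char_mult A (\<lambda>x. cnj (\<psi> x))) \<psi> x = A x"
      using mchar_nonzero[OF \<psi>, of x] mchar_0[OF A]
      by (cases "x = 0") (auto simp: char_mult_def mchar_cnj[OF \<psi>])
  qed
  have comm: "char_mult A (\<lambda>x. cnj (\<psi> x)) = char_mult (\<lambda>x. cnj (\<psi> x)) A"
    by (auto simp: char_mult_def)
  have "cnj (\<psi> (-1)) = \<psi> (-1)"
    unfolding mchar_cnj[OF \<psi>] by (rule inverse_unique[OF mchar_minus_one_square[OF \<psi>]])
  moreover have "(\<Sum>x\<in>UNIV. char_mult A (\<lambda>x. cnj (\<psi> x)) x * \<psi> (1 - x))
      = gauss (char_mult A (\<lambda>x. cnj (\<psi> x))) * gauss \<psi> / gauss A"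
    using jacobi_sum[OF is_mchar_char_mult[OF A c] \<psi>] nt unfolding AB by blast
  ultimately show ?thesis unfolding char_binom_def comm by simp
qed

text \<open>The product formula for the conjugate of \<psi> evaluates the numerators. It also
  contains the factor \<open>i = 0\<close>, which explains the division by the Gauss sum of the
  conjugate of \<psi>; its factors without \<psi> are exactly the denominators here.\<close>

lemma prod_char_binom:
  assumes T: "char_generator T" and dt: "d * t = CARD('a) - 1" and \<psi>: "is_mchar \<psi>"
  shows "(\<Prod>i\<in>{1..<d}. char_binom (char_mult (char_pow T (i * t)) (\<lambda>x. cnj (\<psi> x))) (\<lambda>x. cnj (\<psi> x)))
       = (\<psi> (-1) * gauss \<psi> / of_nat CARD('a)) ^ (d - 1) *
         (\<psi> (of_nat d) ^ d * gauss (char_pow (\<lambda>x. cnj (\<psi> x)) d) / gauss (\<lambda>x. cnj (\<psi> x)))"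
proof -
  let ?\<chi> = "\<lambda>x. cnj (\<psi> x)"
  have d0: "d > 0" and t0: "t > 0" using dt card_field_ge_2[where 'a='a] by (auto intro!: gr0I)
  have m: "is_mchar (char_pow T k)" for k using T by (auto simp: char_generator_def)
  have c: "is_mchar ?\<chi>" using \<psi> by (rule is_mchar_cnj)
  have nt: "char_pow T (i * t) \<noteq> triv_char" if "i \<in> {1..<d}" for i
  proof
    assume "char_pow T (i * t) = triv_char"
    hence "d * t dvd i * t" unfolding char_pow_generator_eq_triv_iff[OF T] dt[symmetric] .
    hence "d dvd i" using t0 by simp
    thus False using that by (auto dest: dvd_imp_le)
  qed
  have "(\<Prod>i\<in>{1..<d}. char_binom (char_mult (char_pow T (i * t)) ?\<chi>) ?\<chi>)
      = (\<Prod>i\<in>{1..<d}. \<psi> (-1) * gauss \<psi> / of_nat CARD('a) *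
           (gauss (char_mult ?\<chi> (char_pow T (i * t))) / gauss (char_pow T (i * t))))"
    by (intro prod.cong refl char_binom_gauss[OF m \<psi> nt])
  also have "\<dots> = (\<psi> (-1) * gauss \<psi> / of_nat CARD('a)) ^ (d - 1) *
      ((\<Prod>i\<in>{1..<d}. gauss (char_mult ?\<chi> (char_pow T (i * t)))) / (\<Prod>i\<in>{1..<d}. gauss (char_pow T (i * t))))"
  proof -
    have "(\<Prod>i\<in>{1..<d}. k * (f i / h i)) = k ^ (d - 1) * ((\<Prod>i\<in>{1..<d}. f i) / (\<Prod>i\<in>{1..<d}. h i))"
      for k and f h :: "nat \<Rightarrow> complex"
      by (simp add: prod.distrib prod_dividef)
    thus ?thesis .
  qed
  also have "(\<Prod>i\<in>{1..<d}. gauss (char_mult ?\<chi> (char_pow T (i * t)))) / (\<Prod>i\<in>{1..<d}. gauss (char_pow T (i * t)))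
      = \<psi> (of_nat d) ^ d * gauss (char_pow ?\<chi> d) / gauss ?\<chi>"
  proof -
    have triv: "char_mult ?\<chi> triv_char = ?\<chi>" using mchar_0[OF \<psi>] by (auto simp: char_mult_def triv_char_def)
    have "{..<d} = insert 0 {1..<d}" using d0 by auto
    hence "(\<Prod>i<d. gauss (char_mult ?\<chi> (char_pow T (i * t))))
        = gauss ?\<chi> * (\<Prod>i\<in>{1..<d}. gauss (char_mult ?\<chi> (char_pow T (i * t))))"
      by (simp add: triv)
    hence "gauss ?\<chi> * (\<Prod>i\<in>{1..<d}. gauss (char_mult ?\<chi> (char_pow T (i * t))))
        = \<psi> (of_nat d) ^ d * gauss (char_pow ?\<chi> d) * (\<Prod>i\<in>{1..<d}. gauss (char_pow T (i * t)))"
      using hasse_davenport_product[OF T dt c] by simp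
    moreover have "(\<Prod>i\<in>{1..<d}. gauss (char_pow T (i * t))) \<noteq> 0" using gauss_nonzero[OF m] by simp
    ultimately show ?thesis using gauss_nonzero[OF c] by (simp add: field_simps)
  qed
  finally show ?thesis .
qed

lemma gauss_cnj:
  assumes "is_mchar \<psi>" "\<psi> \<noteq> triv_char"
  shows "gauss (\<lambda>x. cnj (\<psi> x)) = \<psi> (-1) * of_nat CARD('a) / gauss \<psi>"
  using gauss_mult_cnj[OF assms] gauss_nonzero[OF assms(1)] by (simp add: field_simps)

text \<open>The correction by \<open>gauss \<psi> ^ d / q\<close> when \<open>\<psi> ^ d\<close> is trivial accounts for the constant tuples.\<close>

lemma greene_summand:
  assumes \<psi>: "is_mchar \<psi>" and d: "d \<ge> 2" and lam: "lam \<noteq> 0" and nd: "of_nat d \<noteq> (0 :: 'a)"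
  shows "of_nat CARD('a) ^ (d - 1) / (of_nat CARD('a) - 1) *
      ((\<psi> (-1) * gauss \<psi> / of_nat CARD('a)) ^ (d - 1) *
         (\<psi> (of_nat d) ^ d * gauss (char_pow (\<lambda>x. cnj (\<psi> x)) d) / gauss (\<lambda>x. cnj (\<psi> x))) * \<psi> lam ^ d)
    = 1 / (of_nat CARD('a) - 1) * (gauss \<psi> ^ d / gauss (char_pow \<psi> d) * char_pow \<psi> d (of_nat d * lam))
      + (if \<psi> \<noteq> triv_char \<and> char_pow \<psi> d = triv_char then gauss \<psi> ^ d / of_nat CARD('a) else 0)"
proof -
  define s G q where "s = \<psi> (-1)" and "G = gauss \<psi>" and "q = (of_nat CARD('a) :: complex)"
  have s2: "s * s = 1" unfolding s_def by (rule mchar_minus_one_square[OF \<psi>])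
  hence s0: "s \<noteq> 0" by auto
  have G0: "G \<noteq> 0" unfolding G_def by (rule gauss_nonzero[OF \<psi>])
  have q0: "q \<noteq> 0" by (simp add: q_def)
  have q1: "q - 1 \<noteq> 0" unfolding q_def by (rule card_minus_one_nonzero)
  obtain e where e: "d = Suc e" using d by (cases d) auto
  have m\<psi>: "is_mchar (char_pow \<psi> d)" using \<psi> by auto
  define D where "D = char_pow \<psi> d (of_nat d * lam)"
  have D: "\<psi> (of_nat d) ^ d * \<psi> lam ^ d = D"
    using lam nd by (simp add: D_def char_pow_def mchar_mult[OF \<psi>] power_mult_distrib)
  have cnj_pow: "char_pow (\<lambda>x. cnj (\<psi> x)) d = (\<lambda>x. cnj (char_pow \<psi> d x))"
    by (auto simp: char_pow_def)
  have cnj_triv: "(\<lambda>x. cnj (triv_char x)) = (triv_char :: 'a \<Rightarrow> complex)" by (auto simp: triv_char_def)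
  have pow: "q ^ (d - 1) * (s * G / q) ^ (d - 1) = (s * G) ^ e"
    using q0 by (simp add: e power_divide)
  have lhs: "of_nat CARD('a) ^ (d - 1) / (of_nat CARD('a) - 1) *
      ((\<psi> (-1) * gauss \<psi> / of_nat CARD('a)) ^ (d - 1) *
         (\<psi> (of_nat d) ^ d * gauss (char_pow (\<lambda>x. cnj (\<psi> x)) d) / gauss (\<lambda>x. cnj (\<psi> x))) * \<psi> lam ^ d)
    = 1 / (q - 1) * ((s * G) ^ e * gauss (\<lambda>x. cnj (char_pow \<psi> d x)) / gauss (\<lambda>x. cnj (\<psi> x)) * D)"
    unfolding cnj_pow D[symmetric] s_def[symmetric] G_def[symmetric] q_def[symmetric] pow[symmetric]
    by (simp add: mult_ac)
  have pow_triv: "char_pow triv_char d = (triv_char :: 'a \<Rightarrow> complex)"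
    by (auto simp: char_pow_def triv_char_def)
  consider "\<psi> = triv_char" | "\<psi> \<noteq> triv_char" "char_pow \<psi> d \<noteq> triv_char"
    | "\<psi> \<noteq> triv_char" "char_pow \<psi> d = triv_char" by blast
  thus ?thesis
  proof cases
    case 1
    have "s = 1" using 1 by (simp add: s_def triv_char_def)
    moreover have "G = -1" using 1 by (simp add: G_def gauss_triv)
    ultimately show ?thesis unfolding lhs unfolding G_def[symmetric] D_def[symmetric] q_def[symmetric]
      using 1 by (simp add: pow_triv cnj_triv gauss_triv) (simp add: e)
  next
    case 2
    have s_d: "char_pow \<psi> d (-1) = s ^ d" by (simp add: char_pow_def s_def)
    \<comment> \<open>The signs have exponents \<open>e\<close> from the binomials,
      \<open>d = e + 1\<close> from the Gauss sum of the \<open>d\<close>-th power, and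
      \<open>-1\<close> from the denominator, \<open>2 * e\<close> in total.\<close>
    have "(s * G) ^ e * (s ^ d * q / gauss (char_pow \<psi> d)) / (s * q / G) = (s * s) ^ e * G ^ d / gauss (char_pow \<psi> d)"
      using s0 q0 G0 by (simp add: e power_mult_distrib field_simps)
    also have "\<dots> = G ^ d / gauss (char_pow \<psi> d)" by (simp add: s2)
    finally show ?thesis
      unfolding lhs unfolding gauss_cnj[OF \<psi> 2(1)] gauss_cnj[OF m\<psi> 2(2)] s_d
      using 2 by (simp add: s_def G_def q_def D_def)
  next
    case 3
    have "D = 1" using 3 lam nd by (simp add: D_def triv_char_def)
    \<comment> \<open>Triviality of the \<open>d\<close>-th power at \<open>-1\<close> means
      \<open>s ^ d = 1\<close>, hence \<open>s ^ e = s\<close>, which cancels the sign from the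
      denominator.\<close>
    have "char_pow \<psi> d (-1) = triv_char (-1 :: 'a)" using 3 by simp
    hence "s ^ e * s = 1" by (simp add: s_def char_pow_def triv_char_def e mult.commute)
    hence se: "s ^ e = s" using s2 s0 by (metis mult_right_cancel)
    have "(s * G) ^ e * gauss triv_char / gauss (\<lambda>x. cnj (\<psi> x)) = - (G ^ d) / q"
      unfolding gauss_cnj[OF \<psi> 3(1)] s_def[symmetric] G_def[symmetric] q_def[symmetric] gauss_triv
      using s0 q0 G0 by (simp add: power_mult_distrib se e)
    hence "1 / (q - 1) * ((s * G) ^ e * gauss triv_char / gauss (\<lambda>x. cnj (\<psi> x)) * D)
        = 1 / (q - 1) * (- (G ^ d) / q * D)" by simp
    \<comment> \<open>The partial fraction \<open>-1 / (q * (q - 1)) = -1 / (q - 1) + 1 / q\<close>: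
      its first part has the generic shape, its second is the correction.\<close>
    also have "\<dots> = 1 / (q - 1) * (G ^ d / gauss triv_char * D) + G ^ d / q"
      unfolding \<open>D = 1\<close> gauss_triv using q0 q1 by (simp add: field_simps)
    finally have "1 / (q - 1) * ((s * G) ^ e * gauss triv_char / gauss (\<lambda>x. cnj (\<psi> x)) * D)
        = 1 / (q - 1) * (G ^ d / gauss triv_char * D) + G ^ d / q" .
    thus ?thesis unfolding lhs unfolding 3(2) cnj_triv using 3 by (simp add: G_def q_def D_def)
  qed
qed

text \<open>Conjugation is an involution on the characters. Summing over conjugates turns the
  argument \<open>1 / lam ^ d\<close> of Greene's function into \<open>lam ^ d\<close>.\<close>

lemma sum_mchars_cnj:
  fixes F :: "('a \<Rightarrow> complex) \<Rightarrow> complex"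
  assumes T: "char_generator T"
  shows "(\<Sum>\<chi> | is_mchar \<chi>. F \<chi>) = (\<Sum>j<CARD('a) - 1. F (\<lambda>x. cnj (char_pow T j x)))"
proof -
  have "(\<Sum>\<chi> | is_mchar \<chi>. F \<chi>) = (\<Sum>\<chi> | is_mchar \<chi>. F (\<lambda>x. cnj (\<chi> x)))"
    by (rule sum.reindex_bij_witness[of _ "\<lambda>\<chi> x. cnj (\<chi> x)" "\<lambda>\<chi> x. cnj (\<chi> x)"])
       (auto intro: is_mchar_cnj)
  thus ?thesis
    unfolding mchars_eq_char_pow_image(1)[OF T] sum.reindex[OF mchars_eq_char_pow_image(2)[OF T]]
    by simp
qed

lemma greeneF_gauss:
  assumes T: "char_generator T" and dt: "d * t = CARD('a) - 1" and d: "d \<ge> 2" and lam: "lam \<noteq> 0"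
  shows "of_nat CARD('a) ^ (d - 2) *
      greeneF (d - 2) (\<lambda>i. char_pow T ((i + 1) * t)) (\<lambda>i. triv_char) (1 / lam ^ d)
    = 1 / (of_nat CARD('a) - 1) * (\<Sum>j<CARD('a) - 1. gauss (char_pow T j) ^ d
          / gauss (char_pow T (d * j)) * char_pow T (d * j) (of_nat d * lam))
      + 1 / of_nat CARD('a) * (\<Sum>c\<in>{1..<d}. gauss (char_pow T (c * t)) ^ d)"
proof -
  let ?q = "of_nat CARD('a) :: complex"
  have m: "is_mchar (char_pow T k)" for k using T by (auto simp: char_generator_def)
  have t0: "t > 0" using dt card_field_ge_2[where 'a='a] by (auto intro!: gr0I)
  have nd: "of_nat d \<noteq> (0::'a)" using of_nat_dvd_card_minus_one[of d] dt by (metis dvd_triv_left)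
  define H where "H \<chi> = (\<Prod>i\<in>{1..<d}. char_binom (char_mult (char_pow T (i * t)) \<chi>) \<chi>)" for \<chi>
  \<comment> \<open>The upper characters are numbered from \<open>0\<close> but have exponents
    \<open>(i + 1) * t\<close>, and the first binomial lacks an explicit lower character. As the
    others are trivial, all \<open>d - 1\<close> binomials take one form.\<close>
  have H: "char_binom (char_mult (char_pow T ((0 + 1) * t)) \<chi>) \<chi> *
      (\<Prod>i\<in>{1..d - 2}. char_binom (char_mult (char_pow T ((i + 1) * t)) \<chi>) (char_mult triv_char \<chi>)) = H \<chi>"
    if "is_mchar \<chi>" for \<chi>
  proof -
    have "char_mult triv_char \<chi> = \<chi>" using mchar_0[OF that] by (auto simp: char_mult_def triv_char_def)
    moreover have "(\<Prod>i\<in>{0..<d - 1}. char_binom (char_mult (char_pow T ((i + 1) * t)) \<chi>) \<chi>) = H \<chi>"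
      unfolding H_def using d
      by (intro prod.reindex_bij_witness[of _ "\<lambda>i. i - 1" "\<lambda>i. i + 1"]) auto
    moreover have "{0..<d - 1} = insert 0 {1..d - 2}" using d by auto
    ultimately show ?thesis by simp
  qed
  have "?q ^ (d - 2) * greeneF (d - 2) (\<lambda>i. char_pow T ((i + 1) * t)) (\<lambda>i. triv_char) (1 / lam ^ d)
      = ?q ^ (d - 2) * (?q / (?q - 1) * (\<Sum>\<chi> | is_mchar \<chi>. H \<chi> * \<chi> (1 / lam ^ d)))"
    unfolding greeneF_def by (simp add: H[simplified] mult.assoc)
  also have "\<dots> = ?q ^ (d - 1) / (?q - 1) * (\<Sum>\<chi> | is_mchar \<chi>. H \<chi> * \<chi> (1 / lam ^ d))"
  proof -
    have "d - 1 = Suc (d - 2)" using d by simp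
    thus ?thesis by simp
  qed
  also have "\<dots> = (\<Sum>j<CARD('a) - 1. ?q ^ (d - 1) / (?q - 1) *
      (H (\<lambda>x. cnj (char_pow T j x)) * cnj (char_pow T j (1 / lam ^ d))))"
    unfolding sum_mchars_cnj[OF T] sum_distrib_left ..
  also have "\<dots> = (\<Sum>j<CARD('a) - 1. 1 / (?q - 1) * (gauss (char_pow T j) ^ d
          / gauss (char_pow T (d * j)) * char_pow T (d * j) (of_nat d * lam))
      + (if char_pow T j \<noteq> triv_char \<and> char_pow T (d * j) = triv_char
           then gauss (char_pow T j) ^ d / ?q else 0))"
  proof (rule sum.cong[OF refl])
    fix j
    have "cnj (char_pow T j (1 / lam ^ d)) = char_pow T j lam ^ d"
      using mchar_inverse[OF m, of j "lam ^ d"] mchar_cnj[OF m, of j "inverse (lam ^ d)"] mchar_power[OF m, of j lam d]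
      by (simp add: field_simps)
    thus "?q ^ (d - 1) / (?q - 1) * (H (\<lambda>x. cnj (char_pow T j x)) * cnj (char_pow T j (1 / lam ^ d)))
      = 1 / (?q - 1) * (gauss (char_pow T j) ^ d
          / gauss (char_pow T (d * j)) * char_pow T (d * j) (of_nat d * lam))
      + (if char_pow T j \<noteq> triv_char \<and> char_pow T (d * j) = triv_char
           then gauss (char_pow T j) ^ d / ?q else 0)"
      using greene_summand[OF m[of j] d lam nd]
      unfolding H_def prod_char_binom[OF T dt m] char_pow_pow mult.commute[of j d] by simp
  qed
  also have "\<dots> = 1 / (?q - 1) * (\<Sum>j<CARD('a) - 1. gauss (char_pow T j) ^ d
          / gauss (char_pow T (d * j)) * char_pow T (d * j) (of_nat d * lam))
      + (\<Sum>j<CARD('a) - 1. if char_pow T j \<noteq> triv_char \<and> char_pow T (d * j) = triv_char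
           then gauss (char_pow T j) ^ d / ?q else 0)"
    unfolding sum.distrib sum_distrib_left ..
  also have "(\<Sum>j<CARD('a) - 1. if char_pow T j \<noteq> triv_char \<and> char_pow T (d * j) = triv_char
           then gauss (char_pow T j) ^ d / ?q else 0)
      = (\<Sum>j | j \<in> {..<CARD('a) - 1} \<and> char_pow T j \<noteq> triv_char \<and> char_pow T (d * j) = triv_char.
           gauss (char_pow T j) ^ d / ?q)"
    by (rule sum.inter_filter[symmetric]) simp
  \<comment> \<open>With \<open>q - 1 = d * t\<close> the conditions on \<open>j\<close> read:
    \<open>d * t\<close> divides \<open>d * j\<close> but not \<open>j\<close>. So \<open>j\<close>
    is a nonzero multiple of \<open>t\<close>, corresponding to the constant tuple with entry
    \<open>j / t\<close>.\<close>
  also have "{j \<in> {..<CARD('a) - 1}. char_pow T j \<noteq> triv_char \<and> char_pow T (d * j) = triv_char}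
      = (\<lambda>c. c * t) ` {1..<d}"
  proof (intro equalityI subsetI)
    fix j assume "j \<in> {j \<in> {..<CARD('a) - 1}. char_pow T j \<noteq> triv_char \<and> char_pow T (d * j) = triv_char}"
    hence j: "j < d * t" "\<not> d * t dvd j" "d * t dvd d * j"
      unfolding char_pow_generator_eq_triv_iff[OF T] dt[symmetric] by auto
    hence "t dvd j" using d by simp
    then obtain c where c: "j = t * c" by blast
    thus "j \<in> (\<lambda>c. c * t) ` {1..<d}" using j t0
      by (intro image_eqI[of _ _ c]) (auto simp: Suc_le_eq intro!: gr0I)
  next
    fix j assume "j \<in> (\<lambda>c. c * t) ` {1..<d}"
    then obtain c where "j = c * t" "c \<in> {1..<d}" by (rule imageE)
    hence c: "j = c * t" "0 < c" "c < d" by auto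
    have "\<not> d * t dvd c * t" using c t0 by (auto dest: dvd_imp_le)
    moreover have "d * t dvd d * (c * t)" by simp
    ultimately show "j \<in> {j \<in> {..<CARD('a) - 1}. char_pow T j \<noteq> triv_char \<and> char_pow T (d * j) = triv_char}"
      unfolding char_pow_generator_eq_triv_iff[OF T] dt[symmetric] using c t0 by simp
  qed
  also have "(\<Sum>j\<in>(\<lambda>c. c * t) ` {1..<d}. gauss (char_pow T j) ^ d / ?q)
      = 1 / ?q * (\<Sum>c\<in>{1..<d}. gauss (char_pow T (c * t)) ^ d)"
    using t0 by (subst sum.reindex) (auto simp: inj_on_def sum_divide_distrib)
  finally show ?thesis .
qed

end

section \<open>Classes of exponent tuples\<close>

text \<open>The action of the integers modulo \<open>d\<close> by adding
  \<open>k (1, ..., 1)\<close>, whose orbits on \<open>Wset\<close> are the classes; zero is kept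
  from index \<open>d\<close> on to stay within the encoding of \<open>Wset\<close>.\<close>

definition shift_tuple :: "nat \<Rightarrow> nat \<Rightarrow> (nat \<Rightarrow> nat) \<Rightarrow> nat \<Rightarrow> nat" where
  "shift_tuple d k w = (\<lambda>i. if i < d then (w i + k) mod d else 0)"

lemma equiv_Wrel: "equiv (Wset d) (Wrel d)"
proof (rule equivI)
  show "refl_on (Wset d) (Wrel d)"
    by (auto simp: refl_on_def Wrel_def intro!: exI[of _ 0])
  show "sym (Wrel d)"
  proof (rule symI)
    fix w w' assume ww': "(w, w') \<in> Wrel d"
    then obtain k where k: "\<forall>i<d. [int (w i) - int (w' i) = k] (mod int d)" by (auto simp: Wrel_def)
    have "[int (w' i) - int (w i) = - k] (mod int d)" if "i < d" for i
    proof -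
      have "[- (int (w i) - int (w' i)) = - k] (mod int d)"
        using k that by (simp only: cong_minus_minus_iff)
      thus ?thesis by simp
    qed
    thus "(w', w) \<in> Wrel d" using ww' by (auto simp: Wrel_def)
  qed
  show "trans (Wrel d)"
  proof (rule transI)
    fix u v w assume uv: "(u, v) \<in> Wrel d" and vw: "(v, w) \<in> Wrel d"
    obtain k l where k: "\<forall>i<d. [int (u i) - int (v i) = k] (mod int d)"
      and l: "\<forall>i<d. [int (v i) - int (w i) = l] (mod int d)" using uv vw by (auto simp: Wrel_def)
    have "[int (u i) - int (w i) = k + l] (mod int d)" if "i < d" for i
      using cong_add[OF k[rule_format, OF that] l[rule_format, OF that]] by simp
    thus "(u, w) \<in> Wrel d" using uv vw by (auto simp: Wrel_def)
  qed
qed (auto simp: Wrel_def)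

text \<open>A shift changes the sum of the entries by a multiple of \<open>d\<close>, so it stays in
  \<open>Wset\<close>. The entry at index \<open>0\<close> already recovers \<open>k\<close> modulo
  \<open>d\<close>, so every class has exactly \<open>d\<close> members.\<close>

lemma Wrel_class:
  assumes d: "d > 0" and w: "w \<in> Wset d"
  shows "Wrel d `` {w} = (\<lambda>k. shift_tuple d k w) ` {..<d}"
    and "inj_on (\<lambda>k. shift_tuple d k w) {..<d}"
proof -
  show "Wrel d `` {w} = (\<lambda>k. shift_tuple d k w) ` {..<d}"
  proof (intro equalityI subsetI)
    fix v assume "v \<in> Wrel d `` {w}"
    then obtain k where v: "v \<in> Wset d" and k: "\<And>i. i < d \<Longrightarrow> [int (w i) - int (v i) = k] (mod int d)"
      by (auto simp: Wrel_def)
    \<comment> \<open>The relation records \<open>w - v\<close>, whereas the shift leads from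
      \<open>w\<close> to \<open>v\<close>; hence the sign.\<close>
    define l where "l = nat ((- k) mod int d)"
    have l: "int l = (- k) mod int d" using d by (simp add: l_def)
    have "l < d" using d by (simp add: l_def nat_less_iff)
    moreover have "v = shift_tuple d l w"
    proof
      fix i
      show "v i = shift_tuple d l w i"
      proof (cases "i < d")
        case True
        have "int ((w i + l) mod d) = (int (w i) - k) mod int d"
          by (simp add: zmod_int l mod_simps)
        also have "\<dots> = int (v i) mod int d"
          using cong_diff[OF cong_refl[of "int (w i)"] k[OF True]] by (simp add: cong_def)
        also have "\<dots> = int (v i)" using v True by (simp add: Wset_def)
        finally show ?thesis using True by (simp add: shift_tuple_def)
      qed (use v in \<open>auto simp: Wset_def shift_tuple_def\<close>)
    qed
    ultimately show "v \<in> (\<lambda>k. shift_tuple d k w) ` {..<d}" by blast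
  next
    fix v assume "v \<in> (\<lambda>k. shift_tuple d k w) ` {..<d}"
    then obtain k where v: "v = shift_tuple d k w" by blast
    have "(\<Sum>i<d. v i) mod d = (\<Sum>i<d. w i + k) mod d"
      using mod_sum_eq[of "\<lambda>i. w i + k" d "{..<d}"] by (simp add: v shift_tuple_def)
    also have "\<dots> = 0" using w by (simp add: sum.distrib Wset_def mod_simps)
    finally have "v \<in> Wset d" using d by (auto simp: Wset_def v shift_tuple_def)
    moreover have "[int (w i) - int (v i) = - int k] (mod int d)" if "i < d" for i
      using that by (simp add: v shift_tuple_def zmod_int cong_def mod_simps)
    ultimately show "v \<in> Wrel d `` {w}" using w by (auto simp: Wrel_def)
  qed
  show "inj_on (\<lambda>k. shift_tuple d k w) {..<d}"
  proof (rule inj_onI)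
    fix k l assume kl: "k \<in> {..<d}" "l \<in> {..<d}" "shift_tuple d k w = shift_tuple d l w"
    have "(w 0 + k) mod d = (w 0 + l) mod d"
      using d fun_cong[OF kl(3), of 0] by (simp add: shift_tuple_def)
    hence "[w 0 + k = w 0 + l] (mod d)" by (simp add: cong_def)
    hence "[k = l] (mod d)" by (simp only: cong_add_lcancel_nat)
    thus "k = l" using kl by (simp add: cong_def)
  qed
qed

lemma sum_split_residues: "(\<Sum>j<d * t. f j) = (\<Sum>k<d. \<Sum>j<t. f (j + k * t))"
  for f :: "nat \<Rightarrow> 'b::comm_monoid_add"
proof -
  have "(\<Sum>j<a + b. f j) = (\<Sum>j<a. f j) + (\<Sum>j<b. f (j + a))" for a b
    by (induction b) (simp_all add: add_ac)
  note split = this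
  show ?thesis
  proof (induction d)
    case (Suc d)
    have "(\<Sum>j<Suc d * t. f j) = (\<Sum>j<d * t + t. f j)" by (simp add: add.commute)
    also have "\<dots> = (\<Sum>k<Suc d. \<Sum>j<t. f (j + k * t))" unfolding split Suc by simp
    finally show ?case .
  qed simp
qed

text \<open>Each of the \<open>d\<close> members of a class sees the range \<open>j < t\<close>. By
  \<open>shift\<close>, the \<open>k\<close>-th member acts as the representative on the
  \<open>k\<close>-th block of length \<open>t\<close>, and the blocks join to
  \<open>j < d * t\<close>. The second claim frees the sum from the choice made by
  \<open>SOME\<close>.\<close>

lemma sum_over_classes:
  fixes E :: "(nat \<Rightarrow> nat) \<Rightarrow> nat \<Rightarrow> complex"
  assumes d: "d > 0"
    and shift: "\<And>w k j. w \<in> Wset d \<Longrightarrow> E (shift_tuple d k w) j = E w (j + k * t)"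
  shows "(\<Sum>j<t. \<Sum>w\<in>Wset d. E w j) = (\<Sum>C\<in>Wset d // Wrel d. \<Sum>j<d * t. E (SOME w. w \<in> C) j)"
    and "w \<in> Wset d \<Longrightarrow> (\<Sum>j<d * t. E (SOME v. v \<in> Wrel d `` {w}) j) = (\<Sum>j<d * t. E w j)"
proof -
  have class_sum: "(\<Sum>v\<in>Wrel d `` {w}. \<Sum>j<t. E v j) = (\<Sum>j<d * t. E w j)" if w: "w \<in> Wset d" for w
  proof -
    have "(\<Sum>v\<in>Wrel d `` {w}. \<Sum>j<t. E v j) = (\<Sum>k<d. \<Sum>j<t. E (shift_tuple d k w) j)"
      unfolding Wrel_class(1)[OF d w] by (subst sum.reindex[OF Wrel_class(2)[OF d w]]) simp
    also have "\<dots> = (\<Sum>j<d * t. E w j)"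
      unfolding sum_split_residues by (simp add: shift[OF w])
    finally show ?thesis .
  qed
  have rep: "(SOME v. v \<in> C) \<in> Wset d \<and> Wrel d `` {SOME v. v \<in> C} = C" if C: "C \<in> Wset d // Wrel d" for C
  proof -
    obtain w where w: "w \<in> Wset d" "C = Wrel d `` {w}" using C by (rule quotientE)
    define v where "v = (SOME v. v \<in> C)"
    have "w \<in> C" using w equiv_class_self[OF equiv_Wrel] by blast
    hence v: "v \<in> C" unfolding v_def by (rule someI[where P = "\<lambda>v. v \<in> C"])
    hence wv: "(w, v) \<in> Wrel d" using w by simp
    have "Wrel d `` {w} = Wrel d `` {v}" by (rule equiv_class_eq[OF equiv_Wrel wv])
    hence C_eq: "Wrel d `` {v} = C" using w(2) by simp
    have "v \<in> Wset d" using wv by (auto simp: Wrel_def)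
    thus ?thesis using C_eq unfolding v_def by (rule conjI)
  qed
  have "(\<Sum>j<t. \<Sum>w\<in>Wset d. E w j) = (\<Sum>w\<in>\<Union>(Wset d // Wrel d). \<Sum>j<t. E w j)"
    unfolding Union_quotient[OF equiv_Wrel] by (rule sum.swap)
  also have "\<dots> = (\<Sum>C\<in>Wset d // Wrel d. \<Sum>w\<in>C. \<Sum>j<t. E w j)"
  proof -
    have "\<forall>C\<in>Wset d // Wrel d. finite C"
      using finite_Wset[OF d] in_quotient_imp_subset[OF equiv_Wrel] by (metis finite_subset)
    moreover have "\<forall>A\<in>Wset d // Wrel d. \<forall>B\<in>Wset d // Wrel d. A \<noteq> B \<longrightarrow> A \<inter> B = {}"
      using quotient_disj[OF equiv_Wrel] by blast
    ultimately show ?thesis by (simp add: sum.Union_disjoint)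
  qed
  also have "\<dots> = (\<Sum>C\<in>Wset d // Wrel d. \<Sum>j<d * t. E (SOME w. w \<in> C) j)"
  proof (rule sum.cong[OF refl])
    fix C assume C: "C \<in> Wset d // Wrel d"
    show "(\<Sum>w\<in>C. \<Sum>j<t. E w j) = (\<Sum>j<d * t. E (SOME w. w \<in> C) j)"
      using class_sum[OF conjunct1[OF rep[OF C]]] unfolding conjunct2[OF rep[OF C]] .
  qed
  finally show "(\<Sum>j<t. \<Sum>w\<in>Wset d. E w j) = (\<Sum>C\<in>Wset d // Wrel d. \<Sum>j<d * t. E (SOME w. w \<in> C) j)" .
  show "(\<Sum>j<d * t. E (SOME v. v \<in> Wrel d `` {w}) j) = (\<Sum>j<d * t. E w j)" if w: "w \<in> Wset d"
  proof -
    note rep' = rep[OF quotientI[OF w]]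
    show ?thesis
      using class_sum[OF conjunct1[OF rep']] class_sum[OF w] unfolding conjunct2[OF rep'] by simp
  qed
qed

text \<open>A constant tuple with entry \<open>c\<close> has entry sum \<open>d * c\<close>, so it
  meets the congruence for every \<open>c\<close>.\<close>

lemma Wset_nonzero_eq_Wss_Un:
  assumes "d \<ge> 2"
  shows "{w \<in> Wset d. \<forall>i<d. w i \<noteq> 0} = Wss d \<union> (\<lambda>c i. if i < d then c else 0) ` {1..<d}"
proof (intro equalityI subsetI)
  fix w assume w: "w \<in> {w \<in> Wset d. \<forall>i<d. w i \<noteq> 0}"
  show "w \<in> Wss d \<union> (\<lambda>c i. if i < d then c else 0) ` {1..<d}"
  proof (cases "\<forall>i<d. \<forall>j<d. w i = w j")
    case True
    hence w0: "w i = w 0" if "i < d" for i using that assms by (meson order_less_le_trans pos2)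
    have "w = (\<lambda>i. if i < d then w 0 else 0)"
    proof
      fix i show "w i = (if i < d then w 0 else 0)"
        using w0[of i] w by (cases "i < d") (auto simp: Wset_def)
    qed
    moreover have "w 0 \<in> {1..<d}" using w assms by (auto simp: Wset_def Suc_le_eq)
    ultimately show ?thesis by blast
  qed (use w in \<open>auto simp: Wss_def\<close>)
qed (auto simp: Wss_def Wset_def)

lemma sum_Wset_nonzero:
  fixes f :: "nat \<Rightarrow> complex"
  assumes "d \<ge> 2"
  shows "(\<Sum>w | w \<in> Wset d \<and> (\<forall>i<d. w i \<noteq> 0). \<Prod>i<d. f (w i))
       = (\<Sum>w\<in>Wss d. \<Prod>i<d. f (w i)) + (\<Sum>c\<in>{1..<d}. f c ^ d)"
proof -
  let ?c = "\<lambda>c i. if i < d then c else 0 :: nat"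
  have inj: "inj_on ?c {1..<d}"
  proof (rule inj_onI)
    fix a b assume "?c a = ?c b"
    from fun_cong[OF this, of 0] show "a = b" using assms by simp
  qed
  have "(\<Sum>w | w \<in> Wset d \<and> (\<forall>i<d. w i \<noteq> 0). \<Prod>i<d. f (w i))
      = (\<Sum>w\<in>Wss d. \<Prod>i<d. f (w i)) + (\<Sum>w\<in>?c ` {1..<d}. \<Prod>i<d. f (w i))"
    unfolding Wset_nonzero_eq_Wss_Un[OF assms]
  proof (rule sum.union_disjoint)
    show "finite (Wss d)" using finite_Wset[of d] assms by (simp add: Wss_def)
  qed (auto simp: Wss_def)
  also have "(\<Sum>w\<in>?c ` {1..<d}. \<Prod>i<d. f (w i)) = (\<Sum>c\<in>{1..<d}. f c ^ d)"
    unfolding sum.reindex[OF inj] by simp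
  finally show ?thesis .
qed

section \<open>The trace character\<close>

context finite_field_card
begin

text \<open>The \<open>p\<close> distinct images of the residues are roots of
  \<open>X ^ p - X\<close>, which has no room for more.\<close>

lemma prime_field_eq_image: "{y :: 'a. y ^ p = y} = of_nat ` {..<p}"
  and inj_of_nat_prime_field: "inj_on (of_nat :: nat \<Rightarrow> 'a) {..<p}"
proof -
  show inj: "inj_on (of_nat :: nat \<Rightarrow> 'a) {..<p}"
    by (auto simp: inj_on_def of_nat_eq_iff_cong_CHAR CHAR_eq cong_def)
  have p0: "p > 1" using prime_p by (rule prime_gt_1_nat)
  define P where "P = monom (1 :: 'a) p - monom 1 1"
  have "coeff P p = 1" using p0 by (simp add: P_def)
  hence P0: "P \<noteq> 0" by auto
  have "degree P \<le> p" unfolding P_def using p0 by (intro degree_diff_le) (auto simp: degree_monom_eq)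
  moreover have roots: "{y. poly P y = 0} = {y. y ^ p = y}" by (auto simp: P_def poly_monom)
  ultimately have card: "card {y :: 'a. y ^ p = y} \<le> p" using card_poly_roots_bound[OF P0] by simp
  have "(of_nat m :: 'a) ^ p = of_nat m" for m
  proof (induction m)
    case (Suc m)
    have "(1 + of_nat m :: 'a) ^ p = 1 ^ p + of_nat m ^ p"
      by (rule freshmans_dream) (simp_all add: CHAR_eq prime_p)
    thus ?case using Suc by simp
  qed (use p0 in \<open>simp add: power_0_left\<close>)
  hence sub: "of_nat ` {..<p} \<subseteq> {y :: 'a. y ^ p = y}" by auto
  have "of_nat ` {..<p} = {y :: 'a. y ^ p = y}"
    using sub card by (intro card_seteq) (simp_all add: card_image[OF inj])
  thus "{y :: 'a. y ^ p = y} = of_nat ` {..<p}" by simp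
qed

lemma ftrace_add: "ftrace p n (x + y) = ftrace p n x + ftrace p n (y :: 'a)"
proof -
  have "(x + y) ^ (p ^ k) = x ^ (p ^ k) + y ^ (p ^ k)" for k
    by (rule freshmans_dream'[of _ k]) (simp_all add: CHAR_eq prime_p)
  thus ?thesis by (simp add: ftrace_def sum.distrib)
qed

text \<open>The \<open>p\<close>-th power shifts the summands by one, and the last becomes
  \<open>x ^ q = x\<close>. So the trace lies in the prime field.\<close>

lemma ftrace_power: "ftrace p n (x :: 'a) ^ p = ftrace p n x"
proof -
  have "ftrace p n x ^ p = (\<Sum>k<n. (x ^ (p ^ k)) ^ p)"
    unfolding ftrace_def by (rule freshmans_dream_sum) (simp_all add: CHAR_eq prime_p)
  also have "\<dots> = (\<Sum>k<n. x ^ (p ^ Suc k))" by (simp add: mult.commute flip: power_mult)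
  also have "\<dots> + x ^ (p ^ 0) = (\<Sum>k<Suc n. x ^ (p ^ k))"
    by (simp add: sum.lessThan_Suc_shift del: sum.lessThan_Suc)
  hence "(\<Sum>k<n. x ^ (p ^ Suc k)) = ftrace p n x"
    using field_power_card[of x] by (simp add: ftrace_def card_eq)
  finally show ?thesis .
qed

text \<open>The trace is a polynomial function of degree at most \<open>p ^ (n - 1)\<close>, less
  than \<open>q\<close>, and nonzero since its linear coefficient is \<open>1\<close>; it cannot
  vanish on the whole field.\<close>

lemma ftrace_nonzero: "\<exists>x :: 'a. ftrace p n x \<noteq> 0"
proof (rule ccontr)
  assume "\<not> ?thesis"
  hence all: "ftrace p n x = 0" for x :: 'a by blast
  have p1: "p > 1" using prime_p by (rule prime_gt_1_nat)
  have n0: "n > 0" using card_field_ge_2[where 'a='a] card_eq by (intro gr0I) simp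
  define P where "P = (\<Sum>k<n. monom (1 :: 'a) (p ^ k))"
  have "coeff P (p ^ 0) = (\<Sum>k<n. if k = 0 then 1 else 0)"
    unfolding P_def coeff_sum using p1 by (intro sum.cong refl) (auto simp: coeff_monom)
  also have "\<dots> = 1" using n0 by simp
  finally have P0: "P \<noteq> 0" by auto
  have "degree P \<le> p ^ (n - 1)"
    unfolding P_def
  proof (rule degree_sum_le)
    fix k assume "k \<in> {..<n}"
    hence "p ^ k \<le> p ^ (n - 1)" using p1 by (intro power_increasing) auto
    thus "degree (monom (1 :: 'a) (p ^ k)) \<le> p ^ (n - 1)" by (simp add: degree_monom_eq)
  qed simp
  also have "\<dots> < p ^ n" using p1 n0 by (intro power_strict_increasing) auto
  finally have "degree P < CARD('a)" by (simp add: card_eq)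
  moreover have "{x. poly P x = 0} = UNIV"
    using all by (auto simp: P_def poly_sum poly_monom ftrace_def)
  ultimately show False using card_poly_roots_bound[OF P0] by simp
qed

text \<open>The trace lies in the prime field, so the description by \<open>THE\<close> has a unique
  solution \<tau>. It is additive only modulo \<open>p\<close>, which is enough because
  \<open>\<zeta> ^ p = 1\<close>.\<close>

lemma gauss_field_add_char:
  assumes \<zeta>: "\<zeta> ^ p = 1" "\<zeta> \<noteq> 1"
  shows "gauss_field (add_char p n \<zeta> :: 'a \<Rightarrow> complex) p n"
proof -
  define \<tau> where "\<tau> x = (THE m. m < p \<and> of_nat m = ftrace p n x)" for x :: 'a
  have p0: "p > 0" using prime_p by (rule prime_gt_0_nat)
  have \<tau>: "\<tau> x < p" "of_nat (\<tau> x) = ftrace p n x" for x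
  proof -
    have "ftrace p n x \<in> of_nat ` {..<p}"
      unfolding prime_field_eq_image[symmetric] using ftrace_power by simp
    hence "\<exists>!m. m < p \<and> of_nat m = ftrace p n x"
      using inj_of_nat_prime_field by (auto simp: inj_on_def)
    from theI'[OF this] show "\<tau> x < p" "of_nat (\<tau> x) = ftrace p n x" by (auto simp: \<tau>_def)
  qed
  have pow_mod: "\<zeta> ^ k = \<zeta> ^ (k mod p)" for k
  proof -
    have "\<zeta> ^ (p * (k div p) + k mod p) = \<zeta> ^ (k mod p)"
      by (simp only: power_add power_mult \<zeta>(1) power_one mult_1)
    thus ?thesis by simp
  qed
  have eqI: "\<zeta> ^ k = \<zeta> ^ l" if "of_nat k = (of_nat l :: 'a)" for k l
    using that pow_mod[of k] pow_mod[of l]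
    by (simp add: of_nat_eq_iff_cong_CHAR CHAR_eq cong_def)
  have add_char: "add_char p n \<zeta> x = \<zeta> ^ \<tau> x" for x by (simp add: add_char_def \<tau>_def)
  show ?thesis
  proof unfold_locales
    fix x y :: 'a
    have "\<zeta> ^ \<tau> (x + y) = \<zeta> ^ (\<tau> x + \<tau> y)" by (rule eqI) (simp add: \<tau>(2) ftrace_add)
    thus "add_char p n \<zeta> (x + y) = add_char p n \<zeta> x * add_char p n \<zeta> y"
      by (simp add: add_char power_add)
  next
    have "\<zeta> ^ \<tau> 0 = \<zeta> ^ 0"
      by (rule eqI) (use p0 in \<open>simp add: \<tau>(2) ftrace_def power_0_left\<close>)
    thus "add_char p n \<zeta> (0 :: 'a) = 1" by (simp add: add_char)
  next
    obtain x :: 'a where x: "ftrace p n x \<noteq> 0" using ftrace_nonzero by blast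
    have "\<tau> x \<noteq> 0" using \<tau>(2)[of x] x by (metis of_nat_0)
    hence "\<not> p dvd \<tau> x" using \<tau>(1)[of x] by (auto dest: dvd_imp_le)
    \<comment> \<open>An inverse \<open>k\<close> of \<open>\<tau> x\<close> modulo \<open>p\<close>
      recovers \<zeta> as the \<open>k\<close>-th power of the character value, so that value is not
      \<open>1\<close>.\<close>
    hence "coprime (\<tau> x) p" using prime_p by (metis coprime_commute prime_imp_coprime)
    then obtain k where "[\<tau> x * k = Suc 0] (mod p)" using cong_solve_coprime_nat by blast
    hence "(\<tau> x * k) mod p = 1 mod p" by (simp add: cong_def)
    hence "\<zeta> ^ (\<tau> x * k) = \<zeta> ^ 1" using pow_mod by metis
    hence "(\<zeta> ^ \<tau> x) ^ k \<noteq> 1" using \<zeta>(2) by (simp add: power_mult)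
    hence "add_char p n \<zeta> x \<noteq> 1" by (auto simp: add_char)
    thus "\<exists>x :: 'a. add_char p n \<zeta> x \<noteq> 1" by blast
  qed
qed

end

section \<open>The point count\<close>

context gauss_field
begin

lemma card_dwork_points:
  fixes lam :: 'a
  assumes T: "char_generator T" and dt: "d * t = CARD('a) - 1" and d: "d \<ge> 2"
  shows "of_nat (card (dwork_points d lam)) = (of_nat CARD('a) ^ (d - 1) - 1) / (of_nat CARD('a) - 1)
     + 1 / of_nat CARD('a) * (\<Sum>w | w \<in> Wset d \<and> (\<forall>i<d. w i \<noteq> 0). \<Prod>i<d. gauss (char_pow T (w i * t)))
     + 1 / (of_nat CARD('a) - 1) * (\<Sum>j<t. \<Sum>w\<in>Wset d. (\<Prod>i<d. gauss (char_pow T (w i * t + j)))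
          / gauss (char_pow T (d * j)) * char_pow T (d * j) (of_nat d * lam))"
proof -
  define q where "q = (of_nat CARD('a) :: complex)"
  define S where "S = (\<Sum>w | w \<in> Wset d \<and> (\<forall>i<d. w i \<noteq> 0). \<Prod>i<d. gauss (char_pow T (w i * t)))"
  define R where "R = (\<Sum>j<t. \<Sum>w\<in>Wset d. (\<Prod>i<d. gauss (char_pow T (w i * t + j)))
          / gauss (char_pow T (d * j)) * char_pow T (d * j) (of_nat d * lam))"
  define N where "N = (of_nat (card (dwork_points d lam)) :: complex)"
  have q0: "q \<noteq> 0" and q1: "q - 1 \<noteq> 0" using card_minus_one_nonzero by (auto simp: q_def)
  have "of_nat (card (dwork_cone d lam)) = (q - 1) * N + 1"
    using d card_dwork_cone[of d lam] card_field_ge_2[where 'a='a]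
    by (simp add: q_def N_def of_nat_diff)
  hence "q * ((q - 1) * N + 1) = q ^ d + (q - 1) * S + q * R"
    using card_dwork_cone_gauss[OF T dt, of lam] by (simp add: q_def S_def R_def)
  moreover have "q ^ d = q * q ^ (d - 1)" using d by (cases d) auto
  ultimately have "N * (q * (q - 1)) = q * (q ^ (d - 1) - 1) + (q - 1) * S + q * R"
    by (simp add: algebra_simps)
  also have "\<dots> = ((q ^ (d - 1) - 1) / (q - 1) + 1 / q * S + 1 / (q - 1) * R) * (q * (q - 1))"
    using q0 q1 by (simp add: distrib_right)
  finally have "N = (q ^ (d - 1) - 1) / (q - 1) + 1 / q * S + 1 / (q - 1) * R"
    using q0 q1 by simp
  thus ?thesis by (simp only: N_def q_def S_def R_def)
qed

end

theorem theorem8p1: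
  fixes T :: "'a::{field,finite} \<Rightarrow> complex"
    and lam :: 'a and d p n :: nat and \<zeta> :: complex
  assumes "d \<ge> 2"
    and "prime p" and "n \<ge> 1" and "CARD('a) = p ^ n"
    and "CARD('a) mod d = 1"
    and "\<zeta> ^ p = 1" and "\<zeta> \<noteq> 1"
    and "char_generator T"
    and "lam \<noteq> 0"
  shows
   "(let q = CARD('a); t = (q - 1) div d; g = gauss_sum p n \<zeta> in
     of_nat (card (dwork_points d lam)) =
       (of_nat q ^ (d - 1) - 1) / (of_nat q - 1)
     + of_nat q ^ (d - 2) *
         greeneF (d - 2) (\<lambda>i. char_pow T ((i + 1) * t)) (\<lambda>i. triv_char) (1 / lam ^ d)
     + 1 / of_nat q * (\<Sum>w\<in>Wss d. \<Prod>i<d. g (char_pow T (w i * t)))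
     + 1 / (of_nat q - 1) *
         (\<Sum>C\<in>(Wset d // Wrel d) - {Wrel d `` {(\<lambda>i. 0)}}.
            let w = (SOME w. w \<in> C) in
            \<Sum>j\<in>{0..q - 2}.
              (\<Prod>i<d. g (char_pow T (w i * t + j))) / g (char_pow T (d * j))
                * char_pow T (d * j) (of_nat d * lam)))"
proof -
  interpret ff: finite_field_card p n "TYPE('a)"
    by unfold_locales (use assms in auto)
  interpret gauss_field "add_char p n \<zeta> :: 'a \<Rightarrow> complex" p n
    by (rule ff.gauss_field_add_char[OF assms(6,7)])
  define t where "t = (CARD('a) - 1) div d"
  have q2: "CARD('a) \<ge> 2" by (rule card_field_ge_2)
  have "d dvd CARD('a) - 1" using assms(5) q2 by (metis mod_eq_dvd_iff_nat dvd_minus_mod)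
  hence dt: "d * t = CARD('a) - 1" by (simp add: t_def)
  have d0: "d > 0" using assms(1) by simp
  have T: "char_generator T" and mT: "is_mchar T" using assms(8) by (auto simp: char_generator_def)
  have gauss_eq: "gauss_sum p n \<zeta> = (gauss :: ('a \<Rightarrow> complex) \<Rightarrow> complex)"
    by (auto simp: gauss_sum_def gauss_def fun_eq_iff)
  define E where "E w j = (\<Prod>i<d. gauss (char_pow T (w i * t + j))) / gauss (char_pow T (d * j))
      * char_pow T (d * j) (of_nat d * lam)" for w j
  have shift: "E (shift_tuple d k w) j = E w (j + k * t)" for w k j
  proof -
    \<comment> \<open>The exponents differ by \<open>k * (d * t)\<close>, a multiple of the period
      \<open>q - 1\<close>. The characters in the numerator match for the same reason, reduction of
      an entry modulo \<open>d\<close> becoming reduction modulo \<open>d * t\<close> after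
      multiplication by \<open>t\<close>.\<close>
    have "char_pow T (d * j) = char_pow T (d * (j + k * t))"
    proof (rule char_pow_periodic[OF mT])
      have "d * (j + k * t) = d * j + k * (d * t)" by (simp add: algebra_simps)
      thus "d * j mod (CARD('a) - 1) = d * (j + k * t) mod (CARD('a) - 1)" by (simp add: dt)
    qed
    moreover have "char_pow T (shift_tuple d k w i * t + j) = char_pow T (w i * t + (j + k * t))" if "i < d" for i
    proof (rule char_pow_periodic[OF mT])
      have "(shift_tuple d k w i * t + j) mod (d * t) = (((w i + k) * t) mod (d * t) + j) mod (d * t)"
        using that by (simp add: shift_tuple_def mod_mult_mult2)
      also have "\<dots> = (w i * t + (j + k * t)) mod (d * t)"
        unfolding mod_add_left_eq by (simp add: algebra_simps)
      finally show "(shift_tuple d k w i * t + j) mod (CARD('a) - 1) = (w i * t + (j + k * t)) mod (CARD('a) - 1)"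
        unfolding dt .
    qed
    ultimately show ?thesis by (simp add: E_def)
  qed
  let ?q = "of_nat CARD('a) :: complex" and ?Q = "Wset d // Wrel d" and ?O = "Wrel d `` {\<lambda>i. 0}"
  have zero: "(\<lambda>i. 0) \<in> Wset d" using d0 by (simp add: Wset_def)
  have "(\<Sum>j<t. \<Sum>w\<in>Wset d. E w j) = (\<Sum>C\<in>?Q. \<Sum>j<d * t. E (SOME w. w \<in> C) j)"
    by (rule sum_over_classes(1)[OF d0 shift])
  also have "\<dots> = (\<Sum>j<d * t. E (SOME w. w \<in> ?O) j) + (\<Sum>C\<in>?Q - {?O}. \<Sum>j<d * t. E (SOME w. w \<in> C) j)"
  proof (rule sum.remove)
    show "finite ?Q" using finite_Wset[OF d0] by (rule finite_quotient) (auto simp: Wrel_def)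
    show "?O \<in> ?Q" by (rule quotientI[OF zero])
  qed
  also have "(\<Sum>j<d * t. E (SOME w. w \<in> ?O) j) = (\<Sum>j<d * t. E (\<lambda>i. 0) j)"
    by (rule sum_over_classes(2)[OF d0 shift zero])
  finally have classes: "(\<Sum>j<t. \<Sum>w\<in>Wset d. E w j)
      = (\<Sum>j<d * t. E (\<lambda>i. 0) j) + (\<Sum>C\<in>?Q - {?O}. \<Sum>j<d * t. E (SOME w. w \<in> C) j)" .
  have E0: "E (\<lambda>i. 0) j = gauss (char_pow T j) ^ d / gauss (char_pow T (d * j)) * char_pow T (d * j) (of_nat d * lam)" for j
    by (simp add: E_def)
  have "of_nat (card (dwork_points d lam)) = (?q ^ (d - 1) - 1) / (?q - 1)
     + 1 / ?q * (\<Sum>w | w \<in> Wset d \<and> (\<forall>i<d. w i \<noteq> 0). \<Prod>i<d. gauss (char_pow T (w i * t)))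
     + 1 / (?q - 1) * (\<Sum>j<t. \<Sum>w\<in>Wset d. E w j)"
    unfolding E_def by (rule card_dwork_points[OF T dt assms(1)])
  also have "\<dots> = (?q ^ (d - 1) - 1) / (?q - 1)
     + ?q ^ (d - 2) * greeneF (d - 2) (\<lambda>i. char_pow T ((i + 1) * t)) (\<lambda>i. triv_char) (1 / lam ^ d)
     + 1 / ?q * (\<Sum>w\<in>Wss d. \<Prod>i<d. gauss (char_pow T (w i * t)))
     + 1 / (?q - 1) * (\<Sum>C\<in>?Q - {?O}. \<Sum>j<d * t. E (SOME w. w \<in> C) j)"
    \<comment> \<open>In the Gauss sum form of Greene's function, the sum over \<open>j\<close> is
      the class of \<open>0\<close> and the sum over \<open>c\<close> is the contribution of the
      constant tuples, so both sides have the same terms.\<close>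
    unfolding greeneF_gauss[OF T dt assms(1,9)] classes E0 dt
      sum_Wset_nonzero[OF assms(1), of "\<lambda>k. gauss (char_pow T (k * t))"]
    by (simp only: distrib_left add_ac)
  finally have main: "of_nat (card (dwork_points d lam)) = (?q ^ (d - 1) - 1) / (?q - 1)
     + ?q ^ (d - 2) * greeneF (d - 2) (\<lambda>i. char_pow T ((i + 1) * t)) (\<lambda>i. triv_char) (1 / lam ^ d)
     + 1 / ?q * (\<Sum>w\<in>Wss d. \<Prod>i<d. gauss (char_pow T (w i * t)))
     + 1 / (?q - 1) * (\<Sum>C\<in>?Q - {?O}. \<Sum>j<d * t. E (SOME w. w \<in> C) j)" .
  have range: "{..<d * t} = {0..CARD('a) - 2}" using q2 by (auto simp: dt)
  show ?thesis
    using main unfolding range unfolding E_def Let_def gauss_eq t_def .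
qed

end
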